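(* Suppose the following conditions on the data hold. (Z-i) There exist constants $0<c\le C<\infty$ such that $c\le\lambda_l(\Sigma_n)\le C$ for all $l=1,\dots,d(n)$ and all $n\in\mathbb{N}$, and $$\frac{\max\{d(n)(E_{\mathbf{P}_n}[\|Z_1\|_2^3])^2,\;E_{\mathbf{P}_n}[\|Z_1\|_2^4],\;d(n)^4\}}{n}=o(1).$$ (Z-ii) There exists $\gamma>0$ such that $\frac{d(n)^{2+\gamma}}{n^{\gamma}}E_{\mathbf{P}_n}[\|Z_1\|_2^{4+2\gamma}]=o(1)$. (Z-iii) There exists $\kappa\ge 0$ such that $\frac{(\log d(n))^{\kappa/2}d(n)^{2+\kappa}}{n^{1+\kappa/2}}E_{\mathbf{P}_n}[\|Z_1\|_{2+\kappa}^{2(2+\kappa)}]=o(1)$. Suppose also that the bootstrap weights satisfy, for all $n$ and $i=1,\dots,n$: (W-i) conditionally on $Z^n$, $\omega_{1n},\dots,\omega_{nn}$ are independent with $E_{\mathbf{P}_n^*(\cdot|Z^n)}[\omega_{in}]=0$ and $E_{\mathbf{P}_n^*(\cdot|Z^n)}[\omega_{in}^2]=1$; (W-ii) there exist $q\ge\max\{\gamma+2,4\}$ (with $\gamma$ from (Z-ii)) and a constant $C_w>0$ such that $E_{\mathbf{P}_n^*(\cdot|Z^n)}[|\omega_{in}|^q]\le C_w<\infty$. Then $$\sup_{t\in\mathbb{R}}\left|\mathbf{P}_n^*\left(\|\sqrt n\,\mathbb{Z}_n^*\|_2^2\ge t\mid Z^n\right)-\mathbf{P}_n\left(\|\sqrt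 n\,\mathbb{Z}_n\|_2^2\ge t\right)\right|=o_{\mathbf{P}_n}(1).$$
   Context: $(d(n))_{n}$ is a non-decreasing sequence of positive integers (possibly diverging). For each $n$, $Z^n=(Z_{1,n},\dots,Z_{n,n})$ are independent $\mathbb{R}^{d(n)}$-valued random vectors with common law $\mathbf{P}_n$, mean zero, and finite positive definite covariance $\Sigma_n=E_{\mathbf{P}_n}[Z_{i,n}Z_{i,n}^T]$ with eigenvalues $\lambda_1(\Sigma_n),\dots,\lambda_{d(n)}(\Sigma_n)$; the subscript $n$ is dropped, writing $Z_i$; $\mathbf{P}_n$ also denotes the probability governing $Z^n$. For $x\in\mathbb{R}^d$, $\|x\|_p^p=\sum_{l=1}^d|x_l|^p$, so $\|x\|_{p}^{2p}=(\sum_l|x_l|^p)^2$. The real bootstrap weights $(\omega_{1n},\dots,\omega_{nn})$ have, conditionally on $Z^n$, law $\mathbf{P}_n^*(\cdot|Z^n)$. Put $\mathbb{Z}_n=n^{-1}\sum_{i=1}^nZ_i$ and $\mathbb{Z}_n^*=n^{-1}\sum_{i=1}^n\omega_{in}Z_i$. The notation $|f(Z^n)|=o_{\mathbf{P}_n}(1)$ means: for any $\varepsilon>0$ there is $N(\varepsilon)$ such that $\mathbf{P}_n(|f(Z^n)|\ge\varepsilon)<\varepsilon$ for all $n\ge N(\varepsilon)$. *)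

theory Defs
  imports "HOL-Probability.Probability" "Jordan_Normal_Form.Char_Poly"
begin

text \<open>
  The dimension varies with the sample size inside a single statement, so a vector of dimension
  \<open>d\<close> is an extensional function on \<open>{..<d}\<close>; coordinates are numbered from \<open>0\<close> as in \<open>mat\<close>,
  sample points from \<open>1\<close>.
\<close>

definition vec_borel :: "nat \<Rightarrow> (nat \<Rightarrow> real) measure" where
  "vec_borel d = PiM {..<d} (\<lambda>_. borel)"

definition data_borel :: "nat \<Rightarrow> nat \<Rightarrow> (nat \<Rightarrow> nat \<Rightarrow> real) measure" where
  "data_borel n d = PiM {1..n} (\<lambda>_. vec_borel d)"

definition weight_borel :: "nat \<Rightarrow> (nat \<Rightarrow> real) measure" where
  "weight_borel n = PiM {1..n} (\<lambda>_. borel)"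

definition pnorm :: "nat \<Rightarrow> real \<Rightarrow> (nat \<Rightarrow> real) \<Rightarrow> real" where
  "pnorm d p v = (\<Sum>l<d. \<bar>v l\<bar> powr p) powr (1 / p)"

text \<open>Moments are extended-valued, so that a divergent moment is \<open>\<infinity>\<close> rather than the default
  value \<open>0\<close> of a non-existing Bochner integral.\<close>

definition norm_moment :: "(nat \<Rightarrow> real) measure \<Rightarrow> nat \<Rightarrow> real \<Rightarrow> real \<Rightarrow> ennreal" where
  "norm_moment P d p r = (\<integral>\<^sup>+ z. ennreal (pnorm d p z powr r) \<partial>P)"

text \<open>The matrix \<open>E[Z Z\<^sup>T]\<close>; it is the covariance matrix for centred laws.\<close>

definition second_moment_mat :: "(nat \<Rightarrow> real) measure \<Rightarrow> nat \<Rightarrow> real mat" where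
  "second_moment_mat P d = mat d d (\<lambda>(k, l). \<integral>z. z k * z l \<partial>P)"

definition positive_definite :: "nat \<Rightarrow> real mat \<Rightarrow> bool" where
  "positive_definite d A \<longleftrightarrow>
     (\<forall>v \<in> carrier_vec d. v \<noteq> 0\<^sub>v d \<longrightarrow> 0 < v \<bullet> (A *\<^sub>v v))"

definition centred_finite_cov :: "(nat \<Rightarrow> real) measure \<Rightarrow> nat \<Rightarrow> bool" where
  "centred_finite_cov P d \<longleftrightarrow>
     (\<forall>l<d. integrable P (\<lambda>z. z l) \<and> (\<integral>z. z l \<partial>P) = 0) \<and>
     (\<forall>k<d. \<forall>l<d. integrable P (\<lambda>z. z k * z l))"

text \<open>\<open>powr\<close> satisfies \<open>0 powr 0 = 0\<close>; the factor \<open>(log d)\<^sup>\<kappa>\<^sup>/\<^sup>2\<close> with \<open>d = 1\<close>, \<open>\<kappa> = 0\<close> needs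
  the convention \<open>0\<^sup>0 = 1\<close>.\<close>

definition rpow :: "real \<Rightarrow> real \<Rightarrow> real" where
  "rpow x a = (if a = 0 then 1 else x powr a)"

text \<open>\<open>K\<close> is a regular conditional law of \<open>Y\<close> given \<open>X\<close>.\<close>

definition regular_cond_law ::
  "'a measure \<Rightarrow> 'b measure \<Rightarrow> ('a \<Rightarrow> 'b) \<Rightarrow> 'c measure \<Rightarrow> ('a \<Rightarrow> 'c) \<Rightarrow> ('b \<Rightarrow> 'c measure) \<Rightarrow> bool"
where
  "regular_cond_law M S X T Y K \<longleftrightarrow>
     X \<in> measurable M S \<and> Y \<in> measurable M T \<and> K \<in> measurable S (prob_algebra T) \<and>
     (\<forall>A \<in> sets S. \<forall>B \<in> sets T.
        measure M {x \<in> space M. X x \<in> A \<and> Y x \<in> B} =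
        (\<integral>x. indicator A (X x) * measure (K (X x)) B \<partial>M))"

definition standardized_independent_weights :: "(nat \<Rightarrow> real) measure \<Rightarrow> nat \<Rightarrow> bool" where
  "standardized_independent_weights Q n \<longleftrightarrow>
     prob_space.indep_vars Q (\<lambda>_. borel) (\<lambda>i w. w i) {1..n} \<and>
     (\<forall>i\<in>{1..n}. integrable Q (\<lambda>w. w i) \<and> (\<integral>w. w i \<partial>Q) = 0 \<and>
                 integrable Q (\<lambda>w. (w i)\<^sup>2) \<and> (\<integral>w. (w i)\<^sup>2 \<partial>Q) = 1)"

definition sample_mean :: "nat \<Rightarrow> (nat \<Rightarrow> nat \<Rightarrow> real) \<Rightarrow> nat \<Rightarrow> real" where
  "sample_mean n z l = (\<Sum>i=1..n. z i l) / real n"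

definition boot_mean :: "nat \<Rightarrow> (nat \<Rightarrow> real) \<Rightarrow> (nat \<Rightarrow> nat \<Rightarrow> real) \<Rightarrow> nat \<Rightarrow> real" where
  "boot_mean n w z l = (\<Sum>i=1..n. w i * z i l) / real n"

text \<open>Measurability of the events is part of the definition because \<open>measure\<close> is \<open>0\<close> on
  non-measurable sets.\<close>

definition small_o_prob :: "(nat \<Rightarrow> 'a measure) \<Rightarrow> (nat \<Rightarrow> 'a \<Rightarrow> real) \<Rightarrow> bool" where
  "small_o_prob M f \<longleftrightarrow>
     (\<forall>\<epsilon>>0. \<exists>N. \<forall>n\<ge>N. {x \<in> space (M n). \<bar>f n x\<bar> \<ge> \<epsilon>} \<in> sets (M n) \<and>
                      measure (M n) {x \<in> space (M n). \<bar>f n x\<bar> \<ge> \<epsilon>} < \<epsilon>)"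

end

theory Submission
  imports Defs "HOL-Real_Asymp.Real_Asymp"
begin

text \<open>
  Why the bootstrap works here. Freeze the sample \<open>z\<close> and let \<open>g\<^sub>1, \<dots>, g\<^sub>n\<close> be independent
  standard normal variables. The vector \<open>G = n\<^sup>-\<^sup>1\<^sup>/\<^sup>2 \<Sum> g\<^sub>i z\<^sub>i\<close> is Gaussian and its covariance is the
  empirical second moment matrix of the sample. Both \<open>W = n\<^sup>-\<^sup>1\<^sup>/\<^sup>2 \<Sum> Z\<^sub>i\<close> and the bootstrap vector
  \<open>W\<^sup>* = n\<^sup>-\<^sup>1\<^sup>/\<^sup>2 \<Sum> \<omega>\<^sub>i z\<^sub>i\<close> are compared with \<open>G\<close>, with bounds that do not depend on the dimension
  \<open>d\<close>, for every sample whose empirical second moments are close to the true ones.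

  \<^emph>\<open>Scale.\<close> The squared norm of a \<open>d\<close>-dimensional Gaussian vector with eigenvalues in \<open>[c, C]\<close>
  fluctuates at scale \<open>\<surd>d\<close>. The indicator of \<open>\<parallel>x\<parallel>\<^sup>2 \<ge> t\<close> is therefore sandwiched between smooth steps in
  \<open>\<parallel>x\<parallel>\<^sup>2\<close> of width proportional to \<open>\<delta> \<surd>d\<close> (\<open>smooth_to_tail\<close>). The price is the probability that
  \<open>\<parallel>G\<parallel>\<^sup>2\<close> falls into an interval of that length.

  \<^emph>\<open>Anti-concentration.\<close> By decoupling, the characteristic function of \<open>\<parallel>G\<parallel>\<^sup>2\<close> satisfies
  \<open>\<bar>\<phi>(u)\<bar>\<^sup>2 \<le> (1 + 2 u\<^sup>2 c\<^sup>2)\<close> to the power \<open>- d / 2\<close> (\<open>gaussian_quadratic_char\<close>). Integrated against a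
  Gaussian kernel this bounds the small-ball probability by a function of \<open>\<delta>\<close> and \<open>c\<close> alone that
  vanishes with \<open>\<delta>\<close> (\<open>gaussian_anticoncentration\<close>, \<open>small_ball_bound_vanishes\<close>).

  \<^emph>\<open>Replacement.\<close> Smooth functionals are compared by exchanging one summand at a time
  (\<open>lindeberg\<close>). At scale \<open>\<surd>d\<close> only second and fourth moments of the norms of the summands enter,
  without further powers of \<open>d\<close>. For \<open>W\<^sup>*\<close> the summands \<open>\<omega>\<^sub>i z\<^sub>i\<close> and \<open>g\<^sub>i z\<^sub>i\<close> have the same second
  moments (\<open>boot_vs_gauss\<close>). For \<open>W\<close> each \<open>Z\<^sub>i\<close> is exchanged for an independent copy of \<open>G\<close>, since the
  normalised sum of \<open>n\<close> copies of \<open>G\<close> is distributed like \<open>G\<close> (\<open>nn_integral_gauss_law_sum\<close>); now the second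
  moments differ by the error of the empirical covariance, which matters only through its
  Frobenius norm (\<open>data_vs_gauss\<close>).

  \<^emph>\<open>Good samples.\<close> The expected squared Frobenius error of the empirical covariance is at most
  \<open>E \<parallel>Z\<parallel>\<^sup>4 / n\<close>, which tends to zero, so Markov's inequality makes bad samples unlikely
  (\<open>sample_dev_markov\<close>). The constants are chosen in the order \<open>\<delta>\<close> (anti-concentration), then the
  tolerance \<open>s\<close> for the sample (replacement error), then \<open>n\<close>.

  Vectors are functions on \<open>nat\<close> of which only the coordinates below \<open>d\<close> matter, and sums of
  independent vectors are integrated over product measures, one factor at a time.
\<close>

section \<open>Squared norms and inner products of coordinate functions\<close>

definition nsq :: "nat \<Rightarrow> (nat \<Rightarrow> real) \<Rightarrow> real" where
  "nsq d x = (\<Sum>l<d. (x l)\<^sup>2)"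

definition ip :: "nat \<Rightarrow> (nat \<Rightarrow> real) \<Rightarrow> (nat \<Rightarrow> real) \<Rightarrow> real" where
  "ip d x y = (\<Sum>l<d. x l * y l)"

lemma nsq_nonneg [simp]: "0 \<le> nsq d x"
  by (simp add: nsq_def sum_nonneg)

lemma nsq_add: "nsq d (\<lambda>l. x l + y l) = nsq d x + 2 * ip d x y + nsq d y"
  by (simp add: nsq_def ip_def power2_sum sum.distrib sum_distrib_left algebra_simps)

lemma ip_commute: "ip d x y = ip d y x"
  by (simp add: ip_def mult.commute)

lemma ip_sq_le: "(ip d x y)\<^sup>2 \<le> nsq d x * nsq d y"
  unfolding ip_def nsq_def by (rule Cauchy_Schwarz_ineq_sum)

lemma component_sq_le_nsq: "l < d \<Longrightarrow> (x l)\<^sup>2 \<le> nsq d x"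
  unfolding nsq_def by (rule member_le_sum) auto


section \<open>A spline cutoff and its Taylor expansion\<close>

definition pos3 :: "real \<Rightarrow> real" where "pos3 y = (max 0 y) ^ 3"

text \<open>
  The truncated cube is twice continuously differentiable with a Lipschitz second derivative. Going
  through the four sign patterns of \<open>a\<close> and \<open>a + h\<close> gives the Taylor remainder without any calculus.
\<close>

lemma pos3_taylor:
  "\<bar>pos3 (a + h) - pos3 a - 3 * (max 0 a)\<^sup>2 * h - 3 * max 0 a * h\<^sup>2\<bar> \<le> \<bar>h\<bar> ^ 3"
proof -
  consider "a \<ge> 0" "a + h \<ge> 0" | "a \<le> 0" "a + h \<le> 0" | "a \<le> 0" "a + h \<ge> 0" | "a \<ge> 0" "a + h \<le> 0"
    by linarith
  then show ?thesis
  proof cases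
    case 1
    then have "pos3 (a + h) - pos3 a - 3 * (max 0 a)\<^sup>2 * h - 3 * max 0 a * h\<^sup>2 = h ^ 3"
      by (simp add: pos3_def max_def power3_eq_cube power2_eq_square algebra_simps)
    then show ?thesis by (simp add: power_abs)
  next
    case 2
    then show ?thesis by (auto simp: pos3_def max_def)
  next
    case 3
    then have "pos3 (a + h) - pos3 a - 3 * (max 0 a)\<^sup>2 * h - 3 * max 0 a * h\<^sup>2 = (a + h) ^ 3"
      by (auto simp: pos3_def max_def)
    moreover have "(a + h) ^ 3 \<le> h ^ 3" "0 \<le> (a + h) ^ 3"
      using 3 by (auto intro!: power_mono)
    moreover have "h \<ge> 0" using 3 by simp
    ultimately show ?thesis by simp
  next
    case 4
    have e: "pos3 (a + h) - pos3 a - 3 * (max 0 a)\<^sup>2 * h - 3 * max 0 a * h\<^sup>2 = (- (a + h)) ^ 3 - (- h) ^ 3"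
      using 4 by (auto simp: pos3_def max_def power3_eq_cube power2_eq_square algebra_simps)
    have "(- (a + h)) ^ 3 \<le> (- h) ^ 3" "0 \<le> (- (a + h)) ^ 3"
      using 4 by (auto intro!: power_mono simp del: power_minus_odd)
    moreover have "\<bar>h\<bar> = - h" using 4 by simp
    ultimately show ?thesis unfolding e by (simp del: power_minus_odd)
  qed
qed

text \<open>
  The distribution function of the sum of three independent uniform variables, that is, an integrated
  quadratic B-spline. It climbs from \<open>0\<close> to \<open>1\<close> on \<open>[0, 3]\<close>; the two functions after it are its first
  and second derivatives.
\<close>

definition smooth_step :: "real \<Rightarrow> real" where
  "smooth_step y = (pos3 y - 3 * pos3 (y - 1) + 3 * pos3 (y - 2) - pos3 (y - 3)) / 6"

definition smooth_step_d1 :: "real \<Rightarrow> real" where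
  "smooth_step_d1 y = ((max 0 y)\<^sup>2 - 3 * (max 0 (y - 1))\<^sup>2 + 3 * (max 0 (y - 2))\<^sup>2 - (max 0 (y - 3))\<^sup>2) / 2"

definition smooth_step_d2 :: "real \<Rightarrow> real" where
  "smooth_step_d2 y = max 0 y - 3 * max 0 (y - 1) + 3 * max 0 (y - 2) - max 0 (y - 3)"

lemma real_pieces:
  fixes y :: real
  obtains "y \<le> 0" | "0 \<le> y" "y \<le> 1" | "1 \<le> y" "y \<le> 2" | "2 \<le> y" "y \<le> 3" | "3 \<le> y"
  by linarith

lemma smooth_step_eq_0: "y \<le> 0 \<Longrightarrow> smooth_step y = 0"
  by (simp add: smooth_step_def pos3_def max_def)

lemma smooth_step_eq_1: "3 \<le> y \<Longrightarrow> smooth_step y = 1"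
  by (simp add: smooth_step_def pos3_def max_def power3_eq_cube algebra_simps)

lemma smooth_step_bounds: "0 \<le> smooth_step y \<and> smooth_step y \<le> 1"
proof (cases y rule: real_pieces)
  case 1 then show ?thesis by (simp add: smooth_step_eq_0)
next
  case 2
  then have "smooth_step y = y ^ 3 / 6" by (simp add: smooth_step_def pos3_def max_def)
  moreover have "y ^ 3 \<le> 1" "0 \<le> y ^ 3" using 2 by (auto simp: power_le_one)
  ultimately show ?thesis by linarith
next
  case 3
  define u where "u = y - 1"
  have u: "0 \<le> u" "u \<le> 1" using 3 by (auto simp: u_def)
  have y: "y = u + 1" by (simp add: u_def)
  have e: "smooth_step y = (1 + 3 * u + 3 * u\<^sup>2 * (1 - u) + u ^ 3) / 6"
    using u by (auto simp: y smooth_step_def pos3_def max_def power3_eq_cube power2_eq_square field_simps)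
  have a: "0 \<le> u\<^sup>2 * (1 - u)" "u\<^sup>2 * (1 - u) \<le> 1 - u" "u ^ 3 \<le> 1" "0 \<le> u ^ 3"
    using u by (simp_all add: mult_left_le_one_le power_le_one)
  obtain b c where bc: "b = u\<^sup>2 * (1 - u)" "c = u ^ 3" by blast
  have "smooth_step y = (1 + 3 * u + 3 * b + c) / 6" using e by (simp add: mult.assoc bc)
  then show ?thesis using a u unfolding bc [symmetric] by simp
next
  case 4
  define u where "u = 3 - y"
  have u: "0 \<le> u" "u \<le> 1" using 4 by (auto simp: u_def)
  have y: "y = 3 - u" by (simp add: u_def)
  have e: "smooth_step y = 1 - u ^ 3 / 6"
    using u by (auto simp: y smooth_step_def pos3_def max_def power3_eq_cube power2_eq_square field_simps)
  have "0 \<le> u ^ 3" "u ^ 3 \<le> 1" using u by (auto simp: power_le_one)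
  then show ?thesis by (simp add: e)
next
  case 5 then show ?thesis by (simp add: smooth_step_eq_1)
qed

lemma smooth_step_d1_bound: "\<bar>smooth_step_d1 y\<bar> \<le> 1"
proof (cases y rule: real_pieces)
  case 1 then show ?thesis by (simp add: smooth_step_d1_def max_def)
next
  case 2
  then have "smooth_step_d1 y = y\<^sup>2 / 2" by (simp add: smooth_step_d1_def max_def)
  moreover have "y\<^sup>2 \<le> 1" "0 \<le> y\<^sup>2" using 2 by (auto simp: power_le_one)
  ultimately show ?thesis by linarith
next
  case 3
  then have e: "smooth_step_d1 y = 3 / 4 - (y - 3 / 2)\<^sup>2"
    by (auto simp: smooth_step_d1_def max_def power2_eq_square field_simps)
  have "\<bar>y - 3 / 2\<bar> \<le> 1 / 2" using 3 by linarith
  then have "\<bar>y - 3 / 2\<bar>\<^sup>2 \<le> (1 / 2)\<^sup>2" by (rule power_mono) simp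
  then have r: "(y - 3 / 2)\<^sup>2 \<le> 1 / 4" by (simp add: power_divide)
  have "\<bar>3 / 4 - r\<bar> \<le> 1" if "0 \<le> r" "r \<le> 1 / 4" for r :: real
    using that by linarith
  from this[OF _ r] show ?thesis unfolding e by simp
next
  case 4
  then have e: "smooth_step_d1 y = (3 - y)\<^sup>2 / 2"
    by (auto simp: smooth_step_d1_def max_def power2_eq_square field_simps)
  have "(3 - y)\<^sup>2 \<le> 1" using 4 by (simp add: power_le_one)
  then show ?thesis unfolding e by simp
next
  case 5 then show ?thesis by (simp add: smooth_step_d1_def max_def power2_eq_square algebra_simps)
qed

lemma smooth_step_d2_bound: "\<bar>smooth_step_d2 y\<bar> \<le> 1"
  by (auto simp: smooth_step_d2_def max_def)

text \<open>
  The cubic bound is inherited from the truncated cubes. For large increments the quadratic bound is better;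
  having the minimum of both is what later keeps sixth moments out of the replacement error.
\<close>

lemma smooth_step_taylor:
  "\<bar>smooth_step (a + h) - smooth_step a - smooth_step_d1 a * h - smooth_step_d2 a * h\<^sup>2 / 2\<bar>
      \<le> 3 * min (h\<^sup>2) (\<bar>h\<bar> ^ 3)"
proof -
  define R where "R b = pos3 (b + h) - pos3 b - 3 * (max 0 b)\<^sup>2 * h - 3 * max 0 b * h\<^sup>2" for b
  let ?T = "smooth_step (a + h) - smooth_step a - smooth_step_d1 a * h - smooth_step_d2 a * h\<^sup>2 / 2"
  have R: "\<bar>R b\<bar> \<le> \<bar>h\<bar> ^ 3" for b
    unfolding R_def by (rule pos3_taylor)
  have e: "?T = (R a - 3 * R (a - 1) + 3 * R (a - 2) - R (a - 3)) / 6"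
    unfolding R_def smooth_step_def smooth_step_d1_def smooth_step_d2_def
    by (simp add: field_simps)
  have cubic: "\<bar>?T\<bar> \<le> 3 * \<bar>h\<bar> ^ 3"
  proof -
    have "- (\<bar>h\<bar> ^ 3) \<le> R b \<and> R b \<le> \<bar>h\<bar> ^ 3" for b using R[of b] by (simp add: abs_le_iff)
    from this[of a] this[of "a - 1"] this[of "a - 2"] this[of "a - 3"]
    have "\<bar>R a - 3 * R (a - 1) + 3 * R (a - 2) - R (a - 3)\<bar> \<le> 8 * \<bar>h\<bar> ^ 3"
      unfolding abs_le_iff by linarith
    moreover have "0 \<le> \<bar>h\<bar> ^ 3" by simp
    ultimately show ?thesis
      unfolding e by simp
  qed
  show ?thesis
  proof (cases "\<bar>h\<bar> \<le> 1")
    case True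
    have "\<bar>h\<bar> ^ 3 = h\<^sup>2 * \<bar>h\<bar>" by (simp add: power3_eq_cube power2_eq_square)
    also have "\<dots> \<le> h\<^sup>2 * 1" using True by (intro mult_left_mono) auto
    finally have "min (h\<^sup>2) (\<bar>h\<bar> ^ 3) = \<bar>h\<bar> ^ 3" by simp
    then show ?thesis using cubic by simp
  next
    case False
    have "1 * \<bar>h\<bar> \<le> \<bar>h\<bar> * \<bar>h\<bar>" using False by (intro mult_right_mono) auto
    then have h2: "1 \<le> h\<^sup>2" "\<bar>h\<bar> \<le> h\<^sup>2"
      using False by (simp_all add: power2_eq_square)
    have "\<bar>h\<bar> ^ 3 = h\<^sup>2 * \<bar>h\<bar>" by (simp add: power3_eq_cube power2_eq_square)
    also have "\<dots> \<ge> h\<^sup>2 * 1" using False by (intro mult_left_mono) auto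
    finally have m: "min (h\<^sup>2) (\<bar>h\<bar> ^ 3) = h\<^sup>2" by simp
    have "\<bar>smooth_step_d1 a * h\<bar> \<le> 1 * \<bar>h\<bar>" unfolding abs_mult by (intro mult_right_mono smooth_step_d1_bound) auto
    moreover have "\<bar>smooth_step_d2 a * h\<^sup>2\<bar> \<le> 1 * h\<^sup>2"
      unfolding abs_mult abs_power2 by (intro mult_right_mono smooth_step_d2_bound) auto
    ultimately have "\<bar>?T\<bar> \<le> 3 * h\<^sup>2"
      using h2 smooth_step_bounds[of a] smooth_step_bounds[of "a + h"] unfolding abs_le_iff by linarith
    then show ?thesis by (simp add: m)
  qed
qed

lemma smooth_step_measurable [measurable]: "smooth_step \<in> borel_measurable borel"
  unfolding smooth_step_def pos3_def by measurable

text \<open>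
  Adding \<open>x\<close> to \<open>w\<close> changes \<open>\<parallel>w\<parallel>\<^sup>2 / lam\<close> by \<open>p + q\<close> with \<open>p = 2 \<langle>w, x\<rangle> / lam\<close> and \<open>q = \<parallel>x\<parallel>\<^sup>2 / lam\<close>. The terms kept
  on the left are those whose expectation depends on \<open>x\<close> only through its first two moments. The other terms are of
  order \<open>\<bar>p\<bar> q\<close>, \<open>q\<^sup>2\<close> and \<open>\<bar>p\<bar>\<^sup>3\<close>. The free parameter \<open>\<tau>\<close> trades the odd powers for \<open>\<tau> p\<^sup>2\<close> and \<open>(p\<^sup>4 + q\<^sup>2) / \<tau>\<close>,
  so that second and fourth moments of \<open>x\<close> suffice.
\<close>

lemma smooth_step_nsq_expansion:
  fixes lam \<tau> t :: real and d :: nat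
  assumes lam: "0 < lam" and \<tau>: "0 < \<tau>" "\<tau> \<le> 1"
  defines "a \<equiv> \<lambda>w. nsq d w / lam - t"
  shows "\<bar>smooth_step (a (\<lambda>l. w l + x l)) - (smooth_step (a w) + smooth_step_d1 (a w) * (2 * ip d w x / lam) +
       (smooth_step_d1 (a w) / lam * nsq d x + 2 * smooth_step_d2 (a w) / lam\<^sup>2 * (ip d w x)\<^sup>2))\<bar>
     \<le> 56 * \<tau> / lam\<^sup>2 * (ip d w x)\<^sup>2 + (224 * (nsq d w)\<^sup>2 / lam ^ 4 + 14 / lam\<^sup>2) / \<tau> * (nsq d x)\<^sup>2"
proof -
  define p where "p = 2 * ip d w x / lam"
  define q where "q = nsq d x / lam"
  define h where "h = p + q"
  have q0: "0 \<le> q" using lam by (simp add: q_def)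
  have ah: "a (\<lambda>l. w l + x l) = a w + h"
    by (simp add: a_def h_def p_def q_def nsq_add add_divide_distrib algebra_simps)
  let ?R = "smooth_step (a w + h) - smooth_step (a w) - smooth_step_d1 (a w) * h - smooth_step_d2 (a w) * h\<^sup>2 / 2"
  have "smooth_step (a w + h) - (smooth_step (a w) + smooth_step_d1 (a w) * p + (smooth_step_d1 (a w) * q + smooth_step_d2 (a w) * p\<^sup>2 / 2))
     = ?R + smooth_step_d2 (a w) * (2 * p * q + q\<^sup>2) / 2"
    by (simp add: h_def power2_eq_square field_simps)
  note eq0 = this
  have eq: "\<bar>smooth_step (a w + h) - (smooth_step (a w) + smooth_step_d1 (a w) * p + (smooth_step_d1 (a w) * q
      + smooth_step_d2 (a w) * p\<^sup>2 / 2))\<bar>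
     \<le> \<bar>?R\<bar> + \<bar>smooth_step_d2 (a w)\<bar> * \<bar>2 * p * q + q\<^sup>2\<bar> / 2"
    unfolding eq0 by (intro order_trans[OF abs_triangle_ineq]) (simp add: abs_mult)
  have pq: "\<bar>2 * p * q + q\<^sup>2\<bar> \<le> 2 * \<bar>p\<bar> * q + q\<^sup>2"
    using q0 by (intro order_trans[OF abs_triangle_ineq]) (simp add: abs_mult)
  have "\<bar>smooth_step_d2 (a w)\<bar> * \<bar>2 * p * q + q\<^sup>2\<bar> \<le> 1 * (2 * \<bar>p\<bar> * q + q\<^sup>2)"
    by (intro mult_mono smooth_step_d2_bound pq) auto
  then have second: "\<bar>smooth_step_d2 (a w)\<bar> * \<bar>2 * p * q + q\<^sup>2\<bar> / 2 \<le> \<bar>p\<bar> * q + q\<^sup>2 / 2" by simp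
  have min: "min (h\<^sup>2) (\<bar>h\<bar> ^ 3) \<le> 4 * q\<^sup>2 + 8 * \<bar>p\<bar> ^ 3"
  proof (cases "\<bar>p\<bar> \<le> q")
    case True
    then have "\<bar>h\<bar> \<le> 2 * q" using q0 by (simp add: h_def)
    then have "\<bar>h\<bar>\<^sup>2 \<le> (2 * q)\<^sup>2" by (intro power_mono) auto
    then have "h\<^sup>2 \<le> 4 * q\<^sup>2" by (simp add: power_mult_distrib)
    moreover have "0 \<le> \<bar>p\<bar> ^ 3" by simp
    ultimately show ?thesis by linarith
  next
    case False
    then have "\<bar>h\<bar> \<le> 2 * \<bar>p\<bar>" using q0 by (simp add: h_def)
    then have "\<bar>h\<bar> ^ 3 \<le> (2 * \<bar>p\<bar>) ^ 3" by (intro power_mono) auto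
    then have "\<bar>h\<bar> ^ 3 \<le> 8 * \<bar>p\<bar> ^ 3" by (simp add: power_mult_distrib)
    then show ?thesis by (intro min.coboundedI2) (smt (verit) zero_le_power2)
  qed
  have R: "\<bar>?R\<bar> \<le> 12 * q\<^sup>2 + 24 * \<bar>p\<bar> ^ 3"
    using smooth_step_taylor[of "a w" h] min by linarith
  \<comment> \<open>the arithmetic-geometric mean inequality, weighted by \<open>\<tau>\<close>\<close>
  have am1: "\<bar>p\<bar> * q \<le> (\<tau> * p\<^sup>2 + q\<^sup>2 / \<tau>) / 2"
  proof -
    have "0 \<le> (\<tau> * \<bar>p\<bar> - q)\<^sup>2" by simp
    then have "2 * \<tau> * (\<bar>p\<bar> * q) \<le> \<tau>\<^sup>2 * p\<^sup>2 + q\<^sup>2"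
      by (simp add: power2_diff power_mult_distrib algebra_simps)
    then show ?thesis using \<tau> by (simp add: field_simps power2_eq_square)
  qed
  have am2: "\<bar>p\<bar> ^ 3 \<le> (\<tau> * p\<^sup>2 + p ^ 4 / \<tau>) / 2"
  proof -
    have "0 \<le> p\<^sup>2 * (\<tau> - \<bar>p\<bar>)\<^sup>2" by simp
    also have "\<dots> = \<tau>\<^sup>2 * p\<^sup>2 + p ^ 4 - 2 * \<tau> * \<bar>p\<bar> ^ 3"
    proof -
      have "p\<^sup>2 * \<bar>p\<bar> = \<bar>p\<bar> ^ 3" by (simp add: power2_eq_square power3_eq_cube abs_mult_self_eq)
      moreover have "p\<^sup>2 * p\<^sup>2 = p ^ 4" by (simp flip: power_add)
      ultimately show ?thesis by (simp add: power2_diff algebra_simps)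
    qed
    finally show ?thesis using \<tau> by (simp add: field_simps power2_eq_square)
  qed
  have qt: "q\<^sup>2 \<le> q\<^sup>2 / \<tau>" using \<tau> by (simp add: field_simps mult_left_le_one_le)
  have "\<bar>?R\<bar> + \<bar>smooth_step_d2 (a w)\<bar> * \<bar>2 * p * q + q\<^sup>2\<bar> / 2 \<le> 14 * (\<tau> * p\<^sup>2 + (p ^ 4
      + q\<^sup>2) / \<tau>)"
  proof -
    have nn: "0 \<le> \<tau> * p\<^sup>2" "0 \<le> p ^ 4 / \<tau>" "0 \<le> q\<^sup>2 / \<tau>" using \<tau> by auto
    show ?thesis
      using R second am1 am2 qt nn unfolding add_divide_distrib by argo
  qed
  also have "\<dots> = 56 * \<tau> / lam\<^sup>2 * (ip d w x)\<^sup>2 + (14 * p ^ 4 + 14 * q\<^sup>2) / \<tau>"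
    by (simp add: p_def power_divide power_mult_distrib algebra_simps add_divide_distrib)
  also have "\<dots> \<le> 56 * \<tau> / lam\<^sup>2 * (ip d w x)\<^sup>2 + (224 * (nsq d w)\<^sup>2 / lam ^ 4
      + 14 / lam\<^sup>2) / \<tau> * (nsq d x)\<^sup>2"
  proof -
    have "(ip d w x) ^ 4 = ((ip d w x)\<^sup>2)\<^sup>2" by simp
    also have "\<dots> \<le> (nsq d w * nsq d x)\<^sup>2" by (intro power_mono ip_sq_le) auto
    finally have "p ^ 4 \<le> 16 * (nsq d w)\<^sup>2 * (nsq d x)\<^sup>2 / lam ^ 4"
      using lam by (simp add: p_def power_divide power_mult_distrib divide_right_mono)
    then have "14 * p ^ 4 + 14 * q\<^sup>2 \<le> 224 * (nsq d w)\<^sup>2 * (nsq d x)\<^sup>2 / lam ^ 4 + 14 * (nsq d x)\<^sup>2 / lam\<^sup>2"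
      by (simp add: q_def power_divide)
    then have "(14 * p ^ 4 + 14 * q\<^sup>2) / \<tau> \<le> (224 * (nsq d w)\<^sup>2 * (nsq d x)\<^sup>2 / lam ^ 4
        + 14 * (nsq d x)\<^sup>2 / lam\<^sup>2) / \<tau>"
      using \<tau> by (intro divide_right_mono) auto
    also have "\<dots> = (224 * (nsq d w)\<^sup>2 / lam ^ 4 + 14 / lam\<^sup>2) / \<tau> * (nsq d x)\<^sup>2"
      by (simp add: algebra_simps add_divide_distrib)
    finally show ?thesis by simp
  qed
  finally have fin: "\<bar>?R\<bar> + \<bar>smooth_step_d2 (a w)\<bar> * \<bar>2 * p * q + q\<^sup>2\<bar> / 2 \<le>
    56 * \<tau> / lam\<^sup>2 * (ip d w x)\<^sup>2 + (224 * (nsq d w)\<^sup>2 / lam ^ 4 + 14 / lam\<^sup>2) / \<tau> * (nsq d x)\<^sup>2" .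
  have "smooth_step_d1 (a w) * p + (smooth_step_d1 (a w) * q + smooth_step_d2 (a w) * p\<^sup>2 / 2) =
     smooth_step_d1 (a w) * (2 * ip d w x / lam) + (smooth_step_d1 (a w) / lam * nsq d x
         + 2 * smooth_step_d2 (a w) / lam\<^sup>2 * (ip d w x)\<^sup>2)"
    by (simp add: p_def q_def power_divide power_mult_distrib)
  then show ?thesis
    using eq fin unfolding ah by (simp add: algebra_simps)
qed

section \<open>Moments of sums of independent centred vectors\<close>

text \<open>
  The vector \<open>V x\<close> is centred and square integrable when \<open>x\<close> has law \<open>L\<close>. Keeping \<open>V\<close> apart from \<open>L\<close> covers
  both a random vector \<open>x\<close> and a random multiple \<open>x a\<close> of a fixed vector \<open>a\<close>.
\<close>

definition centred_law :: "nat \<Rightarrow> 'b measure \<Rightarrow> ('b \<Rightarrow> nat \<Rightarrow> real) \<Rightarrow> bool" where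
  "centred_law d L V \<longleftrightarrow> prob_space L \<and>
     (\<forall>l<d. (\<lambda>x. V x l) \<in> borel_measurable L \<and> (\<integral>x. V x l \<partial>L) = 0) \<and>
     integrable L (\<lambda>x. nsq d (V x))"

lemma centred_lawD:
  assumes "centred_law d L V"
  shows "prob_space L" "\<And>l. l < d \<Longrightarrow> (\<lambda>x. V x l) \<in> borel_measurable L"
    "integrable L (\<lambda>x. nsq d (V x))"
    "\<And>l m. l < d \<Longrightarrow> m < d \<Longrightarrow> integrable L (\<lambda>x. V x l * V x m)"
    "\<And>l. l < d \<Longrightarrow> integrable L (\<lambda>x. V x l)"
    "\<And>v. integrable L (\<lambda>x. ip d v (V x))" "\<And>v. (\<integral>x. ip d v (V x) \<partial>L) = 0"
    "\<And>v. integrable L (\<lambda>x. (ip d v (V x))\<^sup>2)"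
proof -
  show P: "prob_space L" and M: "\<And>l. l < d \<Longrightarrow> (\<lambda>x. V x l) \<in> borel_measurable L"
    and I: "integrable L (\<lambda>x. nsq d (V x))"
    using assms by (auto simp: centred_law_def)
  interpret prob_space L by fact
  have sq: "(\<bar>V x l * V x m\<bar>) \<le> nsq d (V x)" if "l < d" "m < d" for x l m
  proof -
    have "2 * \<bar>V x l * V x m\<bar> \<le> (V x l)\<^sup>2 + (V x m)\<^sup>2"
      using sum_squares_bound[of "\<bar>V x l\<bar>" "\<bar>V x m\<bar>"] by (simp add: abs_mult)
    with component_sq_le_nsq[OF that(1), of "V x"] component_sq_le_nsq[OF that(2), of "V x"]
    show ?thesis by linarith
  qed
  show I2: "\<And>l m. l < d \<Longrightarrow> m < d \<Longrightarrow> integrable L (\<lambda>x. V x l * V x m)"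
    by (rule Bochner_Integration.integrable_bound[OF I]) (auto simp: M sq intro!: borel_measurable_times)
  show I1: "\<And>l. l < d \<Longrightarrow> integrable L (\<lambda>x. V x l)"
    by (rule square_integrable_imp_integrable) (auto simp: M power2_eq_square I2)
  show "\<And>v. integrable L (\<lambda>x. ip d v (V x))"
    unfolding ip_def by (auto intro!: Bochner_Integration.integrable_sum I1)
  show "(\<integral>x. ip d v (V x) \<partial>L) = 0" for v
    unfolding ip_def using assms I1
    by (subst Bochner_Integration.integral_sum) (auto simp: centred_law_def)
  have m: "(\<lambda>x. ip d v (V x)) \<in> borel_measurable L" for v
    unfolding ip_def by (auto intro!: borel_measurable_sum borel_measurable_times simp: M)
  show "integrable L (\<lambda>x. (ip d v (V x))\<^sup>2)" for v
    by (rule Bochner_Integration.integrable_bound[OF integrable_mult_right[OF I, of "nsq d v"]])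
      (auto simp: m ip_sq_le intro!: borel_measurable_power)
qed

text \<open>
  For the fourth moment, \<open>4 \<langle>w, V\<rangle> \<parallel>V\<parallel>\<^sup>2\<close> is absorbed by Cauchy--Schwarz instead of being integrated, so
  the bound holds for each fixed \<open>w\<close>; only the term linear in \<open>V\<close> needs the centring.
\<close>

lemma centred_law_add:
  assumes "centred_law d L V"
  shows "(\<integral>\<^sup>+x. ennreal (nsq d (\<lambda>l. w l + V x l)) \<partial>L) = ennreal (nsq d w + (\<integral>x. nsq d (V x) \<partial>L))"
    and "integrable L (\<lambda>x. (nsq d (V x))\<^sup>2) \<Longrightarrow> (\<integral>\<^sup>+x. ennreal ((nsq d (\<lambda>l. w l
        + V x l))\<^sup>2) \<partial>L)
       \<le> ennreal ((nsq d w)\<^sup>2 + 8 * (\<integral>x. nsq d (V x) \<partial>L) * nsq d w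
           + 3 * (\<integral>x. (nsq d (V x))\<^sup>2 \<partial>L))"
proof -
  note D = centred_lawD[OF assms]
  interpret prob_space L by (rule D(1))
  note [simp] = D(3) D(6) D(7) D(8)
  have "(\<integral>\<^sup>+x. ennreal (nsq d (\<lambda>l. w l + V x l)) \<partial>L) = ennreal (\<integral>x. nsq d (\<lambda>l. w l
      + V x l) \<partial>L)"
    by (rule nn_integral_eq_integral, simp add: nsq_add, simp)
  then show "(\<integral>\<^sup>+x. ennreal (nsq d (\<lambda>l. w l + V x l)) \<partial>L) = ennreal (nsq d w
      + (\<integral>x. nsq d (V x) \<partial>L))"
    by (simp add: nsq_add prob_space)
  assume I4: "integrable L (\<lambda>x. (nsq d (V x))\<^sup>2)"
  have le: "(nsq d (\<lambda>l. w l + V x l))\<^sup>2 \<le> (nsq d w)\<^sup>2 + 4 * nsq d w * ip d w (V x) + 8 * nsq d w * nsq d (V x)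
      + 3 * (nsq d (V x))\<^sup>2" for x
  proof -
    define a b c where "a = nsq d w" and "b = ip d w (V x)" and "c = nsq d (V x)"
    have b2: "b\<^sup>2 \<le> a * c" unfolding a_def b_def c_def by (rule ip_sq_le)
    have "4 * (b * c) \<le> 2 * (b\<^sup>2 + c\<^sup>2)" using sum_squares_bound[of b c] by simp
    then have "(a + 2 * b + c)\<^sup>2 \<le> a\<^sup>2 + 4 * a * b + 8 * a * c + 3 * c\<^sup>2"
      using b2 by (simp add: power2_eq_square algebra_simps)
    then show ?thesis by (simp add: nsq_add a_def b_def c_def)
  qed
  have "(\<integral>\<^sup>+x. ennreal ((nsq d (\<lambda>l. w l + V x l))\<^sup>2) \<partial>L) \<le>
     (\<integral>\<^sup>+x. ennreal ((nsq d w)\<^sup>2 + 4 * nsq d w * ip d w (V x) + 8 * nsq d w * nsq d (V x)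
         + 3 * (nsq d (V x))\<^sup>2) \<partial>L)"
    by (intro nn_integral_mono ennreal_leI le)
  also have "\<dots> = ennreal (\<integral>x. (nsq d w)\<^sup>2 + 4 * nsq d w * ip d w (V x) + 8 * nsq d w * nsq d (V x)
      + 3 * (nsq d (V x))\<^sup>2 \<partial>L)"
    by (rule nn_integral_eq_integral) (auto simp: I4 intro!: AE_I2 order_trans[OF _ le])
  also have "\<dots> = ennreal ((nsq d w)\<^sup>2 + 8 * (\<integral>x. nsq d (V x) \<partial>L) * nsq d w
      + 3 * (\<integral>x. (nsq d (V x))\<^sup>2 \<partial>L))"
    by (simp add: I4 prob_space algebra_simps)
  finally show "(\<integral>\<^sup>+x. ennreal ((nsq d (\<lambda>l. w l + V x l))\<^sup>2) \<partial>L)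
       \<le> ennreal ((nsq d w)\<^sup>2 + 8 * (\<integral>x. nsq d (V x) \<partial>L) * nsq d w
           + 3 * (\<integral>x. (nsq d (V x))\<^sup>2 \<partial>L))" .
qed

definition vsum :: "'i set \<Rightarrow> ('i \<Rightarrow> 'b \<Rightarrow> nat \<Rightarrow> real) \<Rightarrow> ('i \<Rightarrow> 'b) \<Rightarrow> nat \<Rightarrow> real" where
  "vsum I V x = (\<lambda>l. \<Sum>i\<in>I. V i (x i) l)"

lemma vsum_insert_upd:
  "finite I \<Longrightarrow> k \<notin> I \<Longrightarrow> vsum (insert k I) V (x(k := y)) = (\<lambda>l. vsum I V x l + V k y l)"
  by (auto simp: vsum_def fun_eq_iff add.commute intro!: sum.cong)

lemma vsum_measurable:
  assumes "\<And>i. i \<in> I \<Longrightarrow> centred_law d (L i) (V i)" "l < d"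
  shows "(\<lambda>x. vsum I V x l) \<in> borel_measurable (PiM I L)"
  unfolding vsum_def
proof (rule borel_measurable_sum)
  fix i assume i: "i \<in> I"
  show "(\<lambda>x. V i (x i) l) \<in> borel_measurable (PiM I L)"
    by (rule measurable_compose[where f = "\<lambda>x. x i" and N = "L i"])
      (rule measurable_component_singleton[OF i], rule centred_lawD(2)[OF assms(1)[OF i] assms(2)])
qed

lemma nsq_measurable [measurable (raw)]:
  "(\<And>l. l < d \<Longrightarrow> (\<lambda>x. X x l) \<in> borel_measurable M)
      \<Longrightarrow> (\<lambda>x. nsq d (X x)) \<in> borel_measurable M"
  unfolding nsq_def by (auto intro!: borel_measurable_sum borel_measurable_power)

lemma ip_measurable [measurable (raw)]:
  "(\<And>l. l < d \<Longrightarrow> (\<lambda>x. X x l) \<in> borel_measurable M)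
      \<Longrightarrow> (\<lambda>x. ip d (X x) v) \<in> borel_measurable M"
  unfolding ip_def by (auto intro!: borel_measurable_sum borel_measurable_times)

lemma product_sigma_finite_prob: "(\<And>i. prob_space (L i)) \<Longrightarrow> product_sigma_finite L"
  by (auto simp: product_sigma_finite_def prob_space_imp_sigma_finite)

text \<open>
  The library version asks every member of the family to be \<open>\<sigma>\<close>-finite. Factors outside the index set do not
  influence the product, so they can be replaced by a point mass.
\<close>

lemma nn_integral_PiM_insert:
  assumes J: "finite J" "k \<notin> J" and L: "\<And>i. i \<in> insert k J \<Longrightarrow> prob_space (L i)"
    and f: "f \<in> borel_measurable (PiM (insert k J) L)"
  shows "(\<integral>\<^sup>+x. f x \<partial>PiM (insert k J) L)
      = (\<integral>\<^sup>+x. \<integral>\<^sup>+y. f (x(k := y)) \<partial>L k \<partial>PiM J L)"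
proof -
  define N where "N = (\<lambda>i. if i \<in> insert k J then L i else return (count_space UNIV) undefined)"
  interpret product_sigma_finite N
    by (rule product_sigma_finite_prob) (use L in \<open>auto simp: N_def prob_space_return\<close>)
  have eq: "PiM (insert k J) L = PiM (insert k J) N" "PiM J L = PiM J N" "L k = N k"
    by (auto intro!: PiM_cong simp: N_def)
  show ?thesis using product_nn_integral_insert[OF J f[unfolded eq]] unfolding eq .
qed

lemma vsum_second_moment:
  assumes "finite I" and "\<And>i. i \<in> I \<Longrightarrow> centred_law d (L i) (V i)"
  shows "(\<integral>\<^sup>+x. ennreal (nsq d (vsum I V x)) \<partial>PiM I L) = ennreal (\<Sum>i\<in>I. \<integral>x. nsq d (V i x) \<partial>L i)"
  using assms
proof (induction I rule: finite_induct)
  case empty then show ?case by (simp add: PiM_empty nn_integral_count_space_finite vsum_def nsq_def)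
next
  case (insert k J)
  have PL: "prob_space (L i)" if "i \<in> insert k J" for i using centred_lawD(1)[OF insert.prems[OF that]] .
  have m: "(\<lambda>x. nsq d (vsum J' V x)) \<in> borel_measurable (PiM J' L)" if "J' \<subseteq> insert k J" for J'
    using that insert.prems by (intro nsq_measurable vsum_measurable) auto
  have P1: "emeasure (PiM J L) (space (PiM J L)) = 1"
    by (rule prob_space.emeasure_space_1[OF prob_space_PiM]) (rule PL, simp)
  have "(\<integral>\<^sup>+x. ennreal (nsq d (vsum (insert k J) V x)) \<partial>PiM (insert k J) L)
    = (\<integral>\<^sup>+x. \<integral>\<^sup>+y. ennreal (nsq d (\<lambda>l. vsum J V x l + V k y l)) \<partial>L k \<partial>PiM J L)"
    using m[OF order_refl] by (subst nn_integral_PiM_insert[OF insert.hyps PL]) (simp_all add: vsum_insert_upd insert.hyps)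
  also have "\<dots> = (\<integral>\<^sup>+x. ennreal (nsq d (vsum J V x)) + ennreal (\<integral>x. nsq d (V k x) \<partial>L k) \<partial>PiM J L)"
    by (subst centred_law_add(1)[OF insert.prems]) simp_all
  also have "\<dots> = (\<integral>\<^sup>+x. ennreal (nsq d (vsum J V x)) \<partial>PiM J L) + ennreal (\<integral>x. nsq d (V k x) \<partial>L k)"
    using P1 m[of J] by (subst nn_integral_add) auto
  also have "\<dots> = ennreal (\<Sum>i\<in>insert k J. \<integral>x. nsq d (V i x) \<partial>L i)"
    using insert by (simp add: ennreal_plus[symmetric] sum_nonneg add.commute del: ennreal_plus)
  finally show ?case .
qed

text \<open>
  The scalar products of the summands with \<open>v\<close> are one-dimensional centred vectors, so this is the second moment
  identity in dimension \<open>1\<close>.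
\<close>

lemma vsum_ip_moment:
  assumes I: "finite I" and L: "\<And>i. i \<in> I \<Longrightarrow> centred_law d (L i) (V i)"
  shows "(\<integral>\<^sup>+x. ennreal ((ip d (vsum I V x) v)\<^sup>2) \<partial>PiM I L)
      = ennreal (\<Sum>i\<in>I. \<integral>x. (ip d v (V i x))\<^sup>2 \<partial>L i)"
proof -
  define U where "U = (\<lambda>i x (_::nat). ip d v (V i x))"
  have U: "nsq 1 (U i x) = (ip d v (V i x))\<^sup>2" for i x by (simp add: nsq_def U_def)
  have "centred_law 1 (L i) (U i)" if i: "i \<in> I" for i
    using centred_lawD(1,6,7,8)[OF L[OF i]] unfolding centred_law_def U
    by (auto simp: U_def dest: borel_measurable_integrable)
  note vsum_second_moment[where V = U and L = L and d = 1, OF I this]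
  moreover have "nsq 1 (vsum I U x) = (ip d (vsum I V x) v)\<^sup>2" for x
  proof -
    have "ip d (vsum I V x) v = (\<Sum>i\<in>I. ip d v (V i (x i)))"
      unfolding vsum_def ip_def sum_distrib_right by (subst sum.swap) (simp add: mult.commute)
    then show ?thesis by (simp add: vsum_def U_def nsq_def)
  qed
  ultimately show ?thesis by (simp only: U)
qed

text \<open>
  A Rosenthal inequality: when a centred summand with second moment \<open>s'\<close> is added to a sum with accumulated
  second moment \<open>s\<close>, the new term \<open>8 s s'\<close> is covered by the growth of \<open>4 s\<^sup>2\<close>.
\<close>

lemma vsum_fourth_moment:
  assumes "finite I" and "\<And>i. i \<in> I \<Longrightarrow> centred_law d (L i) (V i)"
    and "\<And>i. i \<in> I \<Longrightarrow> integrable (L i) (\<lambda>x. (nsq d (V i x))\<^sup>2)"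
  shows "(\<integral>\<^sup>+x. ennreal ((nsq d (vsum I V x))\<^sup>2) \<partial>PiM I L)
    \<le> ennreal (4 * (\<Sum>i\<in>I. \<integral>x. nsq d (V i x) \<partial>L i)\<^sup>2
        + 3 * (\<Sum>i\<in>I. \<integral>x. (nsq d (V i x))\<^sup>2 \<partial>L i))"
  using assms
proof (induction I rule: finite_induct)
  case empty then show ?case by (simp add: PiM_empty nn_integral_count_space_finite vsum_def nsq_def)
next
  case (insert k J)
  have PL: "prob_space (L i)" if "i \<in> insert k J" for i using centred_lawD(1)[OF insert.prems(1)[OF that]] .
  have m: "(\<lambda>x. nsq d (vsum J' V x)) \<in> borel_measurable (PiM J' L)" if "J' \<subseteq> insert k J" for J'
    using that insert.prems by (intro nsq_measurable vsum_measurable) auto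
  have P1: "emeasure (PiM J L) (space (PiM J L)) = 1"
    by (rule prob_space.emeasure_space_1[OF prob_space_PiM]) (rule PL, simp)
  define s where "s = (\<Sum>i\<in>J. \<integral>x. nsq d (V i x) \<partial>L i)"
  define q where "q = (\<Sum>i\<in>J. \<integral>x. (nsq d (V i x))\<^sup>2 \<partial>L i)"
  define s' where "s' = (\<integral>x. nsq d (V k x) \<partial>L k)"
  define q' where "q' = (\<integral>x. (nsq d (V k x))\<^sup>2 \<partial>L k)"
  have nn: "0 \<le> s" "0 \<le> q" "0 \<le> s'" "0 \<le> q'"
    unfolding s_def q_def s'_def q'_def by (auto intro!: sum_nonneg)
  have mJ [measurable]: "(\<lambda>x. nsq d (vsum J V x)) \<in> borel_measurable (PiM J L)" by (rule m) auto
  have "(\<integral>\<^sup>+x. ennreal ((nsq d (vsum (insert k J) V x))\<^sup>2) \<partial>PiM (insert k J) L)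
    = (\<integral>\<^sup>+x. \<integral>\<^sup>+y. ennreal ((nsq d (\<lambda>l. vsum J V x l + V k y l))\<^sup>2) \<partial>L k \<partial>PiM J L)"
    using m[OF order_refl] by (subst nn_integral_PiM_insert[OF insert.hyps PL]) (simp_all add: vsum_insert_upd insert.hyps)
  also have "\<dots> \<le> (\<integral>\<^sup>+x. ennreal ((nsq d (vsum J V x))\<^sup>2 + 8 * s' * nsq d (vsum J V x) + 3 * q') \<partial>PiM J L)"
    unfolding s'_def q'_def by (intro nn_integral_mono centred_law_add(2) insert.prems) auto
  also have "\<dots> = (\<integral>\<^sup>+x. ennreal ((nsq d (vsum J V x))\<^sup>2) + (ennreal (8 * s') * ennreal (nsq d (vsum J V x))
      + ennreal (3 * q')) \<partial>PiM J L)"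
    using nn by (intro nn_integral_cong) (simp add: ennreal_plus ennreal_mult[symmetric] add.assoc)
  also have "\<dots> = (\<integral>\<^sup>+x. ennreal ((nsq d (vsum J V x))\<^sup>2) \<partial>PiM J L) + (ennreal (8 * s') * ennreal s
      + ennreal (3 * q'))"
    using vsum_second_moment[OF insert.hyps(1) insert.prems(1)]
    by (simp add: P1 nn_integral_add nn_integral_cmult s_def)
  also have "\<dots> \<le> ennreal (4 * s\<^sup>2 + 3 * q) + (ennreal (8 * s') * ennreal s + ennreal (3 * q'))"
    using insert unfolding s_def q_def by (intro add_right_mono) auto
  also have "\<dots> = ennreal (4 * s\<^sup>2 + 3 * q + (8 * s' * s + 3 * q'))"
    using nn by (simp add: ennreal_plus[symmetric] ennreal_mult[symmetric] del: ennreal_plus)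
  also have "\<dots> \<le> ennreal (4 * (s' + s)\<^sup>2 + 3 * (q' + q))"
    by (intro ennreal_leI) (simp add: power2_sum algebra_simps)
  finally show ?case using insert.hyps by (simp add: s_def q_def s'_def q'_def)
qed

section \<open>Lindeberg replacement\<close>

text \<open>
  Integrating the pointwise expansion kills its linear term, because the law is centred.
\<close>

lemma smooth_step_integral_expansion:
  fixes lam \<tau> t :: real and d :: nat
  assumes lam: "0 < lam" and \<tau>: "0 < \<tau>" "\<tau> \<le> 1"
    and L: "centred_law d L V" and I4: "integrable L (\<lambda>x. (nsq d (V x))\<^sup>2)"
  defines "a \<equiv> \<lambda>w. nsq d w / lam - t"
  shows "\<bar>(\<integral>x. smooth_step (a (\<lambda>l. w l + V x l)) \<partial>L) - (smooth_step (a w)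
      + smooth_step_d1 (a w) / lam * (\<integral>x. nsq d (V x) \<partial>L)
        + 2 * smooth_step_d2 (a w) / lam\<^sup>2 * (\<integral>x. (ip d w (V x))\<^sup>2 \<partial>L))\<bar>
     \<le> 56 * \<tau> / lam\<^sup>2 * (\<integral>x. (ip d w (V x))\<^sup>2 \<partial>L)
        + (224 * (nsq d w)\<^sup>2 / lam ^ 4 + 14 / lam\<^sup>2) / \<tau> * (\<integral>x. (nsq d (V x))\<^sup>2 \<partial>L)"
proof -
  note D = centred_lawD[OF L]
  interpret prob_space L by (rule D(1))
  let ?F = "\<lambda>x. smooth_step (a (\<lambda>l. w l + V x l))"
  let ?T = "\<lambda>x. smooth_step (a w) + smooth_step_d1 (a w) * (2 * ip d w (V x) / lam) +
       (smooth_step_d1 (a w) / lam * nsq d (V x) + 2 * smooth_step_d2 (a w) / lam\<^sup>2 * (ip d w (V x))\<^sup>2)"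
  have mF: "?F \<in> borel_measurable L"
    unfolding a_def by (intro measurable_compose[OF _ smooth_step_measurable] borel_measurable_diff
        borel_measurable_divide nsq_measurable borel_measurable_add D) auto
  have iF: "integrable L ?F"
    by (rule integrable_const_bound[of _ 1]) (use smooth_step_bounds mF in \<open>auto simp: abs_le_iff intro: order_trans[of _ 0]\<close>)
  have iT: "integrable L ?T"
    using D(3,6,8) by (auto intro!: Bochner_Integration.integrable_add)
  have T: "(\<integral>x. ?T x \<partial>L) = smooth_step (a w) + smooth_step_d1 (a w) / lam * (\<integral>x. nsq d (V x) \<partial>L)
        + 2 * smooth_step_d2 (a w) / lam\<^sup>2 * (\<integral>x. (ip d w (V x))\<^sup>2 \<partial>L)"
    using D(3,6,7,8) by (simp add: prob_space)
  have "\<bar>(\<integral>x. ?F x \<partial>L) - (\<integral>x. ?T x \<partial>L)\<bar> = \<bar>\<integral>x. ?F x - ?T x \<partial>L\<bar>"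
    using iF iT by (subst Bochner_Integration.integral_diff) auto
  also have "\<dots> \<le> (\<integral>x. \<bar>?F x - ?T x\<bar> \<partial>L)"
    by (rule integral_abs_bound)
  also have "\<dots> \<le> (\<integral>x. 56 * \<tau> / lam\<^sup>2 * (ip d w (V x))\<^sup>2
        + (224 * (nsq d w)\<^sup>2 / lam ^ 4 + 14 / lam\<^sup>2) / \<tau> * (nsq d (V x))\<^sup>2 \<partial>L)"
    unfolding a_def
    by (intro integral_mono smooth_step_nsq_expansion lam \<tau> Bochner_Integration.integrable_abs
        Bochner_Integration.integrable_diff iF[unfolded a_def] iT[unfolded a_def]
        Bochner_Integration.integrable_add integrable_mult_right D(8) I4)
  also have "\<dots> = 56 * \<tau> / lam\<^sup>2 * (\<integral>x. (ip d w (V x))\<^sup>2 \<partial>L)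
        + (224 * (nsq d w)\<^sup>2 / lam ^ 4 + 14 / lam\<^sup>2) / \<tau> * (\<integral>x. (nsq d (V x))\<^sup>2 \<partial>L)"
    using D(8) I4 by (subst Bochner_Integration.integral_add) auto
  finally show ?thesis unfolding T .
qed

text \<open>
  Two laws with nearly equal second moments give nearly equal integrals. The discrepancy \<open>\<eta>\<close> of the quadratic
  forms is compared with \<open>\<parallel>w\<parallel>\<^sup>2\<close> and that of the traces with \<open>\<surd>d\<close>: this is how a symmetric matrix of
  Frobenius norm \<open>\<eta>\<close> acts.
\<close>

lemma smooth_step_integral_swap:
  fixes lam \<tau> t :: real and d :: nat
  assumes lam: "0 < lam" and \<tau>: "0 < \<tau>" "\<tau> \<le> 1"
    and A: "centred_law d A V" "integrable A (\<lambda>x. (nsq d (V x))\<^sup>2)"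
    and B: "centred_law d B V" "integrable B (\<lambda>x. (nsq d (V x))\<^sup>2)"
    and ip: "\<bar>(\<integral>x. (ip d w (V x))\<^sup>2 \<partial>A) - (\<integral>x. (ip d w (V x))\<^sup>2 \<partial>B)\<bar>
        \<le> \<eta> * nsq d w"
    and tr: "\<bar>(\<integral>x. nsq d (V x) \<partial>A) - (\<integral>x. nsq d (V x) \<partial>B)\<bar> \<le> \<eta> * sqrt d"
    and qA: "(\<integral>x. (nsq d (V x))\<^sup>2 \<partial>A) \<le> q" and qB: "(\<integral>x. (nsq d (V x))\<^sup>2 \<partial>B) \<le> q"
  defines "F \<equiv> \<lambda>x. smooth_step (nsq d (\<lambda>l. w l + V x l) / lam - t)"
  shows "\<bar>(\<integral>x. F x \<partial>A) - (\<integral>x. F x \<partial>B)\<bar> \<le> \<eta> * sqrt d / lam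
      + 2 * \<eta> / lam\<^sup>2 * nsq d w
     + 56 * \<tau> / lam\<^sup>2 * (\<integral>x. (ip d w (V x))\<^sup>2 \<partial>A)
         + 56 * \<tau> / lam\<^sup>2 * (\<integral>x. (ip d w (V x))\<^sup>2 \<partial>B)
     + (448 / lam ^ 4 / \<tau> * q * (nsq d w)\<^sup>2 + 28 / lam\<^sup>2 / \<tau> * q)"
proof -
  have triangle: "\<bar>X - Y\<bar> \<le> e1 + e2 + a + b + 2 * k"
    if "\<bar>X - (s + p + r)\<bar> \<le> a + k1" "k1 \<le> k" "\<bar>Y - (s + p' + r')\<bar> \<le> b + k2" "k2 \<le> k"
      "\<bar>p - p'\<bar> \<le> e1" "\<bar>r - r'\<bar> \<le> e2" for X Y s p p' r r' a b k k1 k2 e1 e2 :: real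
    using that by linarith
  define u where "u = nsq d w / lam - t"
  define mA mB iA iB qA' qB' where "mA = (\<integral>x. nsq d (V x) \<partial>A)" and "mB = (\<integral>x. nsq d (V x) \<partial>B)"
    and "iA = (\<integral>x. (ip d w (V x))\<^sup>2 \<partial>A)" and "iB = (\<integral>x. (ip d w (V x))\<^sup>2 \<partial>B)"
    and "qA' = (\<integral>x. (nsq d (V x))\<^sup>2 \<partial>A)" and "qB' = (\<integral>x. (nsq d (V x))\<^sup>2 \<partial>B)"
  define K where "K = (224 * (nsq d w)\<^sup>2 / lam ^ 4 + 14 / lam\<^sup>2) / \<tau>"
  have K: "0 \<le> K" using lam \<tau> by (simp add: K_def)
  have "\<bar>(\<integral>x. F x \<partial>A) - (smooth_step u + smooth_step_d1 u / lam * mA + 2 * smooth_step_d2 u / lam\<^sup>2 * iA)\<bar>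
     \<le> 56 * \<tau> / lam\<^sup>2 * iA + K * qA'"
    unfolding F_def u_def mA_def iA_def qA'_def K_def
    by (rule smooth_step_integral_expansion[OF lam \<tau> A])
  moreover have "K * qA' \<le> K * q" using K qA by (simp add: qA'_def mult_left_mono)
  moreover have "\<bar>(\<integral>x. F x \<partial>B) - (smooth_step u + smooth_step_d1 u / lam * mB + 2 * smooth_step_d2 u / lam\<^sup>2 * iB)\<bar>
     \<le> 56 * \<tau> / lam\<^sup>2 * iB + K * qB'"
    unfolding F_def u_def mB_def iB_def qB'_def K_def
    by (rule smooth_step_integral_expansion[OF lam \<tau> B])
  moreover have "K * qB' \<le> K * q" using K qB by (simp add: qB'_def mult_left_mono)
  moreover have "\<bar>smooth_step_d1 u / lam * (mA - mB)\<bar> \<le> \<eta> * sqrt d / lam"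
  proof -
    have "\<bar>smooth_step_d1 u\<bar> * \<bar>mA - mB\<bar> \<le> 1 * (\<eta> * sqrt d)"
      using tr by (intro mult_mono smooth_step_d1_bound) (auto simp: mA_def mB_def)
    then show ?thesis using lam by (simp add: abs_mult divide_right_mono)
  qed
  moreover have "\<bar>2 * smooth_step_d2 u / lam\<^sup>2 * (iA - iB)\<bar> \<le> 2 * \<eta> / lam\<^sup>2 * nsq d w"
  proof -
    have "\<bar>smooth_step_d2 u\<bar> * \<bar>iA - iB\<bar> \<le> 1 * (\<eta> * nsq d w)"
      using ip by (intro mult_mono smooth_step_d2_bound) (auto simp: iA_def iB_def)
    then have "2 * (\<bar>smooth_step_d2 u\<bar> * \<bar>iA - iB\<bar>) / lam\<^sup>2 \<le> 2 * (\<eta> * nsq d w) / lam\<^sup>2"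
      by (intro divide_right_mono) auto
    then show ?thesis by (simp add: abs_mult mult.assoc)
  qed
  ultimately have "\<bar>(\<integral>x. F x \<partial>A) - (\<integral>x. F x \<partial>B)\<bar> \<le> \<eta> * sqrt d / lam
      + 2 * \<eta> / lam\<^sup>2 * nsq d w
     + 56 * \<tau> / lam\<^sup>2 * iA + 56 * \<tau> / lam\<^sup>2 * iB + 2 * (K * q)"
    unfolding right_diff_distrib by (rule triangle)
  also have "2 * (K * q) = 448 / lam ^ 4 / \<tau> * q * (nsq d w)\<^sup>2 + 28 / lam\<^sup>2 / \<tau> * q"
    by (simp add: K_def add_divide_distrib algebra_simps)
  finally show ?thesis by (simp add: iA_def iB_def)
qed

text \<open>
  The squared norm is the sum of the quadratic form over the standard basis.
\<close>

lemma nsq_moment_le: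
  assumes L: "centred_law d L V" and s: "\<And>v. (\<integral>x. (ip d v (V x))\<^sup>2 \<partial>L) \<le> s v"
  shows "(\<integral>x. nsq d (V x) \<partial>L) \<le> (\<Sum>l<d. s (\<lambda>m. of_bool (m = l)))"
proof -
  have b: "ip d (\<lambda>m. of_bool (m = l)) (V x) = V x l" if "l < d" for l x
    using that by (simp add: ip_def of_bool_def if_distrib[of "\<lambda>y. y * _"] cong: if_cong)
  have "(\<integral>x. nsq d (V x) \<partial>L) = (\<Sum>l<d. \<integral>x. (V x l)\<^sup>2 \<partial>L)"
    unfolding nsq_def using centred_lawD(4)[OF L]
    by (intro Bochner_Integration.integral_sum) (simp add: power2_eq_square)
  also have "\<dots> = (\<Sum>l<d. \<integral>x. (ip d (\<lambda>m. of_bool (m = l)) (V x))\<^sup>2 \<partial>L)"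
    by (intro sum.cong refl) (simp add: b)
  also have "\<dots> \<le> (\<Sum>l<d. s (\<lambda>m. of_bool (m = l)))"
    by (intro sum_mono s)
  finally show ?thesis .
qed

lemma nsq_basis: "l < d \<Longrightarrow> nsq d (\<lambda>m. of_bool (m = l)) = 1"
  by (simp add: nsq_def of_bool_def if_distrib[of "\<lambda>y. y\<^sup>2"] cong: if_cong)

text \<open>
  The partial sum without the \<open>k\<close>-th summand is independent of that summand, so the estimate for a fixed \<open>w\<close> can
  be integrated over \<open>w\<close>. The mixed term \<open>E \<langle>w, V\<rangle>\<^sup>2\<close> is integrated over \<open>w\<close> first: this yields \<open>\<kappa> E \<parallel>V\<parallel>\<^sup>2\<close>,
  whereas Cauchy--Schwarz would lose a factor \<open>d\<close>.
\<close>

lemma lindeberg_step: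
  fixes H :: "nat \<Rightarrow> 'b measure" and A B :: "'b measure" and V :: "nat \<Rightarrow> 'b \<Rightarrow> nat \<Rightarrow> real"
      and lam \<tau> t \<eta> \<kappa> \<rho> m q :: real
  assumes lam: "0 < lam" and \<tau>: "0 < \<tau>" "\<tau> \<le> 1" and nn: "0 \<le> \<eta>" "0 \<le> \<kappa>" "0 \<le> \<rho>"
    and J: "finite J" "k \<notin> J"
    and H: "\<And>i. i \<in> J \<Longrightarrow> centred_law d (H i) (V i)" "\<And>i. i \<in> J
        \<Longrightarrow> integrable (H i) (\<lambda>x. (nsq d (V i x))\<^sup>2)"
    and A: "centred_law d A (V k)" "integrable A (\<lambda>x. (nsq d (V k x))\<^sup>2)"
    and B: "centred_law d B (V k)" "integrable B (\<lambda>x. (nsq d (V k x))\<^sup>2)"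
    and HI: "\<And>v. (\<Sum>i\<in>J. \<integral>x. (ip d v (V i x))\<^sup>2 \<partial>H i) \<le> \<kappa> * nsq d v"
    and HM: "(\<Sum>i\<in>J. \<integral>x. nsq d (V i x) \<partial>H i) \<le> \<kappa> * d"
    and HQ: "(\<Sum>i\<in>J. \<integral>x. (nsq d (V i x))\<^sup>2 \<partial>H i) \<le> \<rho>"
    and mA: "(\<integral>x. nsq d (V k x) \<partial>A) \<le> m" and mB: "(\<integral>x. nsq d (V k x) \<partial>B) \<le> m"
    and qA: "(\<integral>x. (nsq d (V k x))\<^sup>2 \<partial>A) \<le> q" and qB: "(\<integral>x. (nsq d (V k x))\<^sup>2 \<partial>B) \<le> q"
    and ip: "\<And>v. \<bar>(\<integral>x. (ip d v (V k x))\<^sup>2 \<partial>A) - (\<integral>x. (ip d v (V k x))\<^sup>2 \<partial>B)\<bar>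
        \<le> \<eta> * nsq d v"
    and tr: "\<bar>(\<integral>x. nsq d (V k x) \<partial>A) - (\<integral>x. nsq d (V k x) \<partial>B)\<bar> \<le> \<eta> * sqrt d"
  defines "F \<equiv> \<lambda>x. smooth_step (nsq d (vsum (insert k J) V x) / lam - t)"
  shows "\<bar>(\<integral>x. F x \<partial>PiM (insert k J) (H(k := A))) - (\<integral>x. F x \<partial>PiM (insert k J) (H(k := B)))\<bar>
    \<le> \<eta> * (sqrt d / lam + 2 * \<kappa> * d / lam\<^sup>2) + 112 * \<tau> * \<kappa> / lam\<^sup>2 * m
      + (448 * (4 * (\<kappa> * d)\<^sup>2 + 3 * \<rho>) / lam ^ 4 + 28 / lam\<^sup>2) / \<tau> * q"
proof -
  \<comment> \<open>outside \<open>J\<close> any probability space will do, since the product over \<open>J\<close> does not see it\<close>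
  define N where "N = (\<lambda>i. if i \<in> J then H i else return (count_space UNIV) undefined)"
  have PN: "prob_space (N i)" for i
    using H(1) by (auto simp: N_def centred_law_def prob_space_return)
  interpret A: prob_space A using A by (simp add: centred_law_def)
  interpret B: prob_space B using B by (simp add: centred_law_def)
  define W where "W = PiM J N"
  interpret W: prob_space W unfolding W_def by (rule prob_space_PiM) (rule PN)
  have WH: "W = PiM J H" unfolding W_def by (rule PiM_cong) (auto simp: N_def)
  define S where "S = vsum J V"
  have S: "(\<lambda>x. S x l) \<in> borel_measurable W" if "l < d" for l
    unfolding WH S_def using vsum_measurable[OF H(1) that] .
  have nsqS [measurable]: "(\<lambda>x. nsq d (S x)) \<in> borel_measurable W"
    by (rule nsq_measurable) (rule S)
  define G where "G x y = smooth_step (nsq d (\<lambda>l. S x l + V k y l) / lam - t)" for x y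
  have G01: "\<bar>G x y\<bar> \<le> 1" for x y
    unfolding G_def using smooth_step_bounds by (auto simp: abs_le_iff intro: order_trans[of _ 0])
  have Gm: "(\<lambda>(x, y). G x y) \<in> borel_measurable (W \<Otimes>\<^sub>M L)" if L: "centred_law d L (V k)" for L
    unfolding G_def split_beta
    by (intro measurable_compose[OF _ smooth_step_measurable] borel_measurable_diff borel_measurable_divide
        nsq_measurable borel_measurable_add measurable_compose[OF measurable_fst S]
        measurable_compose[OF measurable_snd centred_lawD(2)[OF L]]) auto
  have iG: "integrable W (\<lambda>x. \<integral>y. G x y \<partial>L)" if L: "centred_law d L (V k)" for L
  proof (rule W.integrable_const_bound[of _ 1])
    interpret L: prob_space L using L by (simp add: centred_law_def)
    show "(\<lambda>x. \<integral>y. G x y \<partial>L) \<in> borel_measurable W"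
      using Gm[OF L] by (rule L.borel_measurable_lebesgue_integral)
    have "\<bar>\<integral>y. G x y \<partial>L\<bar> \<le> 1" for x
    proof -
      have "\<bar>\<integral>y. G x y \<partial>L\<bar> \<le> (\<integral>y. \<bar>G x y\<bar> \<partial>L)" by (rule integral_abs_bound)
      also have "\<dots> \<le> (\<integral>y. 1 \<partial>L)" using G01
        by (intro integral_mono') auto
      finally show ?thesis by (simp add: L.prob_space)
    qed
    then show "AE x in W. norm (\<integral>y. G x y \<partial>L) \<le> 1" by simp
  qed
  have expand: "(\<integral>x. F x \<partial>PiM (insert k J) (H(k := L))) = (\<integral>x. \<integral>y. G x y \<partial>L \<partial>W)"
    if L: "centred_law d L (V k)" for L
  proof -
    have PL: "prob_space ((N(k := L)) i)" for i
      using PN L by (auto simp: centred_law_def)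
    interpret L: product_sigma_finite "N(k := L)"
      by (rule product_sigma_finite_prob) (rule PL)
    interpret PL: prob_space "PiM (insert k J) (N(k := L))"
      by (rule prob_space_PiM) (rule PL)
    have eq: "PiM (insert k J) (H(k := L)) = PiM (insert k J) (N(k := L))"
      by (intro PiM_cong) (auto simp: N_def)
    have WL: "PiM J (N(k := L)) = W"
      unfolding W_def using J by (intro PiM_cong) auto
    have "F \<in> borel_measurable (PiM (insert k J) (N(k := L)))"
      unfolding F_def
      by (intro measurable_compose[OF _ smooth_step_measurable] borel_measurable_diff borel_measurable_divide
        nsq_measurable vsum_measurable) (use H L J in \<open>auto simp: N_def\<close>)
    then have "integrable (PiM (insert k J) (N(k := L))) F"
      using smooth_step_bounds by (intro PL.integrable_const_bound[of _ 1])
        (auto simp: F_def abs_le_iff intro: order_trans[of _ 0])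
    then have "(\<integral>x. F x \<partial>PiM (insert k J) (N(k := L))) = (\<integral>x. \<integral>y. F (x(k := y)) \<partial>L \<partial>W)"
      using L.product_integral_insert[OF J] by (simp add: WL)
    also have "\<dots> = (\<integral>x. \<integral>y. G x y \<partial>L \<partial>W)"
      by (simp add: F_def G_def S_def vsum_insert_upd[OF J])
    finally show ?thesis by (simp add: eq)
  qed
  define c1 c2 c3 where "c1 = 2 * \<eta> / lam\<^sup>2" and "c2 = 56 * \<tau> / lam\<^sup>2" and "c3 = 448 / lam ^ 4 / \<tau> * q"
  define c0 where "c0 = \<eta> * sqrt d / lam + 28 / lam\<^sup>2 / \<tau> * q"
  have q: "0 \<le> q" using qA by (rule order_trans[rotated]) simp
  have m: "0 \<le> m" using mA by (rule order_trans[rotated]) simp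
  have c: "0 \<le> c0" "0 \<le> c1" "0 \<le> c2" "0 \<le> c3"
    using lam \<tau> nn q by (auto simp: c0_def c1_def c2_def c3_def)
  define jA jB where "jA = (\<lambda>x. \<integral>y. (ip d (S x) (V k y))\<^sup>2 \<partial>A)" and "jB
      = (\<lambda>x. \<integral>y. (ip d (S x) (V k y))\<^sup>2 \<partial>B)"
  have bound: "\<bar>(\<integral>y. G x y \<partial>A) - (\<integral>y. G x y \<partial>B)\<bar> \<le> c0 + c1 * nsq d (S x) + c2 * jA x + c2 * jB x
      + c3 * (nsq d (S x))\<^sup>2" for x
    using smooth_step_integral_swap[OF lam \<tau> A B ip tr qA qB, of "S x" t]
    by (simp add: G_def c0_def c1_def c2_def c3_def jA_def jB_def)
  have ipm: "(\<lambda>(x, y). (ip d (S x) (V k y))\<^sup>2) \<in> borel_measurable (W \<Otimes>\<^sub>M L)" if L: "centred_law d L (V k)" for L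
    unfolding ip_def split_beta
    by (intro borel_measurable_power borel_measurable_sum borel_measurable_times measurable_compose[OF measurable_fst S]
        measurable_compose[OF measurable_snd centred_lawD(2)[OF L]]) auto
  have J1: "(\<integral>\<^sup>+x. ennreal (\<integral>y. (ip d (S x) (V k y))\<^sup>2 \<partial>L) \<partial>W) \<le> ennreal (\<kappa> * m)"
    if L: "centred_law d L (V k)" and mL: "(\<integral>x. nsq d (V k x) \<partial>L) \<le> m" for L
  proof -
    interpret L: prob_space L using L by (simp add: centred_law_def)
    interpret WL: pair_sigma_finite W L ..
    have "(\<integral>\<^sup>+x. ennreal (\<integral>y. (ip d (S x) (V k y))\<^sup>2 \<partial>L) \<partial>W)
        = (\<integral>\<^sup>+x. \<integral>\<^sup>+y. ennreal ((ip d (S x) (V k y))\<^sup>2) \<partial>L \<partial>W)"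
      by (intro nn_integral_cong nn_integral_eq_integral[symmetric] centred_lawD(8)[OF L]) auto
    also have "\<dots> = (\<integral>\<^sup>+y. \<integral>\<^sup>+x. ennreal ((ip d (S x) (V k y))\<^sup>2) \<partial>W \<partial>L)"
      using measurable_compose[OF ipm[OF L] measurable_ennreal]
      by (intro WL.Fubini'[symmetric]) (simp add: split_beta)
    also have "\<dots> \<le> (\<integral>\<^sup>+y. ennreal (\<kappa> * nsq d (V k y)) \<partial>L)"
      unfolding WH S_def using J H HI by (subst vsum_ip_moment) (auto intro!: nn_integral_mono ennreal_leI)
    also have "\<dots> = ennreal (\<kappa> * (\<integral>y. nsq d (V k y) \<partial>L))"
      using nn centred_lawD(3)[OF L] by (subst nn_integral_eq_integral) auto
    also have "\<dots> \<le> ennreal (\<kappa> * m)" using nn mL by (intro ennreal_leI mult_left_mono) auto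
    finally show ?thesis .
  qed
  have jm: "(\<lambda>x. \<integral>y. (ip d (S x) (V k y))\<^sup>2 \<partial>L) \<in> borel_measurable W" if L: "centred_law d L (V k)" for L
  proof -
    interpret L: prob_space L using L by (simp add: centred_law_def)
    show ?thesis using ipm[OF L] by (rule L.borel_measurable_lebesgue_integral)
  qed
  have [measurable]: "jA \<in> borel_measurable W" "jB \<in> borel_measurable W"
    unfolding jA_def jB_def using jm A B by auto
  have jnn: "0 \<le> jA x" "0 \<le> jB x" for x by (auto simp: jA_def jB_def)
  have "ennreal \<bar>(\<integral>x. F x \<partial>PiM (insert k J) (H(k := A))) - (\<integral>x. F x \<partial>PiM (insert k J) (H(k := B)))\<bar>
     = ennreal \<bar>\<integral>x. (\<integral>y. G x y \<partial>A) - (\<integral>y. G x y \<partial>B) \<partial>W\<bar>"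
    unfolding expand[OF A(1)] expand[OF B(1)]
    by (subst Bochner_Integration.integral_diff) (auto intro: iG A B)
  also have "\<dots> \<le> (\<integral>\<^sup>+x. ennreal \<bar>(\<integral>y. G x y \<partial>A)
      - (\<integral>y. G x y \<partial>B)\<bar> \<partial>W)"
    using integral_norm_bound_ennreal[of W "\<lambda>x. (\<integral>y. G x y \<partial>A) - (\<integral>y. G x y \<partial>B)"] iG A B by simp
  also have "\<dots> \<le> (\<integral>\<^sup>+x. ennreal (c0 + c1 * nsq d (S x) + c2 * jA x + c2 * jB x + c3 * (nsq d (S x))\<^sup>2) \<partial>W)"
    by (intro nn_integral_mono ennreal_leI bound)
  also have "\<dots> = (\<integral>\<^sup>+x. ennreal c0 + ennreal c1 * ennreal (nsq d (S x)) + ennreal c2 * ennreal (jA x)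
      + ennreal c2 * ennreal (jB x) + ennreal c3 * ennreal ((nsq d (S x))\<^sup>2) \<partial>W)"
    using c jnn by (intro nn_integral_cong) (simp add: ennreal_mult[symmetric] ennreal_plus[symmetric] del: ennreal_plus)
  also have "\<dots> = ennreal c0 + ennreal c1 * (\<integral>\<^sup>+x. ennreal (nsq d (S x)) \<partial>W)
      + ennreal c2 * (\<integral>\<^sup>+x. ennreal (jA x) \<partial>W)
      + ennreal c2 * (\<integral>\<^sup>+x. ennreal (jB x) \<partial>W)
          + ennreal c3 * (\<integral>\<^sup>+x. ennreal ((nsq d (S x))\<^sup>2) \<partial>W)"
    by (simp add: nn_integral_add nn_integral_cmult W.emeasure_space_1)
  also have "\<dots> \<le> ennreal c0 + ennreal c1 * ennreal (\<kappa> * d) + ennreal c2 * ennreal (\<kappa> * m)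
      + ennreal c2 * ennreal (\<kappa> * m) + ennreal c3 * ennreal (4 * (\<kappa> * d)\<^sup>2 + 3 * \<rho>)"
  proof (intro add_mono mult_left_mono order_refl)
    show "(\<integral>\<^sup>+x. ennreal (nsq d (S x)) \<partial>W) \<le> ennreal (\<kappa> * d)"
      unfolding WH S_def using J H HM by (subst vsum_second_moment) (auto intro!: ennreal_leI)
    show "(\<integral>\<^sup>+x. ennreal (jA x) \<partial>W) \<le> ennreal (\<kappa> * m)" "(\<integral>\<^sup>+x. ennreal (jB x) \<partial>W)
        \<le> ennreal (\<kappa> * m)"
      unfolding jA_def jB_def using J1 A B mA mB by auto
    have "(\<integral>\<^sup>+x. ennreal ((nsq d (S x))\<^sup>2) \<partial>W)
        \<le> ennreal (4 * (\<Sum>i\<in>J. \<integral>x. nsq d (V i x) \<partial>H i)\<^sup>2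
        + 3 * (\<Sum>i\<in>J. \<integral>x. (nsq d (V i x))\<^sup>2 \<partial>H i))"
      unfolding WH S_def using J H by (intro vsum_fourth_moment) auto
    also have "\<dots> \<le> ennreal (4 * (\<kappa> * d)\<^sup>2 + 3 * \<rho>)"
      using HM HQ by (intro ennreal_leI add_mono mult_left_mono power_mono) (auto intro!: sum_nonneg)
    finally show "(\<integral>\<^sup>+x. ennreal ((nsq d (S x))\<^sup>2) \<partial>W) \<le> ennreal (4 * (\<kappa> * d)\<^sup>2 + 3 * \<rho>)" .
  qed auto
  also have "\<dots> = ennreal (c0 + c1 * (\<kappa> * d) + c2 * (\<kappa> * m) + c2 * (\<kappa> * m) + c3 * (4 * (\<kappa> * d)\<^sup>2
      + 3 * \<rho>))"
    using c nn m by (simp add: ennreal_mult[symmetric] ennreal_plus[symmetric] del: ennreal_plus)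
  finally have "\<bar>(\<integral>x. F x \<partial>PiM (insert k J) (H(k := A))) - (\<integral>x. F x \<partial>PiM (insert k J) (H(k := B)))\<bar>
     \<le> c0 + c1 * (\<kappa> * d) + c2 * (\<kappa> * m) + c2 * (\<kappa> * m) + c3 * (4 * (\<kappa> * d)\<^sup>2 + 3 * \<rho>)"
    using c nn m by (subst (asm) ennreal_le_iff) (auto intro!: add_nonneg_nonneg mult_nonneg_nonneg)
  also have "\<dots> = \<eta> * (sqrt d / lam + 2 * \<kappa> * d / lam\<^sup>2) + 112 * \<tau> * \<kappa> / lam\<^sup>2 * m
      + (448 * (4 * (\<kappa> * d)\<^sup>2 + 3 * \<rho>) / lam ^ 4 + 28 / lam\<^sup>2) / \<tau> * q"
    by (simp add: c0_def c1_def c2_def c3_def add_divide_distrib algebra_simps)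
  finally show ?thesis .
qed

text \<open>
  Telescoping over hybrid products whose first factors come from \<open>A\<close> and whose remaining factors come from \<open>B\<close>. The
  common bound \<open>s i\<close> for the quadratic forms controls every hybrid at once, and its sum \<open>\<kappa>\<close> bounds the
  covariance of all partial sums.
\<close>

lemma lindeberg:
  fixes A B :: "nat \<Rightarrow> 'b measure" and V :: "nat \<Rightarrow> 'b \<Rightarrow> nat \<Rightarrow> real"
      and lam \<tau> t \<eta> \<kappa> \<rho> :: real
    and s :: "nat \<Rightarrow> (nat \<Rightarrow> real) \<Rightarrow> real" and q e :: "nat \<Rightarrow> real"
  assumes lam: "0 < lam" and \<tau>: "0 < \<tau>" "\<tau> \<le> 1"
    and A: "\<And>i. i \<in> {1..n} \<Longrightarrow> centred_law d (A i) (V i)" "\<And>i. i \<in> {1..n}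
        \<Longrightarrow> integrable (A i) (\<lambda>x. (nsq d (V i x))\<^sup>2)"
    and B: "\<And>i. i \<in> {1..n} \<Longrightarrow> centred_law d (B i) (V i)" "\<And>i. i \<in> {1..n}
        \<Longrightarrow> integrable (B i) (\<lambda>x. (nsq d (V i x))\<^sup>2)"
    and sA: "\<And>i v. i \<in> {1..n} \<Longrightarrow> (\<integral>x. (ip d v (V i x))\<^sup>2 \<partial>A i) \<le> s i v"
    and sB: "\<And>i v. i \<in> {1..n} \<Longrightarrow> (\<integral>x. (ip d v (V i x))\<^sup>2 \<partial>B i) \<le> s i v"
    and s: "\<And>v. (\<Sum>i=1..n. s i v) \<le> \<kappa> * nsq d v"
    and qA: "\<And>i. i \<in> {1..n} \<Longrightarrow> (\<integral>x. (nsq d (V i x))\<^sup>2 \<partial>A i) \<le> q i"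
    and qB: "\<And>i. i \<in> {1..n} \<Longrightarrow> (\<integral>x. (nsq d (V i x))\<^sup>2 \<partial>B i) \<le> q i"
    and q: "(\<Sum>i=1..n. q i) \<le> \<rho>"
    and e: "\<And>i. i \<in> {1..n} \<Longrightarrow> 0 \<le> e i" "(\<Sum>i=1..n. e i) \<le> \<eta>"
    and ip: "\<And>i v. i \<in> {1..n} \<Longrightarrow> \<bar>(\<integral>x. (ip d v (V i x))\<^sup>2 \<partial>A i)
        - (\<integral>x. (ip d v (V i x))\<^sup>2 \<partial>B i)\<bar> \<le> e i * nsq d v"
    and tr: "\<And>i. i \<in> {1..n} \<Longrightarrow> \<bar>(\<integral>x. nsq d (V i x) \<partial>A i)
        - (\<integral>x. nsq d (V i x) \<partial>B i)\<bar> \<le> e i * sqrt d"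
    and \<kappa>: "0 \<le> \<kappa>"
  defines "F \<equiv> \<lambda>x. smooth_step (nsq d (vsum {1..n} V x) / lam - t)"
  shows "\<bar>(\<integral>x. F x \<partial>PiM {1..n} A) - (\<integral>x. F x \<partial>PiM {1..n} B)\<bar>
    \<le> \<eta> * (sqrt d / lam + 2 * \<kappa> * d / lam\<^sup>2) + 112 * \<tau> * \<kappa> / lam\<^sup>2 * (\<kappa> * d)
      + (448 * (4 * (\<kappa> * d)\<^sup>2 + 3 * \<rho>) / lam ^ 4 + 28 / lam\<^sup>2) / \<tau> * \<rho>"
proof -
  define m where "m i = (\<Sum>l<d. s i (\<lambda>m. of_bool (m = l)))" for i
  have s0: "0 \<le> s i v" if "i \<in> {1..n}" for i v
    using sA[OF that, of v] by (rule order_trans[rotated]) simp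
  have q0: "0 \<le> q i" if "i \<in> {1..n}" for i
    using qA[OF that] by (rule order_trans[rotated]) simp
  have \<rho>: "0 \<le> \<rho>" using q sum_nonneg[of "{1..n}" q] q0 by auto
  have m0: "0 \<le> m i" if "i \<in> {1..n}" for i unfolding m_def by (intro sum_nonneg s0 that)
  have m: "(\<Sum>i=1..n. m i) \<le> \<kappa> * d"
  proof -
    have "(\<Sum>i=1..n. m i) = (\<Sum>l<d. \<Sum>i=1..n. s i (\<lambda>m. of_bool (m = l)))"
      unfolding m_def by (rule sum.swap)
    also have "\<dots> \<le> (\<Sum>l<d. \<kappa> * 1)"
      by (intro sum_mono order_trans[OF s]) (simp add: nsq_basis)
    finally show ?thesis by (simp add: mult.commute)
  qed
  define U where "U k = (\<integral>x. F x \<partial>PiM {1..n} (\<lambda>i. if i < k then A i else B i))" for k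
  define err where "err k = e k * (sqrt d / lam + 2 * \<kappa> * d / lam\<^sup>2) + 112 * \<tau> * \<kappa> / lam\<^sup>2 * m k
      + (448 * (4 * (\<kappa> * d)\<^sup>2 + 3 * \<rho>) / lam ^ 4 + 28 / lam\<^sup>2) / \<tau> * q k" for k
  have swap: "\<bar>U (Suc k) - U k\<bar> \<le> err k" if k: "k \<in> {1..n}" for k
  proof -
    define J where "J = {1..n} - {k}"
    have J: "finite J" "k \<notin> J" "J \<subseteq> {1..n}" and Jk: "insert k J = {1..n}"
      using k by (auto simp: J_def)
    define H where "H = (\<lambda>i. if i < k then A i else B i)"
    have UA: "U (Suc k) = (\<integral>x. F x \<partial>PiM (insert k J) (H(k := A k)))"
      unfolding U_def Jk by (intro arg_cong[where f = "\<lambda>M. integral\<^sup>L M F"] PiM_cong) (auto simp: H_def less_Suc_eq)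
    have UB: "U k = (\<integral>x. F x \<partial>PiM (insert k J) (H(k := B k)))"
      unfolding U_def Jk by (intro arg_cong[where f = "\<lambda>M. integral\<^sup>L M F"] PiM_cong) (auto simp: H_def)
    have sub: "(\<Sum>i\<in>J. f i) \<le> b" if "\<And>i. i \<in> {1..n} \<Longrightarrow> f i \<le> g i" "\<And>i. i \<in> {1..n} \<Longrightarrow> 0
        \<le> g i" "(\<Sum>i=1..n. g i) \<le> b"
      for f g :: "nat \<Rightarrow> real" and b
    proof -
      have "(\<Sum>i\<in>J. f i) \<le> (\<Sum>i\<in>J. g i)" using that J by (intro sum_mono) auto
      also have "\<dots> \<le> (\<Sum>i=1..n. g i)" using that J by (intro sum_mono2) auto
      finally show ?thesis using that by simp
    qed
    show ?thesis
      unfolding UA UB err_def F_def Jk [symmetric]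
    proof (rule lindeberg_step[OF lam \<tau> _ \<kappa> \<rho> J(1,2)])
      show "0 \<le> e k" using e k by simp
      show "centred_law d (H i) (V i)" "integrable (H i) (\<lambda>x. (nsq d (V i x))\<^sup>2)" if "i \<in> J" for i
        using that J A B by (auto simp: H_def)
      show "(\<Sum>i\<in>J. \<integral>x. (ip d v (V i x))\<^sup>2 \<partial>H i) \<le> \<kappa> * nsq d v" for v
        by (rule sub[where g = "\<lambda>i. s i v"]) (use sA sB s0 s in \<open>auto simp: H_def\<close>)
      show "(\<Sum>i\<in>J. \<integral>x. nsq d (V i x) \<partial>H i) \<le> \<kappa> * d"
        by (rule sub[where g = m])
          (use A B m m0 nsq_moment_le[OF A(1) sA] nsq_moment_le[OF B(1) sB] in \<open>auto simp: H_def m_def\<close>)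
      show "(\<Sum>i\<in>J. \<integral>x. (nsq d (V i x))\<^sup>2 \<partial>H i) \<le> \<rho>"
        by (rule sub[where g = q]) (use qA qB q q0 in \<open>auto simp: H_def\<close>)
      show "(\<integral>x. nsq d (V k x) \<partial>A k) \<le> m k" "(\<integral>x. nsq d (V k x) \<partial>B k) \<le> m k"
        unfolding m_def using nsq_moment_le[OF A(1) sA] nsq_moment_le[OF B(1) sB] k by auto
    qed (use A B qA qB ip tr k in auto)
  qed
  have UA: "U (Suc n) = (\<integral>x. F x \<partial>PiM {1..n} A)" and UB: "U 1 = (\<integral>x. F x \<partial>PiM {1..n} B)"
    unfolding U_def by (intro arg_cong[where f = "\<lambda>M. integral\<^sup>L M F"] PiM_cong; auto)+
  have "U (Suc n) - U 1 = (\<Sum>k=1..n. U (Suc k) - U k)"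
    by (rule sum_Suc_diff[symmetric]) simp
  then have "\<bar>U (Suc n) - U 1\<bar> \<le> (\<Sum>k=1..n. \<bar>U (Suc k) - U k\<bar>)"
    by (simp add: sum_abs)
  also have "\<dots> \<le> (\<Sum>k=1..n. err k)" by (intro sum_mono swap)
  also have "\<dots> = (\<Sum>k=1..n. e k) * (sqrt d / lam + 2 * \<kappa> * d / lam\<^sup>2)
      + 112 * \<tau> * \<kappa> / lam\<^sup>2 * (\<Sum>k=1..n. m k)
      + (448 * (4 * (\<kappa> * d)\<^sup>2 + 3 * \<rho>) / lam ^ 4 + 28 / lam\<^sup>2) / \<tau> * (\<Sum>k=1..n. q k)"
    by (simp add: err_def sum.distrib sum_distrib_left sum_distrib_right)
  also have "\<dots> \<le> \<eta> * (sqrt d / lam + 2 * \<kappa> * d / lam\<^sup>2) + 112 * \<tau> * \<kappa> / lam\<^sup>2 * (\<kappa> * d)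
      + (448 * (4 * (\<kappa> * d)\<^sup>2 + 3 * \<rho>) / lam ^ 4 + 28 / lam\<^sup>2) / \<tau> * \<rho>"
    using e q m lam \<tau> \<kappa> \<rho> by (intro add_mono mult_left_mono mult_right_mono) auto
  finally show ?thesis unfolding UA UB .
qed

section \<open>Stability of Gaussian measures\<close>

lemma prob_space_stdn: "prob_space std_normal_distribution"
  using prob_space_normal_density[of 1 0] by simp

lemma sets_stdn [simp, measurable_cong]: "sets std_normal_distribution = sets borel"
  by simp

text \<open>
  On probability spaces boundedness is all the integrability that the characteristic functions below need.
\<close>

lemma Fubini_bounded:
  fixes f :: "'x \<Rightarrow> 'y \<Rightarrow> complex"
  assumes "prob_space M1" "prob_space M2" and f: "case_prod f \<in> borel_measurable (M1 \<Otimes>\<^sub>M M2)"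
    and b: "\<And>x y. norm (f x y) \<le> K"
  shows "(\<integral>x. \<integral>y. f x y \<partial>M2 \<partial>M1) = (\<integral>y. \<integral>x. f x y \<partial>M1 \<partial>M2)"
    and "(\<integral>x. \<integral>y. f x y \<partial>M2 \<partial>M1) = (\<integral>z. f (fst z) (snd z) \<partial>(M1 \<Otimes>\<^sub>M M2))"
proof -
  interpret M1: prob_space M1 by fact
  interpret M2: prob_space M2 by fact
  interpret pair_prob_space M1 M2 ..
  have i: "integrable (M1 \<Otimes>\<^sub>M M2) (case_prod f)"
    by (rule P.integrable_const_bound[of _ K]) (auto simp: b f)
  show "(\<integral>x. \<integral>y. f x y \<partial>M2 \<partial>M1) = (\<integral>y. \<integral>x. f x y \<partial>M1 \<partial>M2)"
    using Fubini_integral[OF i] by simp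
  show "(\<integral>x. \<integral>y. f x y \<partial>M2 \<partial>M1) = (\<integral>z. f (fst z) (snd z) \<partial>(M1 \<Otimes>\<^sub>M M2))"
    using integral_fst'[OF i] by (simp add: split_beta')
qed

lemma integral_iexp_stdn: "(\<integral>x. iexp (c * x) \<partial>std_normal_distribution) = complex_of_real (exp (- (c\<^sup>2) / 2))"
  using char_std_normal_distribution by (simp add: char_def fun_eq_iff)

text \<open>
  Both sides have the characteristic function \<open>exp (- t\<^sup>2 / 2)\<close>.
\<close>

lemma stdn_stable:
  fixes \<alpha> \<beta> :: real
  assumes "\<alpha>\<^sup>2 + \<beta>\<^sup>2 = 1"
  shows "distr (std_normal_distribution \<Otimes>\<^sub>M std_normal_distribution) borel (\<lambda>z. \<alpha> * fst z + \<beta> * snd z)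
      = std_normal_distribution"
proof (rule Levy_uniqueness)
  let ?N = "std_normal_distribution"
  interpret N: prob_space ?N by (rule prob_space_stdn)
  interpret NN: pair_prob_space ?N ?N ..
  have m: "(\<lambda>z. \<alpha> * fst z + \<beta> * snd z) \<in> borel_measurable (?N \<Otimes>\<^sub>M ?N)"
    by measurable
  show "real_distribution ?N" by (rule real_dist_normal_dist)
  show "real_distribution (distr (?N \<Otimes>\<^sub>M ?N) borel (\<lambda>z. \<alpha> * fst z + \<beta> * snd z))"
    using m by (simp add: real_distribution_def real_distribution_axioms_def NN.P.prob_space_distr)
  show "char (distr (?N \<Otimes>\<^sub>M ?N) borel (\<lambda>z. \<alpha> * fst z + \<beta> * snd z)) = char ?N"
  proof
    fix t
    have "char (distr (?N \<Otimes>\<^sub>M ?N) borel (\<lambda>z. \<alpha> * fst z + \<beta> * snd z)) t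
      = (\<integral>z. iexp (t * (\<alpha> * fst z + \<beta> * snd z)) \<partial>(?N \<Otimes>\<^sub>M ?N))"
      unfolding char_def by (subst integral_distr) (use m in auto)
    also have "\<dots> = (\<integral>x. \<integral>y. iexp (t * (\<alpha> * x + \<beta> * y)) \<partial>?N \<partial>?N)"
      by (subst Fubini_bounded(2)[where K = 1]) (auto intro!: prob_space_stdn simp: split_beta)
    also have "\<dots> = (\<integral>x. \<integral>y. iexp ((t * \<alpha>) * x) * iexp ((t * \<beta>) * y) \<partial>?N \<partial>?N)"
      by (simp add: algebra_simps exp_add)
    also have "\<dots> = complex_of_real (exp (- ((t * \<alpha>)\<^sup>2) / 2)) * complex_of_real (exp (- ((t * \<beta>)\<^sup>2) / 2))"
      unfolding integral_mult_right_zero integral_mult_left_zero integral_iexp_stdn ..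
    also have "\<dots> = complex_of_real (exp (- (t\<^sup>2 * (\<alpha>\<^sup>2 + \<beta>\<^sup>2)) / 2))"
      by (simp add: exp_add[symmetric] of_real_mult[symmetric] power_mult_distrib algebra_simps add_divide_distrib diff_divide_distrib del: of_real_mult)
    finally show "char (distr (?N \<Otimes>\<^sub>M ?N) borel (\<lambda>z. \<alpha> * fst z + \<beta> * snd z)) t = char ?N t"
      using assms by (simp add: char_std_normal_distribution)
  qed
qed

lemma nn_integral_stdn_stable:
  fixes \<alpha> \<beta> :: real
  assumes "\<alpha>\<^sup>2 + \<beta>\<^sup>2 = 1" and f: "f \<in> borel_measurable borel"
  shows "(\<integral>\<^sup>+x. \<integral>\<^sup>+y. f (\<alpha> * x
      + \<beta> * y) \<partial>std_normal_distribution \<partial>std_normal_distribution)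
     = (\<integral>\<^sup>+x. f x \<partial>std_normal_distribution)"
proof -
  let ?N = "std_normal_distribution"
  interpret N: prob_space ?N by (rule prob_space_stdn)
  have "(\<integral>\<^sup>+x. f x \<partial>?N) = (\<integral>\<^sup>+z. f (\<alpha> * fst z + \<beta> * snd z) \<partial>(?N \<Otimes>\<^sub>M ?N))"
    using f by (subst stdn_stable[OF assms(1), symmetric]) (subst nn_integral_distr, auto)
  also have "\<dots> = (\<integral>\<^sup>+x. \<integral>\<^sup>+y. f (\<alpha> * x + \<beta> * y) \<partial>?N \<partial>?N)"
    using f by (subst N.nn_integral_fst[symmetric]) auto
  finally show ?thesis by simp
qed

definition gaussian :: "'i set \<Rightarrow> ('i \<Rightarrow> real) measure" where
  "gaussian J = PiM J (\<lambda>_. std_normal_distribution)"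

lemma prob_space_gaussian: "prob_space (gaussian J)"
  unfolding gaussian_def by (rule prob_space_PiM) (rule prob_space_stdn)

lemma sets_gaussian: "sets (gaussian J) = sets (PiM J (\<lambda>_. borel))"
  unfolding gaussian_def by (rule sets_PiM_cong) auto

lemma nn_integral_gaussian_insert:
  assumes "finite J" "k \<notin> J" "f \<in> borel_measurable (gaussian (insert k J))"
  shows "(\<integral>\<^sup>+x. f x \<partial>gaussian (insert k J))
      = (\<integral>\<^sup>+x. \<integral>\<^sup>+y. f (x(k := y)) \<partial>std_normal_distribution \<partial>gaussian J)"
proof -
  interpret product_sigma_finite "\<lambda>_::'a. std_normal_distribution"
    by (rule product_sigma_finite_prob) (rule prob_space_stdn)
  show ?thesis using assms unfolding gaussian_def by (rule product_nn_integral_insert)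
qed

text \<open>
  A rotation of two independent copies. Points of a product space are extensional, hence the restriction to \<open>J\<close>.
\<close>

definition mix :: "real \<Rightarrow> real \<Rightarrow> 'i set \<Rightarrow> ('i \<Rightarrow> real) \<Rightarrow> ('i \<Rightarrow> real) \<Rightarrow> 'i \<Rightarrow> real" where
  "mix \<alpha> \<beta> J x y = (\<lambda>j\<in>J. \<alpha> * x j + \<beta> * y j)"

lemma mix_measurable [measurable (raw)]:
  assumes "f \<in> measurable M (gaussian J)" "g \<in> measurable M (gaussian J)"
  shows "(\<lambda>z. mix \<alpha> \<beta> J (f z) (g z)) \<in> measurable M (gaussian J)"
proof -
  have f: "f \<in> measurable M (PiM J (\<lambda>_. borel))" "g \<in> measurable M (PiM J (\<lambda>_. borel))"
    using assms by (simp_all add: measurable_cong_sets[OF refl sets_gaussian])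
  have "(\<lambda>z. f z j) \<in> borel_measurable M" "(\<lambda>z. g z j) \<in> borel_measurable M" if "j \<in> J" for j
    using f that by (auto intro: measurable_PiM_component_rev measurable_compose[OF _ measurable_component_singleton])
  then show ?thesis
    unfolding mix_def measurable_cong_sets[OF refl sets_gaussian]
    by (intro measurable_restrict) auto
qed

text \<open>
  Induction over the coordinates: peel off one coordinate of both copies, bring their two integrals next to each
  other and apply the one-dimensional case.
\<close>

lemma nn_integral_gaussian_stable:
  fixes \<alpha> \<beta> :: real
  assumes ab: "\<alpha>\<^sup>2 + \<beta>\<^sup>2 = 1" and "finite J" and "f \<in> borel_measurable (gaussian J)"
  shows "(\<integral>\<^sup>+x. \<integral>\<^sup>+y. f (mix \<alpha> \<beta> J x y) \<partial>gaussian J \<partial>gaussian J)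
      = (\<integral>\<^sup>+x. f x \<partial>gaussian J)"
  using assms(2,3)
proof (induction J arbitrary: f rule: finite_induct)
  case empty
  show ?case by (simp add: gaussian_def mix_def PiM_empty nn_integral_count_space_finite)
next
  case (insert k J)
  let ?N = "std_normal_distribution" and ?G = "gaussian J"
  interpret N: prob_space ?N by (rule prob_space_stdn)
  interpret G: prob_space ?G by (rule prob_space_gaussian)
  interpret NG: pair_sigma_finite ?N ?G ..
  note f = insert.prems
  have upd: "(\<lambda>z. (p z)(k := r z)) \<in> measurable M (gaussian (insert k J))"
    if "p \<in> measurable M ?G" "r \<in> borel_measurable M" for p r and M :: "'z measure"
    using that unfolding gaussian_def by (intro measurable_fun_upd[where J = J]) auto
  have fm: "(\<lambda>z. f ((p z)(k := r z))) \<in> borel_measurable M"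
    if "p \<in> measurable M ?G" "r \<in> borel_measurable M" for p r and M :: "'z measure"
    using measurable_compose[OF upd[OF that] f] .
  define g where "g w = (\<integral>\<^sup>+c. f (w(k := c)) \<partial>?N)" for w
  have gm: "g \<in> borel_measurable ?G"
    unfolding g_def by (rule N.borel_measurable_nn_integral) (simp only: split_beta', rule fm, measurable)
  have mk: "mix \<alpha> \<beta> (insert k J) (x(k := a)) (y(k := b)) = (mix \<alpha> \<beta> J x y)(k := \<alpha> * a + \<beta> * b)" for x y a b
    using insert.hyps by (auto simp: mix_def fun_eq_iff)
  have fmix: "(\<lambda>z. f (mix \<alpha> \<beta> (insert k J) (p z) (r z))) \<in> borel_measurable M"
    if "p \<in> measurable M (gaussian (insert k J))" "r \<in> measurable M (gaussian (insert k J))" for p r and M :: "'z measure"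
    using measurable_compose[OF mix_measurable[OF that] f] .
  have "(\<integral>\<^sup>+x. \<integral>\<^sup>+y. f (mix \<alpha> \<beta> (insert k J) x y) \<partial>gaussian (insert k J) \<partial>gaussian (insert k J))
     = (\<integral>\<^sup>+x. \<integral>\<^sup>+y. \<integral>\<^sup>+b. f (mix \<alpha> \<beta> (insert k J) x (y(k := b))) \<partial>?N \<partial>?G \<partial>gaussian (insert k J))"
    by (intro nn_integral_cong nn_integral_gaussian_insert insert.hyps fmix measurable_const measurable_ident_sets[OF refl])
  also have "\<dots>
      = (\<integral>\<^sup>+x. \<integral>\<^sup>+a. \<integral>\<^sup>+y. \<integral>\<^sup>+b. f (mix \<alpha> \<beta> (insert k J) (x(k := a)) (y(k := b))) \<partial>?N \<partial>?G \<partial>?N \<partial>?G)"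
  proof (intro nn_integral_gaussian_insert insert.hyps)
    show "(\<lambda>x. \<integral>\<^sup>+y. \<integral>\<^sup>+b. f (mix \<alpha> \<beta> (insert k J) x (y(k := b))) \<partial>?N \<partial>?G) \<in> borel_measurable (gaussian (insert k J))"
      by (intro G.borel_measurable_nn_integral N.borel_measurable_nn_integral)
        (simp only: split_beta', intro N.borel_measurable_nn_integral, simp only: split_beta', rule fmix, measurable, rule upd, measurable)
  qed
  also have "\<dots>
      = (\<integral>\<^sup>+x. \<integral>\<^sup>+a. \<integral>\<^sup>+y. \<integral>\<^sup>+b. f ((mix \<alpha> \<beta> J x y)(k := \<alpha> * a
          + \<beta> * b)) \<partial>?N \<partial>?G \<partial>?N \<partial>?G)"
    unfolding mk ..
  also have "\<dots>
      = (\<integral>\<^sup>+x. \<integral>\<^sup>+y. \<integral>\<^sup>+a. \<integral>\<^sup>+b. f ((mix \<alpha> \<beta> J x y)(k := \<alpha> * a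
          + \<beta> * b)) \<partial>?N \<partial>?N \<partial>?G \<partial>?G)"
  proof (intro nn_integral_cong)
    fix x assume x: "x \<in> space ?G"
    show "(\<integral>\<^sup>+a. \<integral>\<^sup>+y. \<integral>\<^sup>+b. f ((mix \<alpha> \<beta> J x y)(k := \<alpha> * a
        + \<beta> * b)) \<partial>?N \<partial>?G \<partial>?N)
      = (\<integral>\<^sup>+y. \<integral>\<^sup>+a. \<integral>\<^sup>+b. f ((mix \<alpha> \<beta> J x y)(k := \<alpha> * a
          + \<beta> * b)) \<partial>?N \<partial>?N \<partial>?G)"
      by (rule NG.Fubini'[symmetric], simp only: split_beta', rule N.borel_measurable_nn_integral, simp only: split_beta', rule fm)
        (use x in measurable)
  qed
  also have "\<dots> = (\<integral>\<^sup>+x. \<integral>\<^sup>+y. g (mix \<alpha> \<beta> J x y) \<partial>?G \<partial>?G)"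
  proof (intro nn_integral_cong)
    fix x y assume xy: "x \<in> space ?G" "y \<in> space ?G"
    have "(\<lambda>c. f ((mix \<alpha> \<beta> J x y)(k := c))) \<in> borel_measurable borel"
      by (rule fm) (use xy in measurable)
    from nn_integral_stdn_stable[OF ab this]
    show "(\<integral>\<^sup>+a. \<integral>\<^sup>+b. f ((mix \<alpha> \<beta> J x y)(k := \<alpha> * a + \<beta> * b)) \<partial>?N \<partial>?N)
        = g (mix \<alpha> \<beta> J x y)"
      unfolding g_def .
  qed
  also have "\<dots> = (\<integral>\<^sup>+x. g x \<partial>?G)" by (rule insert.IH[OF gm])
  also have "\<dots> = (\<integral>\<^sup>+x. f x \<partial>gaussian (insert k J))"
    unfolding g_def by (rule nn_integral_gaussian_insert[symmetric]) (use insert in auto)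
  finally show ?case .
qed

lemma gaussian_stable:
  fixes \<alpha> \<beta> :: real
  assumes ab: "\<alpha>\<^sup>2 + \<beta>\<^sup>2 = 1" and J: "finite J"
  shows "distr (gaussian J \<Otimes>\<^sub>M gaussian J) (gaussian J) (\<lambda>z. mix \<alpha> \<beta> J (fst z) (snd z)) = gaussian J"
proof (rule measure_eqI)
  interpret G: prob_space "gaussian J" by (rule prob_space_gaussian)
  fix X assume "X \<in> sets (distr (gaussian J \<Otimes>\<^sub>M gaussian J) (gaussian J) (\<lambda>z. mix \<alpha> \<beta> J (fst z) (snd z)))"
  then have X: "X \<in> sets (gaussian J)" by simp
  let ?D = "distr (gaussian J \<Otimes>\<^sub>M gaussian J) (gaussian J) (\<lambda>z. mix \<alpha> \<beta> J (fst z) (snd z))"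
  have "emeasure ?D X = (\<integral>\<^sup>+z. indicator X z \<partial>?D)" using X by simp
  also have "\<dots>
      = (\<integral>\<^sup>+z. indicator X (mix \<alpha> \<beta> J (fst z) (snd z)) \<partial>(gaussian J \<Otimes>\<^sub>M gaussian J))"
    using X by (intro nn_integral_distr mix_measurable measurable_fst measurable_snd) auto
  also have "\<dots>
      = (\<integral>\<^sup>+x. \<integral>\<^sup>+y. indicator X (mix \<alpha> \<beta> J x y) \<partial>gaussian J \<partial>gaussian J)"
  proof -
    have "(\<lambda>z. indicator X (mix \<alpha> \<beta> J (fst z) (snd z)) :: ennreal) \<in> borel_measurable (gaussian J \<Otimes>\<^sub>M gaussian J)"
      by (rule measurable_compose[OF mix_measurable[OF measurable_fst measurable_snd]]) (use X in simp)
    from G.nn_integral_fst[OF this] show ?thesis by simp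
  qed
  also have "\<dots> = emeasure (gaussian J) X"
    using X by (subst nn_integral_gaussian_stable[OF ab J]) auto
  finally show "emeasure ?D X = emeasure (gaussian J) X" .
qed simp


section \<open>Anti-concentration of Gaussian quadratic forms\<close>

lemma integral_iexp_gaussian:
  assumes "finite J"
  shows "(\<integral>g. iexp (\<Sum>j\<in>J. c j * g j) \<partial>gaussian J) = complex_of_real (exp (- (\<Sum>j\<in>J. (c j)\<^sup>2) / 2))"
proof -
  interpret N: prob_space std_normal_distribution by (rule prob_space_stdn)
  interpret product_sigma_finite "\<lambda>_::'a. std_normal_distribution"
    by (rule product_sigma_finite_prob) (rule prob_space_stdn)
  have "(\<integral>g. iexp (\<Sum>j\<in>J. c j * g j) \<partial>gaussian J)
      = (\<integral>g. (\<Prod>j\<in>J. iexp (c j * g j)) \<partial>gaussian J)"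
    by (simp add: exp_sum[OF assms] sum_distrib_left)
  also have "\<dots> = (\<Prod>j\<in>J. \<integral>x. iexp (c j * x) \<partial>std_normal_distribution)"
    unfolding gaussian_def
    by (rule product_integral_prod[OF assms], rule N.integrable_const_bound[of _ 1]) auto
  also have "\<dots> = (\<Prod>j\<in>J. complex_of_real (exp (- ((c j)\<^sup>2) / 2)))"
    unfolding integral_iexp_stdn ..
  also have "\<dots> = complex_of_real (exp (- (\<Sum>j\<in>J. (c j)\<^sup>2) / 2))"
    by (simp add: exp_sum[OF assms, symmetric] sum_negf sum_divide_distrib flip: of_real_prod)
  finally show ?thesis .
qed

lemma integral_exp_neg_sq_stdn:
  assumes k: "0 \<le> (k::real)"
  shows "(\<integral>x. exp (- k * x\<^sup>2) \<partial>std_normal_distribution) = (1 + 2 * k) powr (-1/2)"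
proof -
  define \<sigma> where "\<sigma> = 1 / sqrt (1 + 2 * k)"
  have \<sigma>: "0 < \<sigma>" using k by (simp add: \<sigma>_def)
  have s2: "\<sigma>\<^sup>2 = 1 / (1 + 2 * k)" using k by (simp add: \<sigma>_def power_divide)
  have eq: "std_normal_density x * exp (- k * x\<^sup>2) = \<sigma> * normal_density 0 \<sigma> x" for x
  proof -
    have "exp (- x\<^sup>2 / 2) * exp (- k * x\<^sup>2) = exp (- x\<^sup>2 / (2 * \<sigma>\<^sup>2))"
      using k by (simp add: exp_add[symmetric] s2 field_simps)
    moreover have "sqrt (2 * pi * \<sigma>\<^sup>2) = sqrt (2 * pi) * \<sigma>"
      using \<sigma> by (simp add: real_sqrt_mult)
    ultimately show ?thesis using \<sigma>
      by (simp add: normal_density_def field_simps)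
  qed
  have "(\<integral>x. exp (- k * x\<^sup>2) \<partial>std_normal_distribution)
      = (\<integral>x. std_normal_density x * exp (- k * x\<^sup>2) \<partial>lborel)"
    by (subst integral_density) auto
  also have "\<dots> = \<sigma>"
    unfolding eq using integral_normal_density[OF \<sigma>, of 0] by simp
  also have "\<sigma> = (1 + 2 * k) powr (-1/2)"
    using k by (simp add: \<sigma>_def powr_minus powr_half_sqrt inverse_eq_divide)
  finally show ?thesis .
qed

definition gsum :: "'i set \<Rightarrow> ('i \<Rightarrow> nat \<Rightarrow> real) \<Rightarrow> ('i \<Rightarrow> real) \<Rightarrow> nat \<Rightarrow> real" where
  "gsum J a g = (\<lambda>l. \<Sum>j\<in>J. g j * a j l)"

lemma gsum_measurable:
  assumes p: "p \<in> measurable M (gaussian J)"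
  shows "(\<lambda>z. gsum J a (p z) l) \<in> borel_measurable M"
proof -
  have "p \<in> measurable M (PiM J (\<lambda>_. borel))"
    using p by (simp add: measurable_cong_sets[OF refl sets_gaussian])
  then have "(\<lambda>z. p z j) \<in> borel_measurable M" if "j \<in> J" for j
    using that by (auto intro: measurable_compose[OF _ measurable_component_singleton])
  then show ?thesis unfolding gsum_def
    by (intro borel_measurable_sum borel_measurable_times) auto
qed

lemma gsum_mix:
  "gsum J a (mix \<alpha> \<beta> J x y) = (\<lambda>l. \<alpha> * gsum J a x l + \<beta> * gsum J a y l)"
  by (simp add: gsum_def mix_def fun_eq_iff sum_distrib_left sum.distrib algebra_simps)

lemma ip_gsum: "ip d v (gsum J a g) = (\<Sum>j\<in>J. ip d v (a j) * g j)"
  unfolding ip_def gsum_def sum_distrib_left sum_distrib_right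
  by (subst sum.swap) (simp add: mult_ac)

lemma nsq_scale: "nsq d (\<lambda>l. r * x l) = r\<^sup>2 * nsq d x"
  by (simp add: nsq_def power_mult_distrib sum_distrib_left)

lemma ip_scale_right: "ip d v (\<lambda>l. r * x l) = r * ip d v x"
  by (simp add: ip_def sum_distrib_left mult_ac)

lemma ip_diff_right: "ip d v (\<lambda>l. x l - y l) = ip d v x - ip d v y"
  by (simp add: ip_def algebra_simps sum_subtractf)

lemma (in prob_space) expectation_square_le:
  fixes f :: "'a \<Rightarrow> real"
  assumes "integrable M f" "integrable M (\<lambda>x. (f x)\<^sup>2)"
  shows "(expectation f)\<^sup>2 \<le> expectation (\<lambda>x. (f x)\<^sup>2)"
  using variance_eq[OF assms] variance_positive[of f] by simp

lemma cnj_measurable: "cnj \<in> borel_measurable borel"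
  by (intro borel_measurable_continuous_onI continuous_intros)

text \<open>
  Decoupling. By stability replace \<open>g\<close> by \<open>(x + y) / \<surd>2\<close>; then \<open>\<langle>G x, G y\<rangle>\<close> is the only term of the phase that
  couples \<open>x\<close> and \<open>y\<close>. Squaring the integral over \<open>y\<close> introduces a second copy \<open>y'\<close>, after which the integral over \<open>x\<close>
  is the characteristic function of a linear form, bounded by a Gaussian function of \<open>\<parallel>G y - G y'\<parallel>\<close>. An auxiliary
  standard Gaussian vector \<open>\<xi>\<close> in dimension \<open>d\<close> linearises that function, and the lower bound on the quadratic form
  is used a second time.
\<close>

lemma gaussian_quadratic_char:
  fixes u c :: real
  assumes J: "finite J" and c: "0 \<le> c" and low: "\<And>v. c * nsq d v \<le> (\<Sum>j\<in>J. (ip d v (a j))\<^sup>2)"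
  shows "(cmod (\<integral>g. iexp (u * nsq d (gsum J a g)) \<partial>gaussian J))\<^sup>2 \<le> (1
      + 2 * (u\<^sup>2 * c\<^sup>2)) powr (- real d / 2)"
proof -
  define \<Gamma> where "\<Gamma> = gaussian J"
  define G where "G = gsum J a"
  interpret \<Gamma>: prob_space \<Gamma> unfolding \<Gamma>_def by (rule prob_space_gaussian)
  interpret \<Gamma>2: pair_prob_space \<Gamma> \<Gamma> ..
  have P2: "prob_space (\<Gamma> \<Otimes>\<^sub>M \<Gamma>)" by (rule \<Gamma>2.P.prob_space_axioms)
  have G [measurable (raw)]: "(\<lambda>z. G (p z) l) \<in> borel_measurable M"
    if "p \<in> measurable M \<Gamma>" for p l and M :: "'z measure"
    using that unfolding G_def \<Gamma>_def by (rule gsum_measurable)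
  have nsqG [measurable (raw)]: "(\<lambda>z. nsq d (G (p z))) \<in> borel_measurable M"
    if "p \<in> measurable M \<Gamma>" for p and M :: "'z measure"
    using that by (intro nsq_measurable G)
  have ipG [measurable (raw)]: "(\<lambda>z. ip d (G (p z)) (G (q z))) \<in> borel_measurable M"
    if "p \<in> measurable M \<Gamma>" "q \<in> measurable M \<Gamma>" for p q and M :: "'z measure"
    unfolding ip_def using that by (intro borel_measurable_sum borel_measurable_times G)
  \<comment> \<open>the rotation by 45 degrees\<close>
  define r where "r = 1 / sqrt 2"
  have r2: "r\<^sup>2 = 1 / 2" by (simp add: r_def power_divide)
  have split: "nsq d (G (mix r r J x y)) = (nsq d (G x) + 2 * ip d (G x) (G y) + nsq d (G y)) / 2" for x y
  proof -
    have "G (mix r r J x y) = (\<lambda>l. r * (G x l + G y l))"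
      by (simp add: G_def gsum_mix distrib_left)
    then show ?thesis by (simp add: nsq_scale nsq_add r2)
  qed
  define k where "k x y = iexp (u * ip d (G x) (G y) + u / 2 * nsq d (G y))" for x y
  have kn: "cmod (k x y) = 1" for x y by (simp add: k_def)
  define h where "h x = (\<integral>y. k x y \<partial>\<Gamma>)" for x
  have km: "(\<lambda>(x, y). k x y) \<in> borel_measurable (\<Gamma> \<Otimes>\<^sub>M \<Gamma>)"
    unfolding k_def by measurable
  have hm [measurable]: "h \<in> borel_measurable \<Gamma>"
    unfolding h_def using km by (rule \<Gamma>.borel_measurable_lebesgue_integral)
  have h1: "cmod (h x) \<le> 1" for x
  proof -
    have "cmod (h x) \<le> (\<integral>y. cmod (k x y) \<partial>\<Gamma>)" unfolding h_def by (rule integral_norm_bound)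
    then show ?thesis by (simp add: kn \<Gamma>.prob_space)
  qed
  have ih: "integrable \<Gamma> (\<lambda>x. cmod (h x))" "integrable \<Gamma> (\<lambda>x. (cmod (h x))\<^sup>2)"
    using h1 by (auto intro!: \<Gamma>.integrable_const_bound[of _ 1] simp: power_le_one)
  define \<phi> where "\<phi> = (\<integral>g. iexp (u * nsq d (G g)) \<partial>\<Gamma>)"
  have mixm: "(\<lambda>z. mix r r J (fst z) (snd z)) \<in> measurable (\<Gamma> \<Otimes>\<^sub>M \<Gamma>) \<Gamma>"
    unfolding \<Gamma>_def by (intro mix_measurable measurable_fst measurable_snd)
  have "\<phi> = (\<integral>z. iexp (u * nsq d (G (mix r r J (fst z) (snd z)))) \<partial>(\<Gamma> \<Otimes>\<^sub>M \<Gamma>))"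
    unfolding \<phi>_def
    by (subst gaussian_stable[OF _ J, of r r, symmetric, folded \<Gamma>_def]) (auto simp: r2 \<Gamma>_def[symmetric] mixm intro!: integral_distr)
  also have "\<dots> = (\<integral>x. \<integral>y. iexp (u * nsq d (G (mix r r J x y))) \<partial>\<Gamma> \<partial>\<Gamma>)"
    by (rule Fubini_bounded(2)[where K = 1, symmetric]) (auto intro!: \<Gamma>.prob_space_axioms simp: split)
  also have "\<dots> = (\<integral>x. iexp (u / 2 * nsq d (G x)) * h x \<partial>\<Gamma>)"
  proof (rule Bochner_Integration.integral_cong[OF refl])
    fix x
    have "iexp (u * nsq d (G (mix r r J x y))) = iexp (u / 2 * nsq d (G x)) * k x y" for y
      unfolding split k_def exp_add[symmetric] by (simp add: algebra_simps add_divide_distrib)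
    then show "(\<integral>y. iexp (u * nsq d (G (mix r r J x y))) \<partial>\<Gamma>) = iexp (u / 2 * nsq d (G x)) * h x"
      by (simp add: h_def)
  qed
  finally have "cmod \<phi> \<le> (\<integral>x. cmod (h x) \<partial>\<Gamma>)"
    using integral_norm_bound[of \<Gamma> "\<lambda>x. iexp (u / 2 * nsq d (G x)) * h x"] by (simp add: norm_mult)
  then have "(cmod \<phi>)\<^sup>2 \<le> (\<integral>x. cmod (h x) \<partial>\<Gamma>)\<^sup>2" by (intro power_mono) auto
  also have "\<dots> \<le> (\<integral>x. (cmod (h x))\<^sup>2 \<partial>\<Gamma>)"
    by (rule \<Gamma>.expectation_square_le[OF ih])
  finally have main1: "(cmod \<phi>)\<^sup>2 \<le> (\<integral>x. (cmod (h x))\<^sup>2 \<partial>\<Gamma>)" .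
  \<comment> \<open>the square of \<open>h x\<close> is an integral over two copies of the inner variable\<close>
  define D where "D w = (\<lambda>l. G (fst w) l - G (snd w) l)" for w
  define \<theta> where "\<theta> w = u / 2 * (nsq d (G (fst w)) - nsq d (G (snd w)))" for w
  define Q where "Q w = (\<Sum>j\<in>J. (ip d (D w) (a j))\<^sup>2)" for w
  have D: "(\<lambda>w. D w l) \<in> borel_measurable (\<Gamma> \<Otimes>\<^sub>M \<Gamma>)" for l
    unfolding D_def by measurable
  have [measurable]: "\<theta> \<in> borel_measurable (\<Gamma> \<Otimes>\<^sub>M \<Gamma>)" unfolding \<theta>_def by measurable
  have nsqD [measurable]: "(\<lambda>w. nsq d (D w)) \<in> borel_measurable (\<Gamma> \<Otimes>\<^sub>M \<Gamma>)"
    by (intro nsq_measurable D)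
  have [measurable]: "Q \<in> borel_measurable (\<Gamma> \<Otimes>\<^sub>M \<Gamma>)" unfolding Q_def
    by (intro borel_measurable_sum borel_measurable_power ip_measurable D)
  have ipGD: "(\<lambda>z. ip d (G (fst z)) (D (snd z))) \<in> borel_measurable (\<Gamma> \<Otimes>\<^sub>M (\<Gamma> \<Otimes>\<^sub>M \<Gamma>))"
    unfolding ip_def by (intro borel_measurable_sum borel_measurable_times G measurable_fst measurable_compose[OF measurable_snd D])
  have hh: "complex_of_real ((cmod (h x))\<^sup>2) = (\<integral>w. iexp (u * ip d (G x) (D w)
      + \<theta> w) \<partial>(\<Gamma> \<Otimes>\<^sub>M \<Gamma>))"
    if x: "x \<in> space \<Gamma>" for x
  proof -
    have "complex_of_real ((cmod (h x))\<^sup>2) = (\<integral>y. k x y \<partial>\<Gamma>) * (\<integral>y. cnj (k x y) \<partial>\<Gamma>)"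
      unfolding h_def by (subst complex_norm_square) simp
    also have "\<dots> = (\<integral>y. \<integral>y'. k x y * cnj (k x y') \<partial>\<Gamma> \<partial>\<Gamma>)"
      by simp
    also have "\<dots> = (\<integral>w. k x (fst w) * cnj (k x (snd w)) \<partial>(\<Gamma> \<Otimes>\<^sub>M \<Gamma>))"
    proof (rule Fubini_bounded(2)[where K = 1])
      have "(\<lambda>w. k x (p w)) \<in> borel_measurable (\<Gamma> \<Otimes>\<^sub>M \<Gamma>)" if "p \<in> measurable (\<Gamma> \<Otimes>\<^sub>M \<Gamma>) \<Gamma>" for p
        unfolding k_def using that x by measurable
      from this[OF measurable_fst] this[OF measurable_snd]
      show "(\<lambda>(y, y'). k x y * cnj (k x y')) \<in> borel_measurable (\<Gamma> \<Otimes>\<^sub>M \<Gamma>)"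
        unfolding split_beta' by (intro borel_measurable_times measurable_compose[OF _ cnj_measurable])
    qed (auto simp: norm_mult kn intro: \<Gamma>.prob_space_axioms)
    also have "\<dots> = (\<integral>w. iexp (u * ip d (G x) (D w) + \<theta> w) \<partial>(\<Gamma> \<Otimes>\<^sub>M \<Gamma>))"
    proof (rule Bochner_Integration.integral_cong[OF refl])
      fix w
      show "k x (fst w) * cnj (k x (snd w)) = iexp (u * ip d (G x) (D w) + \<theta> w)"
        unfolding k_def \<theta>_def D_def ip_diff_right exp_cnj exp_add[symmetric]
        by (simp add: algebra_simps add_divide_distrib diff_divide_distrib)
    qed
    finally show ?thesis .
  qed
  have "complex_of_real (\<integral>x. (cmod (h x))\<^sup>2 \<partial>\<Gamma>)
      = (\<integral>x. complex_of_real ((cmod (h x))\<^sup>2) \<partial>\<Gamma>)"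
    by (rule integral_complex_of_real[symmetric])
  also have "\<dots> = (\<integral>x. \<integral>w. iexp (u * ip d (G x) (D w)
      + \<theta> w) \<partial>(\<Gamma> \<Otimes>\<^sub>M \<Gamma>) \<partial>\<Gamma>)"
    by (intro Bochner_Integration.integral_cong refl hh)
  also have "\<dots> = (\<integral>w. \<integral>x. iexp (u * ip d (G x) (D w)
      + \<theta> w) \<partial>\<Gamma> \<partial>(\<Gamma> \<Otimes>\<^sub>M \<Gamma>))"
    using ipGD by (intro Fubini_bounded(1)[where K = 1] \<Gamma>.prob_space_axioms P2) (auto simp: split_beta')
  also have "\<dots>
      = (\<integral>w. iexp (\<theta> w) * complex_of_real (exp (- (u\<^sup>2 * Q w) / 2)) \<partial>(\<Gamma> \<Otimes>\<^sub>M \<Gamma>))"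
  proof (rule Bochner_Integration.integral_cong[OF refl])
    fix w
    have "(\<integral>x. iexp (u * ip d (G x) (D w) + \<theta> w) \<partial>\<Gamma>)
        = (\<integral>x. iexp (\<theta> w) * iexp (\<Sum>j\<in>J. (u * ip d (D w) (a j)) * x j) \<partial>\<Gamma>)"
      unfolding exp_add[symmetric] G_def ip_commute[of d "gsum J a _"] ip_gsum
      by (simp add: algebra_simps sum_distrib_left)
    also have "\<dots> = iexp (\<theta> w) * complex_of_real (exp (- (u\<^sup>2 * Q w) / 2))"
      unfolding \<Gamma>_def integral_mult_right_zero integral_iexp_gaussian[OF J]
      by (simp add: Q_def power_mult_distrib sum_distrib_left)
    finally show "(\<integral>x. iexp (u * ip d (G x) (D w) + \<theta> w) \<partial>\<Gamma>)
        = iexp (\<theta> w) * complex_of_real (exp (- (u\<^sup>2 * Q w) / 2))" .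
  qed
  finally have e2: "complex_of_real (\<integral>x. (cmod (h x))\<^sup>2 \<partial>\<Gamma>)
      = (\<integral>w. iexp (\<theta> w) * complex_of_real (exp (- (u\<^sup>2 * Q w) / 2)) \<partial>(\<Gamma> \<Otimes>\<^sub>M \<Gamma>))" .
  have "(\<integral>x. (cmod (h x))\<^sup>2 \<partial>\<Gamma>) = cmod (complex_of_real (\<integral>x. (cmod (h x))\<^sup>2 \<partial>\<Gamma>))"
    unfolding norm_of_real by simp
  also have "\<dots>
      \<le> (\<integral>w. cmod (iexp (\<theta> w) * complex_of_real (exp (- (u\<^sup>2 * Q w) / 2))) \<partial>(\<Gamma> \<Otimes>\<^sub>M \<Gamma>))"
    unfolding e2 by (rule integral_norm_bound)
  also have "\<dots> = (\<integral>w. exp (- (u\<^sup>2 * Q w) / 2) \<partial>(\<Gamma> \<Otimes>\<^sub>M \<Gamma>))"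
    by (simp add: norm_mult)
  also have "\<dots> \<le> (\<integral>w. exp (- (u\<^sup>2 * c * nsq d (D w)) / 2) \<partial>(\<Gamma> \<Otimes>\<^sub>M \<Gamma>))"
  proof (rule integral_mono)
    have Q0: "0 \<le> Q w" for w unfolding Q_def by (intro sum_nonneg) auto
    show "integrable (\<Gamma> \<Otimes>\<^sub>M \<Gamma>) (\<lambda>w. exp (- (u\<^sup>2 * Q w) / 2))"
      using Q0 by (intro \<Gamma>2.P.integrable_const_bound[of _ 1]) auto
    show "integrable (\<Gamma> \<Otimes>\<^sub>M \<Gamma>) (\<lambda>w. exp (- (u\<^sup>2 * c * nsq d (D w)) / 2))"
      using c by (intro \<Gamma>2.P.integrable_const_bound[of _ 1]) auto
    fix w
    have "u\<^sup>2 * (c * nsq d (D w)) \<le> u\<^sup>2 * Q w"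
      unfolding Q_def by (intro mult_left_mono low) auto
    then show "exp (- (u\<^sup>2 * Q w) / 2) \<le> exp (- (u\<^sup>2 * c * nsq d (D w)) / 2)" by simp
  qed
  finally have main2: "(\<integral>x. (cmod (h x))\<^sup>2 \<partial>\<Gamma>)
      \<le> (\<integral>w. exp (- (u\<^sup>2 * c * nsq d (D w)) / 2) \<partial>(\<Gamma> \<Otimes>\<^sub>M \<Gamma>))" .
  \<comment> \<open>linearisation of the exponential of a squared norm by an auxiliary Gaussian vector\<close>
  define \<Xi> where "\<Xi> = gaussian {..<d}"
  interpret \<Xi>: prob_space \<Xi> unfolding \<Xi>_def by (rule prob_space_gaussian)
  have \<Xi>c [measurable]: "(\<lambda>\<xi>. \<xi> l) \<in> borel_measurable \<Xi>" if "l < d" for l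
    using that unfolding \<Xi>_def measurable_cong_sets[OF sets_gaussian refl] by (intro measurable_component_singleton) auto
  define s where "s = u * sqrt c"
  have s2: "s\<^sup>2 = u\<^sup>2 * c" using c by (simp add: s_def power_mult_distrib)
  have lin: "complex_of_real (exp (- (u\<^sup>2 * c * nsq d (D w)) / 2)) = (\<integral>\<xi>. iexp (s * ip d (D w) \<xi>) \<partial>\<Xi>)" for w
  proof -
    have "(\<integral>\<xi>. iexp (s * ip d (D w) \<xi>) \<partial>\<Xi>)
        = (\<integral>\<xi>. iexp (\<Sum>l<d. (s * D w l) * \<xi> l) \<partial>\<Xi>)"
      by (simp add: ip_def sum_distrib_left mult.assoc)
    also have "\<dots> = complex_of_real (exp (- (\<Sum>l<d. (s * D w l)\<^sup>2) / 2))"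
      unfolding \<Xi>_def by (rule integral_iexp_gaussian) simp
    finally show ?thesis by (simp add: power_mult_distrib s2 nsq_def sum_distrib_left)
  qed
  have ip\<Xi>: "(\<lambda>z. ip d (D (fst z)) (snd z)) \<in> borel_measurable ((\<Gamma> \<Otimes>\<^sub>M \<Gamma>) \<Otimes>\<^sub>M \<Xi>)"
    unfolding ip_def
        by (intro borel_measurable_sum borel_measurable_times measurable_compose[OF measurable_fst D] measurable_compose[OF measurable_snd \<Xi>c]) auto
  define R where "R \<xi> = (\<Sum>j\<in>J. (ip d \<xi> (a j))\<^sup>2)" for \<xi>
  have Rm [measurable]: "R \<in> borel_measurable \<Xi>" unfolding R_def
    by (intro borel_measurable_sum borel_measurable_power ip_measurable \<Xi>c)
  have "complex_of_real (\<integral>w. exp (- (u\<^sup>2 * c * nsq d (D w)) / 2) \<partial>(\<Gamma> \<Otimes>\<^sub>M \<Gamma>))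
      = (\<integral>w. \<integral>\<xi>. iexp (s * ip d (D w) \<xi>) \<partial>\<Xi> \<partial>(\<Gamma> \<Otimes>\<^sub>M \<Gamma>))"
    unfolding lin[symmetric] by simp
  also have "\<dots> = (\<integral>\<xi>. \<integral>w. iexp (s * ip d (D w) \<xi>) \<partial>(\<Gamma> \<Otimes>\<^sub>M \<Gamma>) \<partial>\<Xi>)"
    using ip\<Xi> by (intro Fubini_bounded(1)[where K = 1] \<Xi>.prob_space_axioms P2) (auto simp: split_beta')
  also have "\<dots> = (\<integral>\<xi>. complex_of_real (exp (- (u\<^sup>2 * c) * R \<xi>)) \<partial>\<Xi>)"
  proof (rule Bochner_Integration.integral_cong[OF refl])
    fix \<xi>
    have one: "(\<integral>y. iexp (b * ip d \<xi> (G y)) \<partial>\<Gamma>) = complex_of_real (exp (- (b\<^sup>2 * R \<xi>) / 2))" for b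
    proof -
      have "(\<integral>y. iexp (b * ip d \<xi> (G y)) \<partial>\<Gamma>)
          = (\<integral>y. iexp (\<Sum>j\<in>J. (b * ip d \<xi> (a j)) * y j) \<partial>\<Gamma>)"
        by (simp add: G_def ip_gsum sum_distrib_left mult.assoc)
      also have "\<dots> = complex_of_real (exp (- (b\<^sup>2 * R \<xi>) / 2))"
        unfolding \<Gamma>_def integral_iexp_gaussian[OF J] by (simp add: R_def power_mult_distrib sum_distrib_left)
      finally show ?thesis .
    qed
    have ip\<xi> [measurable (raw)]: "(\<lambda>w. ip d \<xi> (G (p w))) \<in> borel_measurable (\<Gamma> \<Otimes>\<^sub>M \<Gamma>)" if "p \<in> measurable (\<Gamma> \<Otimes>\<^sub>M \<Gamma>) \<Gamma>" for p
      unfolding ip_def using that by (intro borel_measurable_sum borel_measurable_times G) auto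
    have "(\<integral>w. iexp (s * ip d (D w) \<xi>) \<partial>(\<Gamma> \<Otimes>\<^sub>M \<Gamma>))
        = (\<integral>w. iexp (s * ip d \<xi> (G (fst w))) * iexp (- s * ip d \<xi> (G (snd w))) \<partial>(\<Gamma> \<Otimes>\<^sub>M \<Gamma>))"
      unfolding exp_add[symmetric] ip_commute[of d _ \<xi>] D_def ip_diff_right by (simp add: algebra_simps)
    also have "\<dots>
        = (\<integral>y. \<integral>y'. iexp (s * ip d \<xi> (G y)) * iexp (- s * ip d \<xi> (G y')) \<partial>\<Gamma> \<partial>\<Gamma>)"
      using ip\<xi>[OF measurable_fst] ip\<xi>[OF measurable_snd]
      by (intro Fubini_bounded(2)[where K = 1, symmetric] \<Gamma>.prob_space_axioms) (auto simp: split_beta' norm_mult)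
    also have "\<dots> = complex_of_real (exp (- (s\<^sup>2 * R \<xi>) / 2)) * complex_of_real (exp (- ((- s)\<^sup>2 * R \<xi>) / 2))"
      unfolding integral_mult_right_zero integral_mult_left_zero one ..
    also have "\<dots> = complex_of_real (exp (- (u\<^sup>2 * c) * R \<xi>))"
      by (simp add: s2 exp_add[symmetric] flip: of_real_mult)
    finally show "(\<integral>w. iexp (s * ip d (D w) \<xi>) \<partial>(\<Gamma> \<Otimes>\<^sub>M \<Gamma>))
        = complex_of_real (exp (- (u\<^sup>2 * c) * R \<xi>))" .
  qed
  also have "\<dots> = complex_of_real (\<integral>\<xi>. exp (- (u\<^sup>2 * c) * R \<xi>) \<partial>\<Xi>)" by simp
  finally have "(\<integral>w. exp (- (u\<^sup>2 * c * nsq d (D w)) / 2) \<partial>(\<Gamma> \<Otimes>\<^sub>M \<Gamma>))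
      = (\<integral>\<xi>. exp (- (u\<^sup>2 * c) * R \<xi>) \<partial>\<Xi>)"
    unfolding of_real_eq_iff .
  also have "\<dots> \<le> (\<integral>\<xi>. (\<Prod>l<d. exp (- (u\<^sup>2 * c\<^sup>2) * (\<xi> l)\<^sup>2)) \<partial>\<Xi>)"
  proof (rule integral_mono)
    have R0: "0 \<le> R \<xi>" for \<xi> unfolding R_def by (intro sum_nonneg) auto
    show "integrable \<Xi> (\<lambda>\<xi>. exp (- (u\<^sup>2 * c) * R \<xi>))"
      using R0 c by (intro \<Xi>.integrable_const_bound[of _ 1]) auto
    show "integrable \<Xi> (\<lambda>\<xi>. (\<Prod>l<d. exp (- (u\<^sup>2 * c\<^sup>2) * (\<xi> l)\<^sup>2)))"
      by (intro \<Xi>.integrable_const_bound[of _ 1]) (auto intro!: prod_le_1 simp: abs_prod intro!: borel_measurable_prod)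
    fix \<xi>
    have "u\<^sup>2 * c * (c * nsq d \<xi>) \<le> u\<^sup>2 * c * R \<xi>"
      unfolding R_def using c by (intro mult_left_mono low) auto
    then show "exp (- (u\<^sup>2 * c) * R \<xi>) \<le> (\<Prod>l<d. exp (- (u\<^sup>2 * c\<^sup>2) * (\<xi> l)\<^sup>2))"
      by (simp add: exp_sum[symmetric] nsq_def sum_distrib_left sum_negf power2_eq_square[of c] mult_ac)
  qed
  also have "\<dots> = (\<Prod>l<d. \<integral>x. exp (- (u\<^sup>2 * c\<^sup>2) * x\<^sup>2) \<partial>std_normal_distribution)"
  proof -
    interpret N: prob_space std_normal_distribution by (rule prob_space_stdn)
    interpret product_sigma_finite "\<lambda>_::nat. std_normal_distribution"
      by (rule product_sigma_finite_prob) (rule prob_space_stdn)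
    show ?thesis unfolding \<Xi>_def gaussian_def
      by (rule product_integral_prod, simp, rule N.integrable_const_bound[of _ 1]) auto
  qed
  also have "\<dots> = ((1 + 2 * (u\<^sup>2 * c\<^sup>2)) powr (-1/2)) ^ d"
    using integral_exp_neg_sq_stdn[of "u\<^sup>2 * c\<^sup>2"] by simp
  also have "\<dots> = (1 + 2 * (u\<^sup>2 * c\<^sup>2)) powr (- real d / 2)"
  proof -
    have pos: "0 < 1 + 2 * (u\<^sup>2 * c\<^sup>2)" by (intro add_pos_nonneg) auto
    then have "((1 + 2 * (u\<^sup>2 * c\<^sup>2)) powr (-1/2)) ^ d = ((1 + 2 * (u\<^sup>2 * c\<^sup>2)) powr (-1/2)) powr real d"
      by (subst powr_realpow) auto
    then show ?thesis by (simp add: powr_powr)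
  qed
  finally show ?thesis using main1 main2 by (simp add: \<phi>_def G_def \<Gamma>_def)
qed

text \<open>
  The bound on the probability that \<open>\<parallel>G\<parallel>\<^sup>2\<close> lies in an interval of half-length \<open>\<delta> \<surd>d\<close>, when the covariance
  of \<open>G\<close> is at least \<open>c\<close>. It depends neither on the dimension nor on the position of the interval.
\<close>

definition small_ball_bound :: "real \<Rightarrow> real \<Rightarrow> real" where
  "small_ball_bound c \<delta> = exp (1/2) * (\<integral>x. (1
      + 2 * (x\<^sup>2 * c\<^sup>2) / \<delta>\<^sup>2) powr (-1/4) \<partial>std_normal_distribution)"

lemma powr_neg_quarter_bounds: "0 \<le> (y::real) \<Longrightarrow> 0 \<le> (1 + y) powr (-1/4) \<and> (1 + y) powr (-1/4) \<le> 1"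
  using powr_mono2'[of "-1/4" 1 "1 + y"] by simp

text \<open>
  The indicator of \<open>\<bar>y\<bar> \<le> lam\<close> is at most \<open>exp (1/2)\<close> times \<open>exp (- (y / lam)\<^sup>2 / 2)\<close>, which is the
  mean of \<open>exp (\<i> \<eta> y / lam)\<close> over a standard normal \<open>\<eta>\<close>. So the mean of the modulus of the characteristic function
  at \<open>\<eta> / lam\<close> is an upper bound. Bernoulli's inequality removes the dimension from it.
\<close>

lemma gaussian_anticoncentration:
  fixes c \<delta> t :: real
  assumes J: "finite J" and c: "0 \<le> c" and low: "\<And>v. c * nsq d v \<le> (\<Sum>j\<in>J. (ip d v (a j))\<^sup>2)"
    and d: "1 \<le> d" and \<delta>: "0 < \<delta>"
  shows "measure (gaussian J) {g \<in> space (gaussian J). \<bar>nsq d (gsum J a g) - t\<bar> \<le> \<delta> * sqrt d}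
      \<le> small_ball_bound c \<delta>"
proof -
  define \<Gamma> where "\<Gamma> = gaussian J"
  interpret \<Gamma>: prob_space \<Gamma> unfolding \<Gamma>_def by (rule prob_space_gaussian)
  let ?N = "std_normal_distribution"
  interpret N: prob_space ?N by (rule prob_space_stdn)
  define Y where "Y g = nsq d (gsum J a g)" for g
  have Ym [measurable]: "Y \<in> borel_measurable \<Gamma>"
    unfolding Y_def \<Gamma>_def by (intro nsq_measurable gsum_measurable measurable_ident_sets[OF refl])
  define lam where "lam = \<delta> * sqrt d"
  have lam: "0 < lam" using d \<delta> by (simp add: lam_def)
  define A where "A = {g \<in> space \<Gamma>. \<bar>Y g - t\<bar> \<le> lam}"
  have A: "A \<in> sets \<Gamma>" unfolding A_def by measurable
  have ie: "integrable \<Gamma> (\<lambda>g. exp (- (((Y g - t) / lam)\<^sup>2) / 2))"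
    by (intro \<Gamma>.integrable_const_bound[of _ 1]) auto
  have "measure \<Gamma> A = (\<integral>g. indicator A g \<partial>\<Gamma>)" using A by simp
  also have "\<dots> \<le> (\<integral>g. exp (1/2) * exp (- (((Y g - t) / lam)\<^sup>2) / 2) \<partial>\<Gamma>)"
  proof (rule integral_mono)
    show "indicator A g \<le> exp (1/2) * exp (- (((Y g - t) / lam)\<^sup>2) / 2)" for g
    proof (cases "g \<in> A")
      case True
      then have "\<bar>(Y g - t) / lam\<bar> \<le> 1" using lam by (simp add: A_def)
      then have "((Y g - t) / lam)\<^sup>2 \<le> 1" by (simp add: abs_square_le_1)
      then show ?thesis using True by (simp add: exp_add[symmetric])
    qed simp
  qed (use A ie in \<open>auto intro!: integrable_real_indicator simp: \<Gamma>.emeasure_eq_measure\<close>)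
  finally have "measure \<Gamma> A \<le> exp (1/2) * (\<integral>g. exp (- (((Y g - t) / lam)\<^sup>2) / 2) \<partial>\<Gamma>)" by simp
  also have "(\<integral>g. exp (- (((Y g - t) / lam)\<^sup>2) / 2) \<partial>\<Gamma>) \<le> (\<integral>x. (1
      + 2 * (x\<^sup>2 * c\<^sup>2) / \<delta>\<^sup>2) powr (-1/4) \<partial>?N)"
  proof -
    define \<phi> where "\<phi> u = (\<integral>g. iexp (u * Y g) \<partial>\<Gamma>)" for u
    have "complex_of_real (\<integral>g. exp (- (((Y g - t) / lam)\<^sup>2) / 2) \<partial>\<Gamma>)
      = (\<integral>g. \<integral>x. iexp ((Y g - t) / lam * x) \<partial>?N \<partial>\<Gamma>)"
      unfolding integral_iexp_stdn by simp
    also have "\<dots> = (\<integral>x. \<integral>g. iexp ((Y g - t) / lam * x) \<partial>\<Gamma> \<partial>?N)"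
      by (intro Fubini_bounded(1)[where K = 1] \<Gamma>.prob_space_axioms N.prob_space_axioms) (auto simp: split_beta')
    also have "\<dots> = (\<integral>x. iexp (- t * x / lam) * \<phi> (x / lam) \<partial>?N)"
    proof (rule Bochner_Integration.integral_cong[OF refl])
      fix x
      have "iexp ((Y g - t) / lam * x) = iexp (- t * x / lam) * iexp (x / lam * Y g)" for g
        unfolding exp_add[symmetric] by (simp add: algebra_simps diff_divide_distrib)
      then show "(\<integral>g. iexp ((Y g - t) / lam * x) \<partial>\<Gamma>) = iexp (- t * x / lam) * \<phi> (x / lam)"
        by (simp add: \<phi>_def)
    qed
    finally have e: "complex_of_real (\<integral>g. exp (- (((Y g - t) / lam)\<^sup>2) / 2) \<partial>\<Gamma>)
        = (\<integral>x. iexp (- t * x / lam) * \<phi> (x / lam) \<partial>?N)" .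
    have "(\<integral>g. exp (- (((Y g - t) / lam)\<^sup>2) / 2) \<partial>\<Gamma>) = cmod (complex_of_real (\<integral>g. exp (- (((Y g
        - t) / lam)\<^sup>2) / 2) \<partial>\<Gamma>))"
      unfolding norm_of_real by simp
    also have "\<dots> \<le> (\<integral>x. cmod (iexp (- t * x / lam) * \<phi> (x / lam)) \<partial>?N)"
      unfolding e by (rule integral_norm_bound)
    also have "\<dots> \<le> (\<integral>x. (1 + 2 * (x\<^sup>2 * c\<^sup>2) / \<delta>\<^sup>2) powr (-1/4) \<partial>?N)"
    proof (rule integral_mono')
      show "integrable ?N (\<lambda>x. (1 + 2 * (x\<^sup>2 * c\<^sup>2) / \<delta>\<^sup>2) powr (-1/4))"
        using powr_neg_quarter_bounds by (intro N.integrable_const_bound[of _ 1]) auto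
      fix x
      define b where "b = 2 * (x\<^sup>2 * c\<^sup>2) / \<delta>\<^sup>2"
      have b: "0 \<le> b" by (simp add: b_def)
      have bd: "2 * ((x / lam)\<^sup>2 * c\<^sup>2) = b / d"
        using d by (simp add: b_def lam_def power_divide power_mult_distrib)
      have pos: "0 < 1 + b / d" using b d by (simp add: add_pos_nonneg)
      have "(cmod (\<phi> (x / lam)))\<^sup>2 \<le> (1 + b / d) powr (- real d / 2)"
        using gaussian_quadratic_char[OF J c low, of "x / lam"] by (simp add: \<phi>_def Y_def \<Gamma>_def bd)
      also have "\<dots> = ((1 + b / d) ^ d) powr (-1/2)"
        using pos by (simp add: powr_powr flip: powr_realpow)
      also have "\<dots> \<le> (1 + b) powr (-1/2)"
      proof (rule powr_mono2')
        have "1 + real d * (b / d) \<le> (1 + b / d) ^ d"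
          using b d by (intro Bernoulli_inequality) (auto intro: order_trans[of _ 0])
        then show "1 + b \<le> (1 + b / d) ^ d" using d by simp
      qed (use b in auto)
      also have "\<dots> = ((1 + b) powr (-1/4))\<^sup>2"
        using b by (simp add: powr_power)
      finally have "cmod (\<phi> (x / lam)) \<le> (1 + b) powr (-1/4)"
        by (rule power2_le_imp_le) simp
      then show "cmod (iexp (- t * x / lam) * \<phi> (x / lam)) \<le> (1 + 2 * (x\<^sup>2 * c\<^sup>2) / \<delta>\<^sup>2) powr (-1/4)"
        by (simp add: norm_mult b_def)
    qed auto
    finally show ?thesis .
  qed
  finally show ?thesis
    by (simp add: small_ball_bound_def A_def Y_def \<Gamma>_def lam_def)
qed

text \<open>
  Dominated convergence along \<open>\<delta> = 1 / (n + 1)\<close>; the integrand tends to \<open>0\<close> except at \<open>x = 0\<close>.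
\<close>

lemma small_ball_bound_vanishes:
  fixes c \<epsilon> :: real
  assumes c: "0 < c" and \<epsilon>: "0 < \<epsilon>"
  obtains \<delta> where "0 < \<delta>" "\<delta> \<le> 1" "small_ball_bound c \<delta> < \<epsilon>"
proof -
  let ?N = "std_normal_distribution"
  interpret N: prob_space ?N by (rule prob_space_stdn)
  let ?f = "\<lambda>(n::nat) x. (1 + 2 * (x\<^sup>2 * c\<^sup>2) / (1 / real (Suc n))\<^sup>2) powr (-1/4) :: real"
  have "(\<lambda>n. \<integral>x. ?f n x \<partial>?N) \<longlonglongrightarrow> (\<integral>x. 0 \<partial>?N)"
  proof (rule integral_dominated_convergence[where w = "\<lambda>_. 1"])
    have "AE x in lborel. x \<noteq> (0::real)" by (rule AE_lborel_singleton)
    then have "AE x in ?N. x \<noteq> 0" by (subst AE_density) auto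
    then show "AE x in ?N. (\<lambda>n. ?f n x) \<longlonglongrightarrow> 0"
    proof eventually_elim
      case (elim x)
      define b where "b = 2 * (x\<^sup>2 * c\<^sup>2)"
      have b: "0 < b" using elim c by (simp add: b_def)
      have "(\<lambda>n. (1 + b * (real (Suc n))\<^sup>2) powr (-1/4)) \<longlonglongrightarrow> 0"
        using b by real_asymp
      then show ?case by (simp add: b_def power_divide)
    qed
    show "AE x in ?N. norm (?f n x) \<le> 1" for n
      using powr_neg_quarter_bounds by auto
  qed auto
  then have "(\<lambda>n. small_ball_bound c (1 / real (Suc n))) \<longlonglongrightarrow> exp (1/2) * 0"
    unfolding small_ball_bound_def by (intro tendsto_mult tendsto_const) simp
  then have "eventually (\<lambda>n. small_ball_bound c (1 / real (Suc n)) < \<epsilon>) sequentially"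
    using \<epsilon> by (intro order_tendstoD(2)) auto
  then obtain n where "small_ball_bound c (1 / real (Suc n)) < \<epsilon>"
    by (auto simp: eventually_sequentially)
  then show ?thesis by (intro that[of "1 / real (Suc n)"]) auto
qed

section \<open>Eigenvalues and quadratic forms\<close>

definition mvec :: "nat \<Rightarrow> (nat \<Rightarrow> nat \<Rightarrow> real) \<Rightarrow> (nat \<Rightarrow> real) \<Rightarrow> nat \<Rightarrow> real" where
  "mvec d S v = (\<lambda>k. \<Sum>l<d. S k l * v l)"

lemma ip_mvec_symmetric:
  fixes S :: "nat \<Rightarrow> nat \<Rightarrow> real"
  assumes "\<And>k l. S k l = S l k"
  shows "ip d v (mvec d S w) = ip d w (mvec d S v)"
  unfolding ip_def mvec_def sum_distrib_left
  by (subst sum.swap) (simp add: assms mult_ac)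

lemma quadratic_form_add:
  fixes S :: "nat \<Rightarrow> nat \<Rightarrow> real"
  assumes "\<And>k l. S k l = S l k"
  shows "ip d (\<lambda>l. v l + t * w l) (mvec d S (\<lambda>l. v l + t * w l))
    = ip d v (mvec d S v) + 2 * t * ip d w (mvec d S v) + t\<^sup>2 * ip d w (mvec d S w)"
proof -
  have m: "mvec d S (\<lambda>l. v l + t * w l) = (\<lambda>k. mvec d S v k + t * mvec d S w k)"
    by (simp add: mvec_def algebra_simps sum.distrib sum_distrib_left)
  have "ip d (\<lambda>l. v l + t * w l) (\<lambda>k. mvec d S v k + t * mvec d S w k)
    = ip d v (mvec d S v) + t * ip d w (mvec d S v) + t * ip d v (mvec d S w) + t\<^sup>2 * ip d w (mvec d S w)"
    by (simp add: ip_def algebra_simps sum.distrib sum_distrib_left power2_eq_square)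
  then show ?thesis
    unfolding m ip_mvec_symmetric[OF assms, where v = v and w = w] by simp
qed

lemma compact_unit_sphere: "compact {v :: nat \<Rightarrow> real. (\<forall>l\<ge>d. v l = 0) \<and> nsq d v = 1}"
proof -
  let ?B = "\<lambda>l. if l < d then {-1..1::real} else {0}"
  have "compactin (product_topology (\<lambda>_. euclidean) UNIV) (PiE UNIV ?B)"
    by (subst compactin_PiE) (auto simp: compactin_euclidean_iff)
  then have c: "compact (PiE UNIV ?B)"
    by (simp add: euclidean_product_topology compactin_euclidean_iff)
  have cl: "closed {v :: nat \<Rightarrow> real. nsq d v = 1}"
    unfolding nsq_def by (intro closed_Collect_eq continuous_intros continuous_on_product_coordinates)
  have "v \<in> PiE UNIV ?B" if "\<forall>l\<ge>d. v l = 0" "nsq d v = 1" for v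
  proof -
    have "\<bar>v l\<bar> \<le> 1" if "l < d" for l
      using component_sq_le_nsq[OF that, of v] \<open>nsq d v = 1\<close> by (simp add: abs_square_le_1)
    then show ?thesis using that by (auto simp: PiE_def abs_le_iff)
  qed
  then have "{v. (\<forall>l\<ge>d. v l = 0) \<and> nsq d v = 1} \<subseteq> PiE UNIV ?B \<inter> {v. nsq d v = 1}"
    by blast
  moreover have "v l = 0" if "v \<in> PiE UNIV ?B" "d \<le> l" for v l
    using PiE_mem[OF that(1), of l] that(2) by simp
  ultimately have "{v. (\<forall>l\<ge>d. v l = 0) \<and> nsq d v = 1} = PiE UNIV ?B \<inter> {v. nsq d v = 1}"
    by blast
  then show ?thesis using compact_Int_closed[OF c cl] by simp
qed

text \<open>
  A minimiser \<open>v\<close> of the quadratic form on the unit sphere, with minimum \<open>e\<close>, makes \<open>S - e\<close> positive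
  semidefinite with value \<open>0\<close> at \<open>v\<close>. If \<open>r = S v - e v\<close> were not zero, moving from \<open>v\<close> in the direction \<open>- r\<close>
  would produce a negative value.
\<close>

lemma symmetric_min_eigenvector:
  fixes S :: "nat \<Rightarrow> nat \<Rightarrow> real"
  assumes d: "1 \<le> d" and sym: "\<And>k l. S k l = S l k"
  shows "\<exists>e v. nsq d v = 1 \<and> (\<forall>k<d. mvec d S v k = e * v k) \<and> (\<forall>w. e * nsq d w \<le> ip d w (mvec d S w))"
proof -
  let ?K = "{v :: nat \<Rightarrow> real. (\<forall>l\<ge>d. v l = 0) \<and> nsq d v = 1}"
  let ?Q = "\<lambda>v. ip d v (mvec d S v)"
  have cont: "continuous_on ?K ?Q"
    unfolding ip_def mvec_def
    by (intro continuous_intros continuous_on_subset[OF continuous_on_product_coordinates]) auto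
  have "(\<lambda>m. of_bool (m = 0)) \<in> ?K" using d nsq_basis[of 0 d] by auto
  then have "?K \<noteq> {}" by (metis equals0D)
  from continuous_attains_inf[OF compact_unit_sphere this cont]
  obtain v where "v \<in> ?K" "\<forall>w\<in>?K. ?Q v \<le> ?Q w" by (rule bexE)
  then have v: "v \<in> ?K" "\<And>w. w \<in> ?K \<Longrightarrow> ?Q v \<le> ?Q w" by simp_all
  define e where "e = ?Q v"
  have min: "e * nsq d w \<le> ?Q w" for w
  proof (cases "nsq d w = 0")
    case True
    then have "w l = 0" if "l < d" for l
      using component_sq_le_nsq[OF that, of w] by simp
    then have "?Q w = 0" by (simp add: ip_def)
    then show ?thesis using True by simp
  next
    case False
    then have pos: "0 < nsq d w" using nsq_nonneg[of d w] by linarith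
    define r where "r = 1 / sqrt (nsq d w)"
    have r2: "r\<^sup>2 = 1 / nsq d w" using pos by (simp add: r_def power_divide)
    define w' where "w' l = (if l < d then r * w l else 0)" for l
    have "nsq d w' = r\<^sup>2 * nsq d w" unfolding nsq_scale[symmetric] by (simp add: nsq_def w'_def)
    then have "w' \<in> ?K" using pos r2 by (auto simp: w'_def)
    then have "e \<le> ?Q w'" unfolding e_def by (rule v(2))
    also have "?Q w' = r\<^sup>2 * ?Q w"
      by (simp add: ip_def mvec_def w'_def sum_distrib_left power2_eq_square mult_ac)
    finally show ?thesis using pos by (simp add: r2 field_simps)
  qed
  define r where "r k = mvec d S v k - e * v k" for k
  define b where "b = ?Q r - e * nsq d r"
  have b: "0 \<le> b" using min[of r] by (simp add: b_def)
  have par: "0 \<le> 2 * t * nsq d r + t\<^sup>2 * b" for t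
  proof -
    have i: "ip d r (mvec d S v) - e * ip d v r = nsq d r"
      by (simp add: ip_def nsq_def r_def sum_subtractf[symmetric] sum_distrib_left power2_eq_square algebra_simps)
    have "0 \<le> ?Q (\<lambda>l. v l + t * r l) - e * nsq d (\<lambda>l. v l + t * r l)"
      using min[of "\<lambda>l. v l + t * r l"] by simp
    also have "\<dots> = 2 * t * (ip d r (mvec d S v) - e * ip d v r) + t\<^sup>2 * b"
      unfolding quadratic_form_add[OF sym] nsq_add nsq_scale ip_scale_right b_def e_def[symmetric]
      using v(1) by (simp add: algebra_simps)
    finally show ?thesis unfolding i .
  qed
  have "nsq d r = 0"
  proof (rule ccontr)
    assume "nsq d r \<noteq> 0"
    then have pos: "0 < nsq d r" using nsq_nonneg[of d r] by linarith
    \<comment> \<open>a small negative step; \<open>b + 1\<close> avoids a division by zero\<close>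
    define t where "t = - nsq d r / (b + 1)"
    have t: "t * (b + 1) = - nsq d r" "t < 0" using b pos by (auto simp: t_def divide_neg_pos)
    have "2 * t * nsq d r + t\<^sup>2 * b = t * (2 * nsq d r + t * (b + 1) - t)"
      by (simp add: power2_eq_square algebra_simps)
    also have "\<dots> = t * (nsq d r - t)" unfolding t(1) by simp
    also have "\<dots> < 0" using t pos by (intro mult_neg_pos) auto
    finally show False using par[of t] by simp
  qed
  then have "r k = 0" if "k < d" for k
    using component_sq_le_nsq[OF that, of r] by simp
  then show ?thesis
    using v(1) min by (intro exI[of _ e] exI[of _ v]) (auto simp: r_def)
qed

lemma eigenvalue_matI:
  fixes S :: "nat \<Rightarrow> nat \<Rightarrow> real"
  assumes "nsq d v = 1" "\<And>k. k < d \<Longrightarrow> mvec d S v k = e * v k"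
  shows "eigenvalue (mat d d (\<lambda>(k, l). S k l)) e"
proof -
  have "vec d v \<noteq> 0\<^sub>v d"
  proof
    assume z: "vec d v = 0\<^sub>v d"
    have "v l = 0" if "l < d" for l
      using arg_cong[OF z, of "\<lambda>u. vec_index u l"] that by simp
    then show False using assms(1) by (simp add: nsq_def)
  qed
  moreover have "mat d d (\<lambda>(k, l). S k l) *\<^sub>v vec d v = e \<cdot>\<^sub>v vec d v"
  proof (rule eq_vecI)
    fix k assume "k < dim_vec (e \<cdot>\<^sub>v vec d v)"
    then have k: "k < d" by simp
    have "vec_index (mat d d (\<lambda>(k, l). S k l) *\<^sub>v vec d v) k = (\<Sum>l<d. S k l * v l)"
      using k by (simp add: scalar_prod_def atLeast0LessThan)
    then show "vec_index (mat d d (\<lambda>(k, l). S k l) *\<^sub>v vec d v) k = vec_index (e \<cdot>\<^sub>v vec d v) k"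
      using assms(2)[OF k] k by (simp add: mvec_def)
  qed simp
  ultimately show ?thesis
    unfolding eigenvalue_def eigenvector_def by (intro exI[of _ "vec d v"]) simp
qed

text \<open>
  The lower bound is the smallest eigenvalue of \<open>S\<close>, the upper bound comes from the smallest eigenvalue of \<open>- S\<close>.
\<close>

lemma quadratic_form_eigenvalue_bounds:
  fixes S :: "nat \<Rightarrow> nat \<Rightarrow> real"
  assumes d: "1 \<le> d" and sym: "\<And>k l. S k l = S l k"
    and ev: "\<And>e. eigenvalue (mat d d (\<lambda>(k, l). S k l)) e \<Longrightarrow> c \<le> e \<and> e \<le> C"
  shows "c * nsq d w \<le> ip d w (mvec d S w)" and "ip d w (mvec d S w) \<le> C * nsq d w"
proof -
  from symmetric_min_eigenvector[where S = S, OF d sym]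
  obtain e v where "nsq d v = 1" "\<forall>k<d. mvec d S v k = e * v k" "\<forall>w. e * nsq d w \<le> ip d w (mvec d S w)"
    by (elim exE conjE)
  then have e: "nsq d v = 1" "\<And>k. k < d \<Longrightarrow> mvec d S v k = e * v k" "\<And>w. e * nsq d w \<le> ip d w (mvec d S w)"
    by simp_all
  have "c \<le> e" using ev[OF eigenvalue_matI[OF e(1,2)]] by simp
  then have "c * nsq d w \<le> e * nsq d w" by (intro mult_right_mono) auto
  then show "c * nsq d w \<le> ip d w (mvec d S w)" using e(3)[of w] by simp
  have sym': "- S k l = - S l k" for k l using sym by simp
  have neg: "mvec d (\<lambda>k l. - S k l) w = (\<lambda>k. - mvec d S w k)" for w
    by (simp add: mvec_def sum_negf)
  from symmetric_min_eigenvector[where S = "\<lambda>k l. - S k l", OF d sym']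
  obtain e v where "nsq d v = 1" "\<forall>k<d. mvec d (\<lambda>k l. - S k l) v k = e * v k"
    "\<forall>w. e * nsq d w \<le> ip d w (mvec d (\<lambda>k l. - S k l) w)"
    by (elim exE conjE)
  then have e: "nsq d v = 1" "\<And>k. k < d \<Longrightarrow> mvec d (\<lambda>k l. - S k l) v k = e * v k"
    "\<And>w. e * nsq d w \<le> ip d w (mvec d (\<lambda>k l. - S k l) w)"
    by simp_all
  have "mvec d S v k = (- e) * v k" if "k < d" for k using e(2)[OF that] by (simp add: neg)
  then have "- e \<le> C" using ev[OF eigenvalue_matI[OF e(1)]] by simp
  then have "(- e) * nsq d w \<le> C * nsq d w" by (intro mult_right_mono) auto
  moreover have "ip d w (mvec d (\<lambda>k l. - S k l) w) = - ip d w (mvec d S w)"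
    unfolding neg by (simp add: ip_def sum_negf)
  ultimately show "ip d w (mvec d S w) \<le> C * nsq d w" using e(3)[of w] by simp
qed


section \<open>Gaussian combinations of fixed vectors\<close>

lemma stdn_moments:
  "integrable std_normal_distribution (\<lambda>x. x)" "(\<integral>x. x \<partial>std_normal_distribution) = 0"
  "integrable std_normal_distribution (\<lambda>x. x\<^sup>2)" "(\<integral>x. x\<^sup>2 \<partial>std_normal_distribution) = 1"
  "integrable std_normal_distribution (\<lambda>x. x ^ 4)" "(\<integral>x. x ^ 4 \<partial>std_normal_distribution) = 3"
proof -
  show "integrable std_normal_distribution (\<lambda>x. x)" "integrable std_normal_distribution (\<lambda>x. x\<^sup>2)" "integrable std_normal_distribution (\<lambda>x. x ^ 4)"
    using integrable_std_normal_distribution_moment[of 1] integrable_std_normal_distribution_moment by auto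
  show "(\<integral>x. x \<partial>std_normal_distribution) = 0"
    using integral_std_normal_distribution_moment_odd[of 1] by simp
  show "(\<integral>x. x\<^sup>2 \<partial>std_normal_distribution) = 1"
    using std_normal_distribution_even_moments(1)[of 1] by simp
  show "(\<integral>x. x ^ 4 \<partial>std_normal_distribution) = 3"
    using std_normal_distribution_even_moments(1)[of 2] by (simp add: fact_numeral)
qed

lemma centred_law_weight:
  fixes L :: "real measure" and a :: "nat \<Rightarrow> real"
  assumes "prob_space L" "sets L = sets borel" "integrable L (\<lambda>r. r)" "(\<integral>r. r \<partial>L) = 0"
    "integrable L (\<lambda>r. r\<^sup>2)" "(\<integral>r. r\<^sup>2 \<partial>L) = 1"
  shows "centred_law d L (\<lambda>r l. r * a l)"
    and "(\<integral>r. (ip d v (\<lambda>l. r * a l))\<^sup>2 \<partial>L) = (ip d v a)\<^sup>2"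
    and "(\<integral>r. nsq d (\<lambda>l. r * a l) \<partial>L) = nsq d a"
    and "integrable L (\<lambda>r. r ^ 4) \<Longrightarrow> integrable L (\<lambda>r. (nsq d (\<lambda>l. r * a l))\<^sup>2)"
    and "(\<integral>r. (nsq d (\<lambda>l. r * a l))\<^sup>2 \<partial>L) = (\<integral>r. r ^ 4 \<partial>L) * (nsq d a)\<^sup>2"
proof -
  have m [measurable]: "(\<lambda>r. r) \<in> borel_measurable L" by (rule borel_measurable_integrable) fact
  show "centred_law d L (\<lambda>r l. r * a l)"
    unfolding centred_law_def nsq_scale
    by (intro conjI allI impI assms(1) borel_measurable_times m borel_measurable_const integrable_mult_left assms(5))
      (simp add: assms(4))
  show "(\<integral>r. (ip d v (\<lambda>l. r * a l))\<^sup>2 \<partial>L) = (ip d v a)\<^sup>2"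
    "(\<integral>r. nsq d (\<lambda>l. r * a l) \<partial>L) = nsq d a"
    unfolding ip_scale_right nsq_scale power_mult_distrib by (simp_all add: assms(6))
  have e: "(nsq d (\<lambda>l. r * a l))\<^sup>2 = r ^ 4 * (nsq d a)\<^sup>2" for r
    unfolding nsq_scale by (simp add: power_mult_distrib)
  show "integrable L (\<lambda>r. (nsq d (\<lambda>l. r * a l))\<^sup>2)" if "integrable L (\<lambda>r. r ^ 4)"
    using that unfolding e by simp
  show "(\<integral>r. (nsq d (\<lambda>l. r * a l))\<^sup>2 \<partial>L) = (\<integral>r. r ^ 4 \<partial>L) * (nsq d a)\<^sup>2"
    unfolding e by simp
qed

lemmas centred_law_stdn = centred_law_weight[OF prob_space_stdn sets_stdn stdn_moments(1-4)]

lemma vsum_weight_eq_gsum: "vsum J (\<lambda>j r l. r * a j l) = gsum J a"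
  by (simp add: vsum_def gsum_def fun_eq_iff)

text \<open>
  The moments of \<open>\<Sum> g\<^sub>j a\<^sub>j\<close> are special cases of those of sums of independent centred vectors; the
  constant \<open>9\<close> is \<open>3\<close> times the fourth moment of a standard normal variable.
\<close>

lemma gaussian_gsum:
  assumes J: "finite J"
  shows "centred_law d (gaussian J) (gsum J a)"
    and "(\<integral>g. (ip d v (gsum J a g))\<^sup>2 \<partial>gaussian J) = (\<Sum>j\<in>J. (ip d v (a j))\<^sup>2)"
    and "(\<integral>g. nsq d (gsum J a g) \<partial>gaussian J) = (\<Sum>j\<in>J. nsq d (a j))"
    and "integrable (gaussian J) (\<lambda>g. (nsq d (gsum J a g))\<^sup>2)"
    and "(\<integral>g. (nsq d (gsum J a g))\<^sup>2 \<partial>gaussian J) \<le> 4 * (\<Sum>j\<in>J. nsq d (a j))\<^sup>2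
        + 9 * (\<Sum>j\<in>J. (nsq d (a j))\<^sup>2)"
proof -
  interpret G: prob_space "gaussian J" by (rule prob_space_gaussian)
  have cl: "centred_law d std_normal_distribution (\<lambda>r l. r * a j l)" for j
    by (rule centred_law_stdn)
  have m [measurable]: "(\<lambda>g. gsum J a g l) \<in> borel_measurable (gaussian J)" for l
    by (intro gsum_measurable measurable_ident_sets[OF refl])
  have mn [measurable]: "(\<lambda>g. nsq d (gsum J a g)) \<in> borel_measurable (gaussian J)"
    by (intro nsq_measurable m)
  have mi [measurable]: "(\<lambda>g. ip d (gsum J a g) v) \<in> borel_measurable (gaussian J)"
    by (intro ip_measurable m)
  note V = vsum_second_moment vsum_ip_moment vsum_fourth_moment
  note V = V[where d = d and L = "\<lambda>_. std_normal_distribution" and V = "\<lambda>j r l. r * a j l" and I = J,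
      OF J cl, folded gaussian_def, unfolded vsum_weight_eq_gsum centred_law_stdn]
  have i2: "(\<integral>\<^sup>+g. ennreal (nsq d (gsum J a g)) \<partial>gaussian J) = ennreal (\<Sum>j\<in>J. nsq d (a j))"
    by (rule V(1))
  have i1: "(\<integral>\<^sup>+g. ennreal ((ip d (gsum J a g) v)\<^sup>2) \<partial>gaussian J) = ennreal (\<Sum>j\<in>J. (ip d v (a j))\<^sup>2)"
    by (rule V(2))
  have i4: "(\<integral>\<^sup>+g. ennreal ((nsq d (gsum J a g))\<^sup>2) \<partial>gaussian J)
      \<le> ennreal (4 * (\<Sum>j\<in>J. nsq d (a j))\<^sup>2 + 3 * (\<Sum>j\<in>J. 3 * (nsq d (a j))\<^sup>2))"
    using V(3) by (simp add: stdn_moments centred_law_stdn)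
  show I2: "(\<integral>g. nsq d (gsum J a g) \<partial>gaussian J) = (\<Sum>j\<in>J. nsq d (a j))"
    by (subst integral_eq_nn_integral) (auto simp: i2 sum_nonneg)
  show "(\<integral>g. (ip d v (gsum J a g))\<^sup>2 \<partial>gaussian J) = (\<Sum>j\<in>J. (ip d v (a j))\<^sup>2)"
    unfolding ip_commute[of d v "gsum J a _"]
    by (subst integral_eq_nn_integral) (auto simp: i1 sum_nonneg)
  show I4: "integrable (gaussian J) (\<lambda>g. (nsq d (gsum J a g))\<^sup>2)"
    using i4 by (intro integrableI_bounded) (auto intro: le_less_trans)
  have "ennreal (\<integral>g. (nsq d (gsum J a g))\<^sup>2 \<partial>gaussian J) \<le> ennreal (4 * (\<Sum>j\<in>J. nsq d (a j))\<^sup>2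
      + 3 * (\<Sum>j\<in>J. 3 * (nsq d (a j))\<^sup>2))"
    using i4 I4 by (subst nn_integral_eq_integral[symmetric]) auto
  then show "(\<integral>g. (nsq d (gsum J a g))\<^sup>2 \<partial>gaussian J) \<le> 4 * (\<Sum>j\<in>J. nsq d (a j))\<^sup>2
      + 9 * (\<Sum>j\<in>J. (nsq d (a j))\<^sup>2)"
    by (subst (asm) ennreal_le_iff) (auto intro!: add_nonneg_nonneg sum_nonneg simp: sum_distrib_left)
  have ml: "(\<integral>g. gsum J a g l \<partial>gaussian J) = 0" for l
  proof -
    interpret product_sigma_finite "\<lambda>_::'a. std_normal_distribution"
      by (rule product_sigma_finite_prob) (rule prob_space_stdn)
    have c: "integrable (gaussian J) (\<lambda>g. g j) \<and> (\<integral>g. g j \<partial>gaussian J) = 0" if "j \<in> J" for j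
    proof -
      have d: "distr (gaussian J) std_normal_distribution (\<lambda>g. g j) = std_normal_distribution"
        unfolding gaussian_def by (rule distr_PiM_component) (auto intro: prob_space_stdn J that)
      have mj: "(\<lambda>g. g j) \<in> measurable (gaussian J) std_normal_distribution"
        unfolding gaussian_def by (rule measurable_component_singleton) (rule that)
      have "integrable (distr (gaussian J) std_normal_distribution (\<lambda>g. g j)) (\<lambda>x. x)"
        unfolding d by (rule stdn_moments)
      then have "integrable (gaussian J) (\<lambda>g. g j)" by (rule integrable_distr[OF mj])
      moreover have "(\<integral>x. x \<partial>distr (gaussian J) std_normal_distribution (\<lambda>g. g j))
          = (\<integral>g. g j \<partial>gaussian J)"
        by (rule integral_distr[OF mj]) simp
      ultimately show ?thesis unfolding d stdn_moments(2) by simp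
    qed
    have "(\<integral>g. gsum J a g l \<partial>gaussian J) = (\<Sum>j\<in>J. \<integral>g. g j * a j l \<partial>gaussian J)"
      unfolding gsum_def by (rule Bochner_Integration.integral_sum) (simp add: c)
    then show ?thesis by (simp add: c)
  qed
  have "integrable (gaussian J) (\<lambda>g. nsq d (gsum J a g))"
    by (intro integrableI_bounded) (auto simp: i2)
  then show "centred_law d (gaussian J) (gsum J a)"
    using ml m unfolding centred_law_def by (auto intro: G.prob_space_axioms)
qed

definition gauss_law :: "nat \<Rightarrow> 'i set \<Rightarrow> ('i \<Rightarrow> nat \<Rightarrow> real) \<Rightarrow> (nat \<Rightarrow> real) measure" where
  "gauss_law d J a = distr (gaussian J) (PiM {..<d} (\<lambda>_. borel)) (\<lambda>g. \<lambda>l\<in>{..<d}. gsum J a g l)"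

text \<open>
  Induction on the number of copies: \<open>m\<close> copies add up to \<open>\<surd>m G\<close>, and stability merges \<open>\<surd>m G' + G\<close> into
  \<open>\<surd>(m + 1) G\<close>.
\<close>

lemma nn_integral_gauss_law_sum:
  fixes h :: "(nat \<Rightarrow> real) \<Rightarrow> ennreal" and K :: "'k set"
  assumes J: "finite J" and K: "finite K" and h: "h \<in> borel_measurable (PiM {..<d} (\<lambda>_. borel))"
  shows "(\<integral>\<^sup>+x. h (\<lambda>l\<in>{..<d}. \<Sum>k\<in>K. x k l) \<partial>PiM K (\<lambda>_. gauss_law d J a))
    = (\<integral>\<^sup>+g. h (\<lambda>l\<in>{..<d}. sqrt (card K) * gsum J a g l) \<partial>gaussian J)"
  using K h
proof (induction K arbitrary: h rule: finite_induct)
  case empty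
  interpret G: prob_space "gaussian J" by (rule prob_space_gaussian)
  show ?case by (simp add: PiM_empty nn_integral_count_space_finite G.emeasure_space_1)
next
  case (insert k K)
  let ?G = "gaussian J" and ?V = "PiM {..<d} (\<lambda>_. borel :: real measure)"
  interpret G: prob_space ?G by (rule prob_space_gaussian)
  note h [measurable] = insert.prems
  have gm [measurable (raw)]: "(\<lambda>z. gsum J a (p z) l) \<in> borel_measurable M" if "p \<in> measurable M ?G" for p l and M :: "'z measure"
    using that by (rule gsum_measurable)
  have m: "(\<lambda>g. \<lambda>l\<in>{..<d}. gsum J a g l) \<in> measurable ?G ?V"
    by (intro measurable_restrict gsum_measurable measurable_ident_sets[OF refl])
  have PL: "prob_space (gauss_law d J a)"
    unfolding gauss_law_def using m by (rule G.prob_space_distr)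
  interpret product_sigma_finite "\<lambda>_::'k. gauss_law d J a"
    by (rule product_sigma_finite_prob) (rule PL)
  let ?K = "PiM K (\<lambda>_. gauss_law d J a)"
  interpret PK: prob_space ?K by (rule prob_space_PiM) (rule PL)
  interpret KG: pair_sigma_finite ?K ?G ..
  have sL: "sets (gauss_law d J a) = sets ?V" by (simp add: gauss_law_def)
  have cm [measurable (raw)]: "(\<lambda>z. p z k l) \<in> borel_measurable M"
    if p: "p \<in> measurable M (PiM K' (\<lambda>_. gauss_law d J a))" and kl: "k \<in> K'" "l < d" for p l and k :: 'k and K' and M :: "'z measure"
  proof -
    have "(\<lambda>z. p z k) \<in> measurable M (gauss_law d J a)"
      using measurable_compose[OF p measurable_component_singleton[OF kl(1)]] .
    then have "(\<lambda>z. p z k) \<in> measurable M ?V" by (simp add: measurable_cong_sets[OF refl sL])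
    then show ?thesis using kl by (auto intro: measurable_compose[OF _ measurable_component_singleton])
  qed
  have restr: "(\<lambda>z. h (\<lambda>l\<in>{..<d}. f z l)) \<in> borel_measurable M"
    if "\<And>l. l < d \<Longrightarrow> (\<lambda>z. f z l) \<in> borel_measurable M" for f and M :: "'z measure"
    using that by (intro measurable_compose[OF _ h] measurable_restrict) auto
  \<comment> \<open>the rotation that turns \<open>\<surd>m G' + G\<close> into \<open>\<surd>(m + 1) G\<close>\<close>
  define \<alpha> \<beta> where "\<alpha> = sqrt (card K / (card K + 1))" and "\<beta> = sqrt (1 / (card K + 1))"
  have ab: "\<alpha>\<^sup>2 + \<beta>\<^sup>2 = 1" by (simp add: \<alpha>_def \<beta>_def add_divide_distrib[symmetric])
  have as: "sqrt (card K + 1) * \<alpha> = sqrt (card K)" "sqrt (card K + 1) * \<beta> = 1"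
    by (simp_all add: \<alpha>_def \<beta>_def real_sqrt_divide)
  have cardk: "card (insert k K) = card K + 1" using insert.hyps by simp
  have "(\<integral>\<^sup>+x. h (\<lambda>l\<in>{..<d}. \<Sum>i\<in>insert k K. x i l) \<partial>PiM (insert k K) (\<lambda>_. gauss_law d J a))
    = (\<integral>\<^sup>+x. \<integral>\<^sup>+y. h (\<lambda>l\<in>{..<d}. \<Sum>i\<in>insert k K. (x(k := y)) i l) \<partial>gauss_law d J a \<partial>?K)"
    by (rule product_nn_integral_insert[OF insert.hyps])
      (intro restr borel_measurable_sum cm[of "\<lambda>x. x" _ "insert k K"] measurable_ident_sets[OF refl], auto)
  also have "\<dots> = (\<integral>\<^sup>+x. \<integral>\<^sup>+y. h (\<lambda>l\<in>{..<d}. (\<Sum>i\<in>K. x i l)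
      + y l) \<partial>gauss_law d J a \<partial>?K)"
  proof -
    have "(\<Sum>i\<in>insert k K. (x(k := y)) i l) = (\<Sum>i\<in>K. x i l) + y l" for x :: "'k \<Rightarrow> nat \<Rightarrow> real" and y l
      using insert.hyps by (simp add: add.commute) (intro sum.cong, auto)
    then show ?thesis by simp
  qed
  also have "\<dots> = (\<integral>\<^sup>+x. \<integral>\<^sup>+g. h (\<lambda>l\<in>{..<d}. (\<Sum>i\<in>K. x i l)
      + gsum J a g l) \<partial>?G \<partial>?K)"
  proof (rule nn_integral_cong)
    fix x assume x: "x \<in> space ?K"
    have "(\<integral>\<^sup>+y. h (\<lambda>l\<in>{..<d}. (\<Sum>i\<in>K. x i l) + y l) \<partial>gauss_law d J a)
      = (\<integral>\<^sup>+g. h (\<lambda>l\<in>{..<d}. (\<Sum>i\<in>K. x i l) + (\<lambda>l\<in>{..<d}. gsum J a g l) l) \<partial>?G)"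
      unfolding gauss_law_def
      by (rule nn_integral_distr[OF m]) (intro restr borel_measurable_add borel_measurable_const measurable_component_singleton, auto)
    then show "(\<integral>\<^sup>+y. h (\<lambda>l\<in>{..<d}. (\<Sum>i\<in>K. x i l) + y l) \<partial>gauss_law d J a)
      = (\<integral>\<^sup>+g. h (\<lambda>l\<in>{..<d}. (\<Sum>i\<in>K. x i l) + gsum J a g l) \<partial>?G)"
      by (simp cong: restrict_cong)
  qed
  also have "\<dots> = (\<integral>\<^sup>+g. \<integral>\<^sup>+x. h (\<lambda>l\<in>{..<d}. (\<Sum>i\<in>K. x i l)
      + gsum J a g l) \<partial>?K \<partial>?G)"
    by (rule KG.Fubini'[symmetric], simp only: split_beta',
        intro restr borel_measurable_add borel_measurable_sum cm[of fst _ K] gm[of snd] measurable_fst measurable_snd)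
  also have "\<dots> = (\<integral>\<^sup>+g. \<integral>\<^sup>+g'. h (\<lambda>l\<in>{..<d}. sqrt (card K) * gsum J a g' l
      + gsum J a g l) \<partial>?G \<partial>?G)"
  proof (rule nn_integral_cong)
    fix g
    define h' where "h' w = h (\<lambda>l\<in>{..<d}. w l + gsum J a g l)" for w
    have "h' \<in> borel_measurable ?V" unfolding h'_def
      by (intro restr borel_measurable_add borel_measurable_const measurable_component_singleton) auto
    from insert.IH[OF this]
    show "(\<integral>\<^sup>+x. h (\<lambda>l\<in>{..<d}. (\<Sum>i\<in>K. x i l) + gsum J a g l) \<partial>?K)
      = (\<integral>\<^sup>+g'. h (\<lambda>l\<in>{..<d}. sqrt (card K) * gsum J a g' l + gsum J a g l) \<partial>?G)"
      unfolding h'_def by (simp cong: restrict_cong)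
  qed
  also have "\<dots> = (\<integral>\<^sup>+g. \<integral>\<^sup>+g'. h (\<lambda>l\<in>{..<d}. sqrt (card K
      + 1) * gsum J a (mix \<beta> \<alpha> J g g') l) \<partial>?G \<partial>?G)"
    unfolding gsum_mix distrib_left mult.assoc[symmetric] as by (simp add: add.commute)
  also have "\<dots> = (\<integral>\<^sup>+g. h (\<lambda>l\<in>{..<d}. sqrt (card K + 1) * gsum J a g l) \<partial>?G)"
    by (rule nn_integral_gaussian_stable)
      (use ab J in \<open>auto simp: add.commute intro!: restr borel_measurable_times gm measurable_ident_sets\<close>)
  finally show ?case unfolding cardk .
qed

section \<open>Gaussian approximation of the sample mean and of the bootstrap mean\<close>

text \<open>
  The right-hand side of the replacement bound.
\<close>

definition lindeberg_error :: "nat \<Rightarrow> real \<Rightarrow> real \<Rightarrow> real \<Rightarrow> real \<Rightarrow> real \<Rightarrow> real" where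
  "lindeberg_error d lam \<tau> \<kappa> \<eta> \<rho> = \<eta> * (sqrt d / lam + 2 * \<kappa> * d / lam\<^sup>2)
      + 112 * \<tau> * \<kappa> / lam\<^sup>2 * (\<kappa> * d)
      + (448 * (4 * (\<kappa> * d)\<^sup>2 + 3 * \<rho>) / lam ^ 4 + 28 / lam\<^sup>2) / \<tau> * \<rho>"

lemma centred_law_scale:
  assumes L: "centred_law d L V"
  shows "centred_law d L (\<lambda>x l. r * V x l)"
    and "(\<integral>x. (ip d v (\<lambda>l. r * V x l))\<^sup>2 \<partial>L) = r\<^sup>2 * (\<integral>x. (ip d v (V x))\<^sup>2 \<partial>L)"
    and "(\<integral>x. nsq d (\<lambda>l. r * V x l) \<partial>L) = r\<^sup>2 * (\<integral>x. nsq d (V x) \<partial>L)"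
    and "(\<integral>x. (nsq d (\<lambda>l. r * V x l))\<^sup>2 \<partial>L) = r ^ 4 * (\<integral>x. (nsq d (V x))\<^sup>2 \<partial>L)"
    and "integrable L (\<lambda>x. (nsq d (V x))\<^sup>2) \<Longrightarrow> integrable L (\<lambda>x. (nsq d (\<lambda>l. r * V x l))\<^sup>2)"
proof -
  have e4: "(r\<^sup>2)\<^sup>2 = r ^ 4" by simp
  show "centred_law d L (\<lambda>x l. r * V x l)"
    using L unfolding centred_law_def nsq_scale by auto
qed (simp_all add: ip_scale_right nsq_scale power_mult_distrib)

lemma nsq_restrict [simp]: "nsq d (\<lambda>l\<in>{..<d}. x l) = nsq d x"
  by (simp add: nsq_def)

lemma ip_restrict [simp]: "ip d v (\<lambda>l\<in>{..<d}. x l) = ip d v x"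
  by (simp add: ip_def)

lemma gauss_law_moments:
  assumes J: "finite J"
  shows "centred_law d (gauss_law d J a) (\<lambda>x. x)"
    and "(\<integral>x. (ip d v x)\<^sup>2 \<partial>gauss_law d J a) = (\<Sum>j\<in>J. (ip d v (a j))\<^sup>2)"
    and "(\<integral>x. nsq d x \<partial>gauss_law d J a) = (\<Sum>j\<in>J. nsq d (a j))"
    and "integrable (gauss_law d J a) (\<lambda>x. (nsq d x)\<^sup>2)"
    and "(\<integral>x. (nsq d x)\<^sup>2 \<partial>gauss_law d J a) \<le> 4 * (\<Sum>j\<in>J. nsq d (a j))\<^sup>2
        + 9 * (\<Sum>j\<in>J. (nsq d (a j))\<^sup>2)"
proof -
  interpret G: prob_space "gaussian J" by (rule prob_space_gaussian)
  let ?V = "PiM {..<d} (\<lambda>_. borel :: real measure)"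
  have m: "(\<lambda>g. \<lambda>l\<in>{..<d}. gsum J a g l) \<in> measurable (gaussian J) ?V"
    by (intro measurable_restrict gsum_measurable measurable_ident_sets[OF refl])
  have c: "(\<lambda>x. x l) \<in> borel_measurable ?V" if "l < d" for l
    using that by (intro measurable_component_singleton) auto
  have nm: "nsq d \<in> borel_measurable ?V" by (rule nsq_measurable) (rule c)
  have im: "(\<lambda>x. ip d v x) \<in> borel_measurable ?V" for v
    unfolding ip_def by (intro borel_measurable_sum borel_measurable_times borel_measurable_const c) auto
  note GG = gaussian_gsum[OF J, where d = d and a = a]
  have "integrable (gauss_law d J a) (nsq d)"
    unfolding gauss_law_def using centred_lawD(3)[OF GG(1)] by (subst integrable_distr_eq[OF m nm]) simp
  moreover have "(\<integral>x. x l \<partial>gauss_law d J a) = 0" if "l < d" for l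
    unfolding gauss_law_def using GG(1) that by (subst integral_distr[OF m c]) (auto simp: centred_law_def)
  ultimately show "centred_law d (gauss_law d J a) (\<lambda>x. x)"
    using G.prob_space_distr[OF m] c by (simp add: centred_law_def gauss_law_def)
  show "(\<integral>x. (ip d v x)\<^sup>2 \<partial>gauss_law d J a) = (\<Sum>j\<in>J. (ip d v (a j))\<^sup>2)"
    unfolding gauss_law_def using GG(2) im by (subst integral_distr[OF m]) auto
  show "(\<integral>x. nsq d x \<partial>gauss_law d J a) = (\<Sum>j\<in>J. nsq d (a j))"
    unfolding gauss_law_def using GG(3) nm by (subst integral_distr[OF m]) auto
  show "integrable (gauss_law d J a) (\<lambda>x. (nsq d x)\<^sup>2)"
    unfolding gauss_law_def using GG(4) nm by (subst integrable_distr_eq[OF m]) auto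
  show "(\<integral>x. (nsq d x)\<^sup>2 \<partial>gauss_law d J a) \<le> 4 * (\<Sum>j\<in>J. nsq d (a j))\<^sup>2
      + 9 * (\<Sum>j\<in>J. (nsq d (a j))\<^sup>2)"
    unfolding gauss_law_def using GG(5) nm by (subst integral_distr[OF m]) auto
qed

lemma sum_nsq_le:
  assumes "\<And>v. (\<Sum>j\<in>J. (ip d v (a j))\<^sup>2) \<le> \<kappa> * nsq d v"
  shows "(\<Sum>j\<in>J. nsq d (a j)) \<le> \<kappa> * d"
proof -
  have b: "ip d (\<lambda>m. of_bool (m = l)) x = x l" if "l < d" for l x
    using that by (simp add: ip_def of_bool_def if_distrib[of "\<lambda>y. y * _"] cong: if_cong)
  have "(\<Sum>j\<in>J. nsq d (a j)) = (\<Sum>l<d. \<Sum>j\<in>J. (ip d (\<lambda>m. of_bool (m = l)) (a j))\<^sup>2)"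
    unfolding nsq_def by (subst sum.swap) (simp add: b)
  also have "\<dots> \<le> (\<Sum>l<d. \<kappa> * nsq d (\<lambda>m. of_bool (m = l)))" by (intro sum_mono assms)
  also have "\<dots> = \<kappa> * d" by (simp add: nsq_basis)
  finally show ?thesis .
qed

text \<open>
  The reference vector \<open>G\<close> is \<open>\<Sum> g\<^sub>j a\<^sub>j\<close>. Each summand \<open>z\<^sub>i / \<surd>n\<close> is exchanged for a copy of \<open>G / \<surd>n\<close>, and the
  \<open>n\<close> copies add up to \<open>G\<close> again. The fourth moment of \<open>G\<close> is of order \<open>d\<^sup>2\<close> and enters divided by \<open>n\<close>.
\<close>

lemma data_vs_gauss:
  fixes P :: "(nat \<Rightarrow> real) measure" and lam \<tau> t \<eta> \<kappa> \<rho> :: real and n d :: nat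
  assumes n: "1 \<le> n" and lam: "0 < lam" and \<tau>: "0 < \<tau>" "\<tau> \<le> 1" and J: "finite J"
    and P: "centred_law d P (\<lambda>z. z)" "integrable P (\<lambda>z. (nsq d z)\<^sup>2)"
    and nn: "0 \<le> \<kappa>" "0 \<le> \<eta>"
    and up: "\<And>v. (\<integral>z. (ip d v z)\<^sup>2 \<partial>P) \<le> \<kappa> * nsq d v" "\<And>v. (\<Sum>j\<in>J. (ip d v (a j))\<^sup>2)
        \<le> \<kappa> * nsq d v"
    and cov: "\<And>v. \<bar>(\<integral>z. (ip d v z)\<^sup>2 \<partial>P) - (\<Sum>j\<in>J. (ip d v (a j))\<^sup>2)\<bar> \<le> \<eta> * nsq d v"
    and tr: "\<bar>(\<integral>z. nsq d z \<partial>P) - (\<Sum>j\<in>J. nsq d (a j))\<bar> \<le> \<eta> * sqrt d"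
    and \<rho>: "(\<integral>z. (nsq d z)\<^sup>2 \<partial>P) \<le> n * \<rho>" "(\<Sum>j\<in>J. (nsq d (a j))\<^sup>2) \<le> \<rho>"
  shows "\<bar>(\<integral>z. smooth_step (nsq d (\<lambda>l. \<Sum>i=1..n. z i l / sqrt n) / lam - t) \<partial>PiM {1..n} (\<lambda>_. P))
      - (\<integral>g. smooth_step (nsq d (gsum J a g) / lam - t) \<partial>gaussian J)\<bar>
          \<le> lindeberg_error d lam \<tau> \<kappa> \<eta> (\<rho> + (4 * (\<kappa> * d)\<^sup>2 + 9 * \<rho>) / n)"
proof -
  define \<rho>' where "\<rho>' = \<rho> + (4 * (\<kappa> * d)\<^sup>2 + 9 * \<rho>) / n"
  have \<rho>0: "0 \<le> \<rho>" using \<rho>(2) by (rule order_trans[rotated]) (auto intro: sum_nonneg)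
  define r where "r = 1 / sqrt n"
  have r2: "r\<^sup>2 = 1 / n" using n by (simp add: r_def power_divide)
  have r4: "r ^ 4 = 1 / n / n"
    using r2 by (simp add: power4_eq_xxxx power2_eq_square)
  define V where "V = (\<lambda>(i::nat) (x::nat \<Rightarrow> real) l. r * x l)"
  define \<nu> where "\<nu> = gauss_law d J a"
  note \<nu>M = gauss_law_moments[OF J, where d = d and a = a, folded \<nu>_def]
  note SP = centred_law_scale[OF P(1), where r = r]
  note S\<nu> = centred_law_scale[OF \<nu>M(1), where r = r]
  have vsV: "vsum {1..n} V x = (\<lambda>l. \<Sum>i=1..n. x i l / sqrt n)" for x
    by (simp add: vsum_def V_def r_def)
  have "\<bar>(\<integral>x. smooth_step (nsq d (vsum {1..n} V x) / lam - t) \<partial>PiM {1..n} (\<lambda>_. P))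
      - (\<integral>x. smooth_step (nsq d (vsum {1..n} V x) / lam - t) \<partial>PiM {1..n} (\<lambda>_. \<nu>))\<bar>
          \<le> lindeberg_error d lam \<tau> \<kappa> \<eta> \<rho>'"
    unfolding lindeberg_error_def
  proof (rule lindeberg[where s = "\<lambda>_ v. \<kappa> * nsq d v / n" and q = "\<lambda>_. \<rho>' / n" and e = "\<lambda>_. \<eta> / n"])
    show "centred_law d P (V i)" "centred_law d \<nu> (V i)" for i
      unfolding V_def by (rule SP S\<nu>)+
    show "integrable P (\<lambda>x. (nsq d (V i x))\<^sup>2)" "integrable \<nu> (\<lambda>x. (nsq d (V i x))\<^sup>2)" for i
      unfolding V_def by (rule SP(5) S\<nu>(5), rule P \<nu>M)+
    show "(\<integral>x. (ip d v (V i x))\<^sup>2 \<partial>P) \<le> \<kappa> * nsq d v / n" for i v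
      unfolding V_def SP r2 using up(1)[of v] n by (simp add: divide_right_mono)
    show "(\<integral>x. (ip d v (V i x))\<^sup>2 \<partial>\<nu>) \<le> \<kappa> * nsq d v / n" for i v
      unfolding V_def S\<nu> r2 \<nu>M using up(2)[of v] n by (simp add: divide_right_mono)
    show "(\<Sum>i=1..n. \<kappa> * nsq d v / n) \<le> \<kappa> * nsq d v" for v using n by simp
    show "(\<integral>x. (nsq d (V i x))\<^sup>2 \<partial>P) \<le> \<rho>' / n" for i
    proof -
      have "(\<integral>x. (nsq d (V i x))\<^sup>2 \<partial>P) \<le> 1 / n / n * (n * \<rho>)"
        unfolding V_def SP r4 by (intro mult_left_mono \<rho>) auto
      also have "\<dots> = \<rho> / n" using n by simp
      also have "\<dots> \<le> \<rho>' / n" using \<rho>0 by (intro divide_right_mono) (auto simp: \<rho>'_def)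
      finally show ?thesis .
    qed
    show "(\<integral>x. (nsq d (V i x))\<^sup>2 \<partial>\<nu>) \<le> \<rho>' / n" for i
    proof -
      have "(\<integral>x. (nsq d (V i x))\<^sup>2 \<partial>\<nu>) \<le> 1 / n / n * (4 * (\<kappa> * d)\<^sup>2 + 9 * \<rho>)"
        unfolding V_def S\<nu> r4
        by (intro mult_left_mono order_trans[OF \<nu>M(5)] add_mono power_mono sum_nsq_le up \<rho> sum_nonneg) auto
      also have "\<dots> \<le> \<rho>' / n" using \<rho>0 by (simp add: \<rho>'_def add_divide_distrib)
      finally show ?thesis .
    qed
    show "(\<Sum>i=1..n. \<rho>' / n) \<le> \<rho>'" using n by simp
    show "0 \<le> \<eta> / n" using nn by simp
    show "(\<Sum>i=1..n. \<eta> / n) \<le> \<eta>" using n by simp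
    show "\<bar>(\<integral>x. (ip d v (V i x))\<^sup>2 \<partial>P) - (\<integral>x. (ip d v (V i x))\<^sup>2 \<partial>\<nu>)\<bar>
        \<le> \<eta> / n * nsq d v" for i v
      unfolding V_def SP S\<nu> r2 \<nu>M using cov[of v] n
      by (simp add: diff_divide_distrib[symmetric] abs_divide divide_right_mono)
    show "\<bar>(\<integral>x. nsq d (V i x) \<partial>P) - (\<integral>x. nsq d (V i x) \<partial>\<nu>)\<bar> \<le> \<eta> / n * sqrt d" for i
      unfolding V_def SP S\<nu> r2 \<nu>M using tr n
      by (simp add: diff_divide_distrib[symmetric] abs_divide divide_right_mono)
  qed (use lam \<tau> nn in auto)
  moreover have "(\<integral>x. smooth_step (nsq d (vsum {1..n} V x) / lam - t) \<partial>PiM {1..n} (\<lambda>_. \<nu>))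
    = (\<integral>g. smooth_step (nsq d (gsum J a g) / lam - t) \<partial>gaussian J)"
  proof -
    let ?V = "PiM {..<d} (\<lambda>_. borel :: real measure)"
    define h where "h w = smooth_step (nsq d (\<lambda>l. w l / sqrt n) / lam - t)" for w
    have hm: "h \<in> borel_measurable ?V"
      unfolding h_def by (intro measurable_compose[OF _ smooth_step_measurable] borel_measurable_diff
        borel_measurable_divide nsq_measurable measurable_component_singleton) auto
    have hr: "h (\<lambda>l\<in>{..<d}. x l) = h x" for x
    proof -
      have "nsq d (\<lambda>l. (\<lambda>l\<in>{..<d}. x l) l / sqrt n) = nsq d (\<lambda>l. x l / sqrt n)"
        by (simp add: nsq_def)
      then show ?thesis by (simp add: h_def)
    qed
    have e1: "smooth_step (nsq d (vsum {1..n} V x) / lam - t) = h (\<lambda>l\<in>{..<d}. \<Sum>i=1..n. x i l)" for x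
      unfolding hr by (simp only: h_def vsV sum_divide_distrib)
    have e2: "smooth_step (nsq d (gsum J a g) / lam - t) = h (\<lambda>l\<in>{..<d}. sqrt (card {1..n}) * gsum J a g l)" for g
      unfolding hr using n by (simp add: h_def)
    have nnh: "0 \<le> h w" for w unfolding h_def using smooth_step_bounds by simp
    have m1: "(\<lambda>x. smooth_step (nsq d (vsum {1..n} V x) / lam - t)) \<in> borel_measurable (PiM {1..n} (\<lambda>_. \<nu>))"
      by (intro measurable_compose[OF _ smooth_step_measurable] borel_measurable_diff
        borel_measurable_divide nsq_measurable vsum_measurable[where d = d]) (auto simp: V_def intro: S\<nu>)
    have m2: "(\<lambda>g. smooth_step (nsq d (gsum J a g) / lam - t)) \<in> borel_measurable (gaussian J)"
      by (intro measurable_compose[OF _ smooth_step_measurable] borel_measurable_diff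
        borel_measurable_divide nsq_measurable gsum_measurable measurable_ident_sets[OF refl]) auto
    have "(\<integral>\<^sup>+x. ennreal (h (\<lambda>l\<in>{..<d}. \<Sum>i=1..n. x i l)) \<partial>PiM {1..n} (\<lambda>_. \<nu>))
      = (\<integral>\<^sup>+g. ennreal (h (\<lambda>l\<in>{..<d}. sqrt (card {1..n}) * gsum J a g l)) \<partial>gaussian J)"
      unfolding \<nu>_def using hm by (intro nn_integral_gauss_law_sum[OF J]) auto
    moreover have "(\<integral>x. smooth_step (nsq d (vsum {1..n} V x) / lam - t) \<partial>PiM {1..n} (\<lambda>_. \<nu>))
      = enn2real (\<integral>\<^sup>+x. ennreal (smooth_step (nsq d (vsum {1..n} V x) / lam - t)) \<partial>PiM {1..n} (\<lambda>_. \<nu>))"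
      using m1 by (rule integral_eq_nn_integral) (simp add: smooth_step_bounds)
    moreover have "(\<integral>g. smooth_step (nsq d (gsum J a g) / lam - t) \<partial>gaussian J)
      = enn2real (\<integral>\<^sup>+g. ennreal (smooth_step (nsq d (gsum J a g) / lam - t)) \<partial>gaussian J)"
      using m2 by (rule integral_eq_nn_integral) (simp add: smooth_step_bounds)
    ultimately show ?thesis unfolding e1 e2 by (simp only:)
  qed
  ultimately show ?thesis by (simp only: vsV \<rho>'_def)
qed

text \<open>
  Weights with mean \<open>0\<close> and variance \<open>1\<close> give summands \<open>w\<^sub>i a\<^sub>i\<close> with the same first two moments as \<open>g\<^sub>i a\<^sub>i\<close>,
  so there is no covariance mismatch.
\<close>

lemma boot_vs_gauss:
  fixes L :: "nat \<Rightarrow> real measure" and lam \<tau> t \<kappa> \<rho> K :: real and n d :: nat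
  assumes lam: "0 < lam" and \<tau>: "0 < \<tau>" "\<tau> \<le> 1" and nn: "0 \<le> \<kappa>" and K: "3 \<le> K"
    and L: "\<And>i. i \<in> {1..n} \<Longrightarrow> prob_space (L i) \<and> sets (L i) = sets borel \<and> integrable (L i) (\<lambda>r. r)
        \<and> (\<integral>r. r \<partial>L i) = 0
       \<and> integrable (L i) (\<lambda>r. r\<^sup>2) \<and> (\<integral>r. r\<^sup>2 \<partial>L i) = 1 \<and> integrable (L i) (\<lambda>r. r ^ 4)
           \<and> (\<integral>r. r ^ 4 \<partial>L i) \<le> K"
    and up: "\<And>v. (\<Sum>i=1..n. (ip d v (a i))\<^sup>2) \<le> \<kappa> * nsq d v"
    and \<rho>: "(\<Sum>i=1..n. (nsq d (a i))\<^sup>2) \<le> \<rho>"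
  shows "\<bar>(\<integral>w. smooth_step (nsq d (gsum {1..n} a w) / lam - t) \<partial>PiM {1..n} L)
      - (\<integral>g. smooth_step (nsq d (gsum {1..n} a g) / lam - t) \<partial>gaussian {1..n})\<bar>
          \<le> lindeberg_error d lam \<tau> \<kappa> 0 (K * \<rho>)"
proof -
  note W = centred_law_weight[where L = "L i" for i]
  have W1: "centred_law d (L i) (\<lambda>r l. r * a i l)" if "i \<in> {1..n}" for i
    using L[OF that] by (elim conjE) (rule W(1); assumption)
  have W2: "(\<integral>r. (ip d v (\<lambda>l. r * a i l))\<^sup>2 \<partial>L i) = (ip d v (a i))\<^sup>2" if "i \<in> {1..n}" for i v
    using L[OF that] by (elim conjE) (rule W(2); assumption)
  have W3: "(\<integral>r. nsq d (\<lambda>l. r * a i l) \<partial>L i) = nsq d (a i)" if "i \<in> {1..n}" for i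
    using L[OF that] by (elim conjE) (rule W(3); assumption)
  have W4: "integrable (L i) (\<lambda>r. (nsq d (\<lambda>l. r * a i l))\<^sup>2)" if "i \<in> {1..n}" for i
    using L[OF that] by (elim conjE) (rule W(4); assumption)
  have W5: "(\<integral>r. (nsq d (\<lambda>l. r * a i l))\<^sup>2 \<partial>L i) \<le> K * (nsq d (a i))\<^sup>2" if "i \<in> {1..n}" for i
  proof -
    have "(\<integral>r. (nsq d (\<lambda>l. r * a i l))\<^sup>2 \<partial>L i) = (\<integral>r. r ^ 4 \<partial>L i) * (nsq d (a i))\<^sup>2"
      using L[OF that] by (elim conjE) (rule W(5); assumption)
    moreover have "(\<integral>r. r ^ 4 \<partial>L i) * (nsq d (a i))\<^sup>2 \<le> K * (nsq d (a i))\<^sup>2"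
      using L[OF that] by (intro mult_right_mono) auto
    ultimately show ?thesis by simp
  qed
  show ?thesis
    unfolding lindeberg_error_def gaussian_def vsum_weight_eq_gsum[symmetric]
  proof (rule lindeberg[where s = "\<lambda>i v. (ip d v (a i))\<^sup>2" and q = "\<lambda>i. K * (nsq d (a i))\<^sup>2" and e = "\<lambda>_. 0"])
    show "(\<integral>r. (nsq d (\<lambda>l. r * a i l))\<^sup>2 \<partial>std_normal_distribution) \<le> K * (nsq d (a i))\<^sup>2" for i
      using K by (simp add: centred_law_stdn stdn_moments mult_right_mono)
    show "integrable std_normal_distribution (\<lambda>r. (nsq d (\<lambda>l. r * a i l))\<^sup>2)" for i
      by (rule centred_law_stdn(4)) (rule stdn_moments)
    show "(\<Sum>i=1..n. K * (nsq d (a i))\<^sup>2) \<le> K * \<rho>"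
      using \<rho> K by (simp add: sum_distrib_left[symmetric] mult_left_mono)
    show "centred_law d std_normal_distribution (\<lambda>r l. r * a i l)" for i
      by (rule centred_law_stdn(1))
    show "(\<integral>r. (ip d v (\<lambda>l. r * a i l))\<^sup>2 \<partial>std_normal_distribution) \<le> (ip d v (a i))\<^sup>2" for i v
      by (simp only: centred_law_stdn(2))
    show "(\<integral>r. (ip d v (\<lambda>l. r * a i l))\<^sup>2 \<partial>L i) \<le> (ip d v (a i))\<^sup>2" if "i \<in> {1..n}" for i v
      by (simp only: W2[OF that])
    show "\<bar>(\<integral>r. (ip d v (\<lambda>l. r * a i l))\<^sup>2 \<partial>L i)
        - (\<integral>r. (ip d v (\<lambda>l. r * a i l))\<^sup>2 \<partial>std_normal_distribution)\<bar> \<le> 0 * nsq d v"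
      if "i \<in> {1..n}" for i v
      unfolding W2[OF that] centred_law_stdn(2) by simp
    show "\<bar>(\<integral>r. nsq d (\<lambda>l. r * a i l) \<partial>L i)
        - (\<integral>r. nsq d (\<lambda>l. r * a i l) \<partial>std_normal_distribution)\<bar> \<le> 0 * sqrt d"
      if "i \<in> {1..n}" for i
      unfolding W3[OF that] centred_law_stdn(3) by simp
  qed (simp_all only: lam \<tau> nn up W1 W4 W5 order_refl sum.neutral_const)
qed


section \<open>From smooth test functions to tail probabilities\<close>

text \<open>
  The step of width \<open>3 lam\<close> ending at \<open>t\<close> dominates the indicator of \<open>[t, \<infinity>)\<close>, and the one starting at \<open>t\<close> is
  dominated by it. Only the reference variable \<open>Y\<close> pays for the transition zone.
\<close>

lemma smooth_to_tail:
  fixes X :: "'x \<Rightarrow> real" and Y :: "'y \<Rightarrow> real"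
  assumes "prob_space M1" "prob_space M2" and X: "X \<in> borel_measurable M1" and Y: "Y \<in> borel_measurable M2"
    and lam: "0 < lam"
    and err: "\<And>t. \<bar>(\<integral>x. smooth_step (X x / lam - t) \<partial>M1) - (\<integral>y. smooth_step (Y y / lam - t) \<partial>M2)\<bar>
        \<le> e"
    and conc: "\<And>t. measure M2 {y \<in> space M2. \<bar>Y y - t\<bar> \<le> 3 * lam} \<le> g"
  shows "\<bar>measure M1 {x \<in> space M1. t \<le> X x} - measure M2 {y \<in> space M2. t \<le> Y y}\<bar> \<le> e + g"
proof -
  interpret M1: prob_space M1 by fact
  interpret M2: prob_space M2 by fact
  note [measurable] = X Y
  have s: "0 \<le> smooth_step y" "smooth_step y \<le> 1" for y using smooth_step_bounds by auto
  have i1: "integrable M1 (\<lambda>x. smooth_step (X x / lam - t))" for t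
    by (rule M1.integrable_const_bound[of _ 1]) (auto simp: s)
  have i2: "integrable M2 (\<lambda>y. smooth_step (Y y / lam - t))" for t
    by (rule M2.integrable_const_bound[of _ 1]) (auto simp: s)
  define A where "A = {x \<in> space M1. t \<le> X x}"
  define B where "B = {y \<in> space M2. t \<le> Y y}"
  define D where "D = {y \<in> space M2. \<bar>Y y - t\<bar> \<le> 3 * lam}"
  have mA [measurable]: "A \<in> sets M1" and mB [measurable]: "B \<in> sets M2" and mD [measurable]: "D \<in> sets M2"
    unfolding A_def B_def D_def by measurable
  have iA: "integrable M1 (indicat_real A)" by (rule integrable_real_indicator) (auto simp: M1.emeasure_eq_measure)
  have iB: "integrable M2 (indicat_real B)" by (rule integrable_real_indicator) (auto simp: M2.emeasure_eq_measure)
  have iD: "integrable M2 (indicat_real D)" by (rule integrable_real_indicator) (auto simp: M2.emeasure_eq_measure)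
  have "measure M1 A = (\<integral>x. indicator A x \<partial>M1)" by simp
  also have "\<dots> \<le> (\<integral>x. smooth_step (X x / lam - (t / lam - 3)) \<partial>M1)"
  proof (rule integral_mono[OF iA i1])
    fix x show "indicat_real A x \<le> smooth_step (X x / lam - (t / lam - 3))"
    proof (cases "x \<in> A")
      case True
      then have "3 \<le> X x / lam - (t / lam - 3)" using lam by (simp add: A_def divide_right_mono)
      then show ?thesis using True by (simp add: smooth_step_eq_1)
    qed (simp add: s)
  qed
  also have "\<dots> \<le> (\<integral>y. smooth_step (Y y / lam - (t / lam - 3)) \<partial>M2) + e"
    using err[of "t / lam - 3"] by simp
  also have "(\<integral>y. smooth_step (Y y / lam - (t / lam - 3)) \<partial>M2) \<le> (\<integral>y. indicator B y + indicator D y \<partial>M2)"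
  proof (rule integral_mono[OF i2])
    fix y assume y: "y \<in> space M2"
    show "smooth_step (Y y / lam - (t / lam - 3)) \<le> indicat_real B y + indicator D y"
    proof (cases "y \<in> B \<or> y \<in> D")
      case False
      then have "Y y < t - 3 * lam" using y lam by (auto simp: B_def D_def)
      then have "Y y / lam \<le> (t - 3 * lam) / lam" using lam by (intro divide_right_mono) auto
      then have "Y y / lam - (t / lam - 3) \<le> 0" using lam by (simp add: diff_divide_distrib)
      then show ?thesis using False by (simp add: smooth_step_eq_0)
    next
      case True
      then have "1 \<le> indicat_real B y + indicator D y" by (auto simp: indicator_def)
      then show ?thesis using s(2) order_trans by blast
    qed
  qed (intro Bochner_Integration.integrable_add iB iD)
  also have "(\<integral>y. indicator B y + indicator D y \<partial>M2) = measure M2 B + measure M2 D"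
    by (subst Bochner_Integration.integral_add[OF iB iD]) simp
  finally have upper: "measure M1 A \<le> measure M2 B + measure M2 D + e" by simp
  have "measure M2 B = (\<integral>y. indicator B y \<partial>M2)" by simp
  also have "\<dots> \<le> (\<integral>y. smooth_step (Y y / lam - t / lam) + indicator D y \<partial>M2)"
  proof (rule integral_mono[OF iB])
    fix y assume y: "y \<in> space M2"
    show "indicat_real B y \<le> smooth_step (Y y / lam - t / lam) + indicator D y"
    proof (cases "y \<in> B \<and> y \<notin> D")
      case True
      then have "t + 3 * lam \<le> Y y" using y lam by (auto simp: B_def D_def)
      then have "(t + 3 * lam) / lam \<le> Y y / lam" using lam by (intro divide_right_mono) auto
      then have "3 \<le> Y y / lam - t / lam" using lam by (simp add: add_divide_distrib)
      then show ?thesis using True by (simp add: smooth_step_eq_1)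
    qed (auto simp: s indicator_def intro: add_nonneg_nonneg)
  qed (intro Bochner_Integration.integrable_add i2 iD)
  also have "\<dots> = (\<integral>y. smooth_step (Y y / lam - t / lam) \<partial>M2) + measure M2 D"
    by (subst Bochner_Integration.integral_add[OF i2 iD]) simp
  also have "(\<integral>y. smooth_step (Y y / lam - t / lam) \<partial>M2) \<le> (\<integral>x. smooth_step (X x / lam - t / lam) \<partial>M1) + e"
    using err[of "t / lam"] by simp
  also have "(\<integral>x. smooth_step (X x / lam - t / lam) \<partial>M1) \<le> (\<integral>x. indicator A x \<partial>M1)"
  proof (rule integral_mono[OF i1 iA])
    fix x assume x: "x \<in> space M1"
    show "smooth_step (X x / lam - t / lam) \<le> indicat_real A x"
    proof (cases "x \<in> A")
      case False
      then have "X x / lam \<le> t / lam" using x lam by (intro divide_right_mono) (auto simp: A_def)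
      then have "X x / lam - t / lam \<le> 0" by simp
      then show ?thesis using False by (simp only: smooth_step_eq_0) simp
    qed (simp add: s)
  qed
  finally have lower: "measure M2 B \<le> measure M1 A + e + measure M2 D" by simp
  have "measure M2 D \<le> g" unfolding D_def by (rule conc)
  then show ?thesis using upper lower unfolding A_def[symmetric] B_def[symmetric] by (simp add: abs_le_iff)
qed

section \<open>Fluctuation of the empirical covariance\<close>

lemma pnorm_2_sq: "(pnorm d 2 v)\<^sup>2 = nsq d v"
proof -
  have "(\<Sum>l<d. \<bar>v l\<bar> powr 2) = nsq d v"
    by (auto simp: nsq_def powr_numeral intro!: sum.cong)
  then show ?thesis by (simp add: pnorm_def powr_half_sqrt)
qed

lemma norm_moment_2_4: "norm_moment P d 2 4 = (\<integral>\<^sup>+z. ennreal ((nsq d z)\<^sup>2) \<partial>P)"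
proof -
  have "pnorm d 2 z powr 4 = (nsq d z)\<^sup>2" for z
  proof -
    have "0 \<le> pnorm d 2 z" by (simp add: pnorm_def)
    then have "pnorm d 2 z powr 4 = ((pnorm d 2 z)\<^sup>2)\<^sup>2"
      by (cases "pnorm d 2 z = 0") (simp_all add: powr_numeral)
    then show ?thesis by (simp add: pnorm_2_sq)
  qed
  then show ?thesis by (simp add: norm_moment_def)
qed

lemma vec_borel_component: "l < d \<Longrightarrow> (\<lambda>z. z l) \<in> borel_measurable (vec_borel d)"
  unfolding vec_borel_def by (intro measurable_component_singleton) auto

lemma centred_finite_cov_imp_centred_law:
  assumes "prob_space P" "sets P = sets (vec_borel d)" "centred_finite_cov P d"
  shows "centred_law d P (\<lambda>z. z)"
proof -
  have "(\<lambda>z. z l) \<in> borel_measurable P" if "l < d" for l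
    using vec_borel_component[OF that] by (simp add: measurable_cong_sets[OF assms(2) refl])
  moreover have "integrable P (nsq d)"
    unfolding nsq_def power2_eq_square using assms(3)
    by (intro Bochner_Integration.integrable_sum) (auto simp: centred_finite_cov_def)
  ultimately show ?thesis
    using assms by (simp add: centred_law_def centred_finite_cov_def)
qed

text \<open>
  The entries of the second moment matrix as a function of two indices, without reference to a matrix type.
\<close>

definition cov_entry :: "(nat \<Rightarrow> real) measure \<Rightarrow> nat \<Rightarrow> nat \<Rightarrow> real" where
  "cov_entry P k l = (\<integral>z. z k * z l \<partial>P)"

lemma second_moment_mat_eq: "second_moment_mat P d = mat d d (\<lambda>(k, l). cov_entry P k l)"
  by (simp add: second_moment_mat_def cov_entry_def)

lemma integral_ip_sq:
  assumes P: "centred_law d P (\<lambda>z. z)"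
  shows "(\<integral>z. (ip d v z)\<^sup>2 \<partial>P) = ip d v (mvec d (cov_entry P) v)"
proof -
  have e: "(ip d v z)\<^sup>2 = (\<Sum>k<d. \<Sum>l<d. v k * v l * (z k * z l))" for z
    unfolding ip_def power2_eq_square sum_product by (intro sum.cong refl) simp
  note I = centred_lawD(4)[OF P]
  have "(\<integral>z. (ip d v z)\<^sup>2 \<partial>P) = (\<Sum>k<d. \<Sum>l<d. v k * v l * cov_entry P k l)"
  proof -
    have "(\<integral>z. (ip d v z)\<^sup>2 \<partial>P) = (\<Sum>k<d. \<integral>z. (\<Sum>l<d. v k * v l * (z k * z l)) \<partial>P)"
      unfolding e using I
      by (intro Bochner_Integration.integral_sum Bochner_Integration.integrable_sum integrable_mult_right) auto
    also have "\<dots> = (\<Sum>k<d. \<Sum>l<d. \<integral>z. v k * v l * (z k * z l) \<partial>P)"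
      using I by (intro sum.cong refl Bochner_Integration.integral_sum integrable_mult_right) auto
    finally show ?thesis by (simp add: cov_entry_def)
  qed
  also have "\<dots> = ip d v (mvec d (cov_entry P) v)"
    by (simp add: ip_def mvec_def sum_distrib_left mult_ac)
  finally show ?thesis .
qed

lemma integral_nsq:
  assumes P: "centred_law d P (\<lambda>z. z)"
  shows "(\<integral>z. nsq d z \<partial>P) = (\<Sum>k<d. cov_entry P k k)"
  unfolding nsq_def cov_entry_def power2_eq_square
  using centred_lawD(4)[OF P] by (intro Bochner_Integration.integral_sum) auto

lemma quadratic_form_frobenius:
  "\<bar>ip d v (mvec d R v)\<bar> \<le> sqrt (\<Sum>k<d. \<Sum>l<d. (R k l)\<^sup>2) * nsq d v"
proof -
  have "nsq d (mvec d R v) \<le> (\<Sum>k<d. (\<Sum>l<d. (R k l)\<^sup>2) * nsq d v)"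
    unfolding mvec_def nsq_def by (intro sum_mono Cauchy_Schwarz_ineq_sum)
  then have "nsq d v * nsq d (mvec d R v) \<le> nsq d v * ((\<Sum>k<d. \<Sum>l<d. (R k l)\<^sup>2) * nsq d v)"
    by (intro mult_left_mono) (auto simp: sum_distrib_right)
  with ip_sq_le[of d v "mvec d R v"]
  have "(ip d v (mvec d R v))\<^sup>2 \<le> (\<Sum>k<d. \<Sum>l<d. (R k l)\<^sup>2) * (nsq d v)\<^sup>2"
    by (simp add: power2_eq_square[of "nsq d v"] mult_ac)
  then have "sqrt ((ip d v (mvec d R v))\<^sup>2) \<le> sqrt ((\<Sum>k<d. \<Sum>l<d. (R k l)\<^sup>2) * (nsq d v)\<^sup>2)"
    by (rule real_sqrt_le_mono)
  then show ?thesis by (simp add: real_sqrt_mult)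
qed

lemma trace_frobenius:
  fixes R :: "nat \<Rightarrow> nat \<Rightarrow> real" and d :: nat
  shows
  "\<bar>\<Sum>k<d. R k k\<bar> \<le> sqrt (\<Sum>k<d. \<Sum>l<d. (R k l)\<^sup>2) * sqrt d"
proof -
  have "(\<Sum>k<d. R k k * 1)\<^sup>2 \<le> (\<Sum>k<d. (R k k)\<^sup>2) * (\<Sum>k<d. 1\<^sup>2)" by (rule Cauchy_Schwarz_ineq_sum)
  also have "\<dots> \<le> (\<Sum>k<d. \<Sum>l<d. (R k l)\<^sup>2) * d"
    by (intro mult_mono sum_mono member_le_sum[where f = "\<lambda>l. (R _ l)\<^sup>2"]) (auto intro!: sum_nonneg)
  finally have "sqrt ((\<Sum>k<d. R k k)\<^sup>2) \<le> sqrt ((\<Sum>k<d. \<Sum>l<d. (R k l)\<^sup>2) * d)"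
    by (intro real_sqrt_le_mono) simp
  then show ?thesis by (simp add: real_sqrt_mult)
qed

definition scaled :: "nat \<Rightarrow> (nat \<Rightarrow> nat \<Rightarrow> real) \<Rightarrow> nat \<Rightarrow> nat \<Rightarrow> real" where
  "scaled n z = (\<lambda>i l. z i l / sqrt n)"

definition cov_dev :: "nat \<Rightarrow> (nat \<Rightarrow> real) measure \<Rightarrow> (nat \<Rightarrow> nat \<Rightarrow> real) \<Rightarrow> nat \<Rightarrow> nat \<Rightarrow> real" where
  "cov_dev n P z k l = (\<Sum>i=1..n. scaled n z i k * scaled n z i l) - cov_entry P k l"

text \<open>
  Measures how atypical a sample is: the squared Frobenius error of the empirical covariance plus the fourth moment
  term of the replacement bound.
\<close>

definition sample_dev :: "nat \<Rightarrow> nat \<Rightarrow> (nat \<Rightarrow> real) measure \<Rightarrow> (nat \<Rightarrow> nat \<Rightarrow> real) \<Rightarrow> real" where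
  "sample_dev n d P z = (\<Sum>k<d. \<Sum>l<d. (cov_dev n P z k l)\<^sup>2) + (\<Sum>i=1..n. (nsq d (scaled n z i))\<^sup>2)"

text \<open>
  Quadratic form and trace of a symmetric matrix are controlled by its Frobenius norm, by Cauchy--Schwarz.
\<close>

lemma sample_dev_bounds:
  assumes P: "centred_law d P (\<lambda>z. z)" and dev: "sample_dev n d P z \<le> s\<^sup>2" and s: "0 \<le> s"
  shows "\<bar>(\<integral>x. (ip d v x)\<^sup>2 \<partial>P) - (\<Sum>i=1..n. (ip d v (scaled n z i))\<^sup>2)\<bar> \<le> s * nsq d v"
    and "\<bar>(\<integral>x. nsq d x \<partial>P) - (\<Sum>i=1..n. nsq d (scaled n z i))\<bar> \<le> s * sqrt d"
    and "(\<Sum>i=1..n. (nsq d (scaled n z i))\<^sup>2) \<le> s\<^sup>2"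
proof -
  let ?F = "\<Sum>k<d. \<Sum>l<d. (cov_dev n P z k l)\<^sup>2"
  have nn: "0 \<le> ?F" "0 \<le> (\<Sum>i=1..n. (nsq d (scaled n z i))\<^sup>2)" by (auto intro!: sum_nonneg)
  then have "?F \<le> s\<^sup>2" using dev by (simp add: sample_dev_def)
  then have F: "sqrt ?F \<le> s" using s by (simp add: real_le_lsqrt)
  show "(\<Sum>i=1..n. (nsq d (scaled n z i))\<^sup>2) \<le> s\<^sup>2" using nn dev by (simp add: sample_dev_def)
  have "(\<Sum>i=1..n. (ip d v (scaled n z i))\<^sup>2) = (\<Sum>k<d. \<Sum>l<d. v k * v l * (\<Sum>i=1..n. scaled n z i k * scaled n z i l))"
  proof -
    have "(ip d v (scaled n z i))\<^sup>2 = (\<Sum>k<d. \<Sum>l<d. v k * v l * (scaled n z i k * scaled n z i l))" for i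
      unfolding ip_def power2_eq_square sum_product by (intro sum.cong refl) simp
    then have "(\<Sum>i=1..n. (ip d v (scaled n z i))\<^sup>2) = (\<Sum>i=1..n. \<Sum>k<d. \<Sum>l<d. v k * v l * (scaled n z i k * scaled n z i l))"
      by simp
    also have "\<dots> = (\<Sum>k<d. \<Sum>i=1..n. \<Sum>l<d. v k * v l * (scaled n z i k * scaled n z i l))"
      by (rule sum.swap)
    also have "\<dots> = (\<Sum>k<d. \<Sum>l<d. \<Sum>i=1..n. v k * v l * (scaled n z i k * scaled n z i l))"
      by (intro sum.cong refl sum.swap)
    finally show ?thesis by (simp add: sum_distrib_left)
  qed
  then have "(\<Sum>i=1..n. (ip d v (scaled n z i))\<^sup>2) - (\<integral>x. (ip d v x)\<^sup>2 \<partial>P) = ip d v (mvec d (cov_dev n P z) v)"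
    unfolding integral_ip_sq[OF P]
    by (simp add: ip_def mvec_def cov_dev_def sum_distrib_left sum_subtractf[symmetric] algebra_simps)
  then have "\<bar>(\<integral>x. (ip d v x)\<^sup>2 \<partial>P) - (\<Sum>i=1..n. (ip d v (scaled n z i))\<^sup>2)\<bar>
      = \<bar>ip d v (mvec d (cov_dev n P z) v)\<bar>"
    by (simp add: abs_minus_commute)
  also have "\<dots> \<le> sqrt ?F * nsq d v" by (rule quadratic_form_frobenius)
  also have "\<dots> \<le> s * nsq d v" using F by (rule mult_right_mono) simp
  finally show "\<bar>(\<integral>x. (ip d v x)\<^sup>2 \<partial>P) - (\<Sum>i=1..n. (ip d v (scaled n z i))\<^sup>2)\<bar> \<le> s * nsq d v" .
  have "(\<Sum>i=1..n. nsq d (scaled n z i)) = (\<Sum>k<d. \<Sum>i=1..n. scaled n z i k * scaled n z i k)"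
    unfolding nsq_def power2_eq_square by (rule sum.swap)
  then have "(\<Sum>i=1..n. nsq d (scaled n z i)) - (\<integral>x. nsq d x \<partial>P) = (\<Sum>k<d. cov_dev n P z k k)"
    unfolding integral_nsq[OF P] by (simp add: cov_dev_def sum_subtractf)
  then have "\<bar>(\<integral>x. nsq d x \<partial>P) - (\<Sum>i=1..n. nsq d (scaled n z i))\<bar> = \<bar>\<Sum>k<d. cov_dev n P z k k\<bar>"
    by (simp add: abs_minus_commute)
  also have "\<dots> \<le> sqrt ?F * sqrt d" by (rule trace_frobenius)
  also have "\<dots> \<le> s * sqrt d" using F by (rule mult_right_mono) simp
  finally show "\<bar>(\<integral>x. nsq d x \<partial>P) - (\<Sum>i=1..n. nsq d (scaled n z i))\<bar> \<le> s * sqrt d" .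
qed

lemma sample_component_measurable:
  assumes P: "centred_law d P (\<lambda>z. z)" and i: "i \<in> I" and l: "l < d"
  shows "(\<lambda>z. z i l) \<in> borel_measurable (PiM I (\<lambda>_. P))"
  by (intro measurable_compose[OF measurable_component_singleton[OF i] centred_lawD(2)[OF P l]])

lemma sample_dev_measurable:
  assumes P: "centred_law d P (\<lambda>z. z)"
  shows "sample_dev n d P \<in> borel_measurable (PiM {1..n} (\<lambda>_. P))"
  unfolding sample_dev_def cov_dev_def scaled_def
  by (intro borel_measurable_add borel_measurable_sum borel_measurable_power borel_measurable_diff
      borel_measurable_times borel_measurable_divide nsq_measurable borel_measurable_const
      sample_component_measurable[OF P]) auto

text \<open>
  An entry of the empirical covariance is a mean of \<open>n\<close> independent variables \<open>x k * x l\<close>, so its variance is at most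
  \<open>E (x k * x l)\<^sup>2 / n\<close>. The sum of these over \<open>k\<close> and \<open>l\<close> is \<open>E \<parallel>x\<parallel>\<^sup>4 / n\<close>, and the second part of the
  deviation has exactly that mean.
\<close>

lemma expectation_sample_dev:
  assumes n: "1 \<le> n" and P: "centred_law d P (\<lambda>z. z)" and i4: "integrable P (\<lambda>z. (nsq d z)\<^sup>2)"
  shows "(\<integral>\<^sup>+z. ennreal (sample_dev n d P z) \<partial>PiM {1..n} (\<lambda>_. P))
      \<le> ennreal (2 * ((\<integral>z. (nsq d z)\<^sup>2 \<partial>P) / n))"
proof -
  interpret P: prob_space P using P by (simp add: centred_law_def)
  define r where "r = (\<integral>z. (nsq d z)\<^sup>2 \<partial>P) / n"
  let ?M = "PiM {1..n} (\<lambda>_. P)"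
  have cm: "(\<lambda>x. x l) \<in> borel_measurable P" if "l < d" for l
    using centred_lawD(2)[OF P that] .
  have prod_le: "(x k * x l)\<^sup>2 \<le> (nsq d x)\<^sup>2" if "k < d" "l < d" for x k l
    unfolding power_mult_distrib power2_eq_square[of "nsq d x"]
    using that by (intro mult_mono component_sq_le_nsq) auto
  have i2: "integrable P (\<lambda>x. (x k * x l)\<^sup>2)" if "k < d" "l < d" for k l
    by (rule Bochner_Integration.integrable_bound[OF i4])
      (use that cm prod_le in \<open>auto intro!: borel_measurable_power borel_measurable_times\<close>)
  have i1: "integrable P (\<lambda>x. x k * x l)" if "k < d" "l < d" for k l
    using centred_lawD(4)[OF P that] .
  have ent: "(\<integral>\<^sup>+z. ennreal ((cov_dev n P z k l)\<^sup>2) \<partial>?M)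
      \<le> ennreal ((\<integral>x. (x k * x l)\<^sup>2 \<partial>P) / n)"
    if kl: "k < d" "l < d" for k l
  proof -
    \<comment> \<open>the entry error as a sum of independent vectors of dimension \<open>1\<close>\<close>
    define V where "V = (\<lambda>(i::nat) (x::nat \<Rightarrow> real) (_::nat). (x k * x l - cov_entry P k l) / n)"
    have nV: "nsq 1 (V i x) = (x k * x l - cov_entry P k l)\<^sup>2 / (real n)\<^sup>2" for i x
      by (simp add: nsq_def V_def power_divide)
    have isq: "integrable P (\<lambda>x. (x k * x l - cov_entry P k l)\<^sup>2)"
      unfolding power2_diff using i1[OF kl] i2[OF kl] by simp
    have VL: "centred_law 1 P (V i)" for i
    proof -
      have "integrable P (\<lambda>x. nsq 1 (V i x))" unfolding nV using isq by simp
      moreover have "(\<lambda>x. V i x l') \<in> borel_measurable P" for l'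
        unfolding V_def using cm kl by (intro borel_measurable_divide borel_measurable_diff borel_measurable_times) auto
      moreover have "(\<integral>x. V i x l' \<partial>P) = 0" for l'
        using i1[OF kl] P.prob_space by (simp add: V_def cov_entry_def)
      ultimately show ?thesis unfolding centred_law_def using P.prob_space_axioms by blast
    qed
    have "cov_dev n P z k l = (\<Sum>i=1..n. V i (z i) 0)" for z
      using n by (simp add: cov_dev_def V_def scaled_def sum_divide_distrib[symmetric] sum_subtractf diff_divide_distrib)
    then have "(\<integral>\<^sup>+z. ennreal ((cov_dev n P z k l)\<^sup>2) \<partial>?M)
        = (\<integral>\<^sup>+z. ennreal (nsq 1 (vsum {1..n} V z)) \<partial>?M)"
      by (simp add: nsq_def vsum_def)
    also have "\<dots> = ennreal (\<Sum>i=1..n. \<integral>x. nsq 1 (V i x) \<partial>P)"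
      using VL by (intro vsum_second_moment) auto
    also have "(\<Sum>i=1..n. \<integral>x. nsq 1 (V i x) \<partial>P) = (\<integral>x. (x k * x l - cov_entry P k l)\<^sup>2 \<partial>P) / n"
      unfolding nV using n by (simp add: power2_eq_square)
    also have "(\<integral>x. (x k * x l - cov_entry P k l)\<^sup>2 \<partial>P) \<le> (\<integral>x. (x k * x l)\<^sup>2 \<partial>P)"
      using P.variance_eq[OF i1[OF kl] i2[OF kl]] by (simp add: cov_entry_def)
    finally show ?thesis by (simp add: divide_right_mono ennreal_leI)
  qed
  have comp: "(\<integral>\<^sup>+z. ennreal ((nsq d (scaled n z i))\<^sup>2) \<partial>?M) = ennreal (r / n)" if i: "i \<in> {1..n}" for i
  proof -
    have "(nsq d (scaled n z i))\<^sup>2 = (nsq d (z i))\<^sup>2 / (real n)\<^sup>2" for z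
      using nsq_scale[of d "1 / sqrt n" "z i"] n by (simp add: scaled_def power_divide)
    then have "(\<integral>\<^sup>+z. ennreal ((nsq d (scaled n z i))\<^sup>2) \<partial>?M)
        = (\<integral>\<^sup>+z. ennreal ((nsq d (z i))\<^sup>2 / (real n)\<^sup>2) \<partial>?M)"
      by simp
    also have "\<dots> = (\<integral>\<^sup>+x. ennreal ((nsq d x)\<^sup>2 / (real n)\<^sup>2) \<partial>distr ?M P (\<lambda>z. z i))"
    proof (rule nn_integral_distr[symmetric])
      show "(\<lambda>z. z i) \<in> measurable ?M P" by (rule measurable_component_singleton) (rule i)
      show "(\<lambda>x. ennreal ((nsq d x)\<^sup>2 / (real n)\<^sup>2)) \<in> borel_measurable (distr ?M P (\<lambda>z. z i))"
        using cm nsq_measurable[of d "\<lambda>x. x" P] by simp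
    qed
    also have "distr ?M P (\<lambda>z. z i) = P"
      by (rule distr_PiM_component) (rule P.prob_space_axioms, rule i)
    also have "(\<integral>\<^sup>+x. ennreal ((nsq d x)\<^sup>2 / (real n)\<^sup>2) \<partial>P) = ennreal (r / n)"
      using i4 by (subst nn_integral_eq_integral) (auto simp: r_def power2_eq_square[of "real n"])
    finally show ?thesis .
  qed
  have m1: "(\<lambda>z. ennreal ((cov_dev n P z k l)\<^sup>2)) \<in> borel_measurable ?M" if "k < d" "l < d" for k l
    unfolding cov_dev_def scaled_def using that
    by (intro measurable_compose[OF _ measurable_ennreal] borel_measurable_sum borel_measurable_power borel_measurable_diff
      borel_measurable_times borel_measurable_divide borel_measurable_const sample_component_measurable[OF P]) auto
  have m2: "(\<lambda>z. ennreal ((nsq d (scaled n z i))\<^sup>2)) \<in> borel_measurable ?M" if "i \<in> {1..n}" for i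
    unfolding scaled_def using that
    by (intro measurable_compose[OF _ measurable_ennreal] borel_measurable_power nsq_measurable
      borel_measurable_divide borel_measurable_const sample_component_measurable[OF P]) auto
  have split: "ennreal (sample_dev n d P z) = (\<Sum>k<d. \<Sum>l<d. ennreal ((cov_dev n P z k l)\<^sup>2))
      + (\<Sum>i=1..n. ennreal ((nsq d (scaled n z i))\<^sup>2))" for z
    unfolding sample_dev_def by (subst ennreal_plus) (simp_all add: sum_nonneg sum_ennreal)
  have "(\<integral>\<^sup>+z. ennreal (sample_dev n d P z) \<partial>?M)
      = (\<Sum>k<d. \<Sum>l<d. \<integral>\<^sup>+z. ennreal ((cov_dev n P z k l)\<^sup>2) \<partial>?M)
    + (\<Sum>i=1..n. \<integral>\<^sup>+z. ennreal ((nsq d (scaled n z i))\<^sup>2) \<partial>?M)"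
  proof -
    have a: "(\<lambda>z. \<Sum>l<d. ennreal ((cov_dev n P z k l)\<^sup>2)) \<in> borel_measurable ?M" if "k < d" for k
      by (intro borel_measurable_sum m1 that) simp
    have b: "(\<lambda>z. \<Sum>k<d. \<Sum>l<d. ennreal ((cov_dev n P z k l)\<^sup>2)) \<in> borel_measurable ?M"
      by (intro borel_measurable_sum a) simp
    have c: "(\<lambda>z. \<Sum>i=1..n. ennreal ((nsq d (scaled n z i))\<^sup>2)) \<in> borel_measurable ?M"
      by (intro borel_measurable_sum m2)
    have "(\<integral>\<^sup>+z. (\<Sum>k<d. \<Sum>l<d. ennreal ((cov_dev n P z k l)\<^sup>2)) \<partial>?M)
        = (\<Sum>k<d. \<integral>\<^sup>+z. (\<Sum>l<d. ennreal ((cov_dev n P z k l)\<^sup>2)) \<partial>?M)"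
      by (rule nn_integral_sum) (rule a, simp)
    also have "\<dots> = (\<Sum>k<d. \<Sum>l<d. \<integral>\<^sup>+z. ennreal ((cov_dev n P z k l)\<^sup>2) \<partial>?M)"
      by (intro sum.cong refl nn_integral_sum m1; simp)
    finally show ?thesis
      unfolding split nn_integral_add[OF b c] using nn_integral_sum[of "{1..n}", OF m2] by (simp only:)
  qed
  also have "\<dots> \<le> (\<Sum>k<d. \<Sum>l<d. ennreal ((\<integral>x. (x k * x l)\<^sup>2 \<partial>P) / n)) + (\<Sum>i=1..n. ennreal (r / n))"
    using ent comp by (intro add_mono sum_mono) auto
  also have "\<dots> = ennreal ((\<Sum>k<d. \<Sum>l<d. (\<integral>x. (x k * x l)\<^sup>2 \<partial>P) / n) + (\<Sum>i=1..n. r / n))"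
  proof -
    have "0 \<le> r" by (simp add: r_def)
    then show ?thesis
      by (subst ennreal_plus) (simp_all add: sum_nonneg sum_ennreal del: sum_constant)
  qed
  also have "(\<Sum>k<d. \<Sum>l<d. (\<integral>x. (x k * x l)\<^sup>2 \<partial>P) / n) = r"
  proof -
    have "(nsq d x)\<^sup>2 = (\<Sum>k<d. \<Sum>l<d. (x k * x l)\<^sup>2)" for x
      unfolding nsq_def power2_eq_square[of "sum _ _"] sum_product power_mult_distrib ..
    then have "(\<integral>x. (nsq d x)\<^sup>2 \<partial>P) = (\<integral>x. (\<Sum>k<d. \<Sum>l<d. (x k * x l)\<^sup>2) \<partial>P)" by simp
    also have "\<dots> = (\<Sum>k<d. \<integral>x. (\<Sum>l<d. (x k * x l)\<^sup>2) \<partial>P)"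
      using i2 by (intro Bochner_Integration.integral_sum Bochner_Integration.integrable_sum) auto
    also have "\<dots> = (\<Sum>k<d. \<Sum>l<d. \<integral>x. (x k * x l)\<^sup>2 \<partial>P)"
      using i2 by (intro sum.cong refl Bochner_Integration.integral_sum) auto
    finally show ?thesis by (simp only: r_def sum_divide_distrib)
  qed
  also have "(\<Sum>i=1..n. r / n) = r" using n by simp
  finally show ?thesis by (simp add: r_def)
qed

lemma sample_dev_markov:
  assumes n: "1 \<le> n" and P: "centred_law d P (\<lambda>z. z)" and i4: "integrable P (\<lambda>z. (nsq d z)\<^sup>2)" and \<rho>: "0 < \<rho>"
  shows "measure (PiM {1..n} (\<lambda>_. P)) {z \<in> space (PiM {1..n} (\<lambda>_. P)). \<rho> \<le> sample_dev n d P z}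
    \<le> 2 * ((\<integral>z. (nsq d z)\<^sup>2 \<partial>P) / n) / \<rho>"
proof -
  let ?M = "PiM {1..n} (\<lambda>_. P)"
  interpret M: prob_space ?M using P by (intro prob_space_PiM) (simp add: centred_law_def)
  have m: "sample_dev n d P \<in> borel_measurable ?M" by (rule sample_dev_measurable[OF P])
  have "emeasure ?M {z \<in> space ?M. \<rho> \<le> sample_dev n d P z}
    = emeasure ?M {z \<in> space ?M. 1 \<le> ennreal (1 / \<rho>) * ennreal (sample_dev n d P z)}"
  proof -
    have "\<rho> \<le> sample_dev n d P z \<longleftrightarrow> 1 \<le> ennreal (1 / \<rho>) * ennreal (sample_dev n d P z)" for z
    proof -
      have "0 \<le> sample_dev n d P z" by (auto simp: sample_dev_def intro!: add_nonneg_nonneg sum_nonneg)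
      then show ?thesis using \<rho>
        by (simp add: ennreal_mult[symmetric] ennreal_1[symmetric] field_simps del: ennreal_1)
    qed
    then show ?thesis by simp
  qed
  also have "\<dots> \<le> ennreal (1 / \<rho>) * (\<integral>\<^sup>+z. ennreal (sample_dev n d P z) * indicator (space ?M) z \<partial>?M)"
    using m by (intro nn_integral_Markov_inequality) auto
  also have "\<dots> = ennreal (1 / \<rho>) * (\<integral>\<^sup>+z. ennreal (sample_dev n d P z) \<partial>?M)"
    by (intro arg_cong2[where f = "(*)"] refl nn_integral_cong) simp
  also have "\<dots> \<le> ennreal (1 / \<rho>) * ennreal (2 * ((\<integral>z. (nsq d z)\<^sup>2 \<partial>P) / n))"
    by (intro mult_left_mono expectation_sample_dev[OF n P i4]) simp
  also have "\<dots> = ennreal (2 * ((\<integral>z. (nsq d z)\<^sup>2 \<partial>P) / n) / \<rho>)"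
    using \<rho> by (subst ennreal_mult[symmetric]) (auto intro!: divide_nonneg_nonneg mult_nonneg_nonneg)
  finally have "ennreal (measure ?M {z \<in> space ?M. \<rho> \<le> sample_dev n d P z})
      \<le> ennreal (2 * ((\<integral>z. (nsq d z)\<^sup>2 \<partial>P) / n) / \<rho>)"
    by (simp only: M.emeasure_eq_measure)
  moreover have "0 \<le> 2 * ((\<integral>z. (nsq d z)\<^sup>2 \<partial>P) / n) / \<rho>"
    using \<rho> by (intro divide_nonneg_nonneg mult_nonneg_nonneg) auto
  ultimately show ?thesis by (simp only: ennreal_le_iff)
qed


section \<open>Comparison of the tails for a good sample\<close>

text \<open>
  At scale \<open>lam = \<delta> \<surd>d\<close> all powers of the dimension cancel.
\<close>

lemma lindeberg_error_le:
  assumes d: "1 \<le> d" and \<delta>: "0 < \<delta>" "\<delta> \<le> 1" and \<tau>: "0 < \<tau>" and nn: "0 \<le> \<kappa>" "0 \<le> \<eta>" "0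
      \<le> \<rho>"
  shows "lindeberg_error d (\<delta> * sqrt d) \<tau> \<kappa> \<eta> \<rho> \<le> (\<eta> * (1 + 2 * \<kappa>) + 112 * \<tau> * \<kappa>\<^sup>2
      + (448 * (4 * \<kappa>\<^sup>2 + 3 * \<rho>) + 28) / \<tau> * \<rho>) / \<delta> ^ 4"
proof -
  have d0: "0 < real d" and sd: "0 < sqrt d" using d by auto
  have inv: "1 \<le> 1 / \<delta>" using \<delta> by simp
  have p: "1 / \<delta> \<le> 1 / \<delta> ^ 4" "1 / \<delta>\<^sup>2 \<le> 1 / \<delta> ^ 4"
    using power_increasing[OF _ inv, of 1 4] power_increasing[OF _ inv, of 2 4] by (simp_all add: power_divide)
  have sq: "(sqrt d) ^ 4 = (real d)\<^sup>2"
    using power_mult[of "sqrt d" 2 2] by simp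
  have l2: "(\<delta> * sqrt d)\<^sup>2 = \<delta>\<^sup>2 * d" and l4: "(\<delta> * sqrt d) ^ 4 = \<delta> ^ 4 * (real d)\<^sup>2"
    by (simp_all add: power_mult_distrib sq)
  have a: "sqrt d / (\<delta> * sqrt d) = 1 / \<delta>" using sd by simp
  have b: "2 * \<kappa> * d / (\<delta> * sqrt d)\<^sup>2 = 2 * \<kappa> * (1 / \<delta>\<^sup>2)" unfolding l2 using d0 by simp
  have c: "112 * \<tau> * \<kappa> / (\<delta> * sqrt d)\<^sup>2 * (\<kappa> * d) = 112 * \<tau> * \<kappa>\<^sup>2 * (1 / \<delta>\<^sup>2)"
    unfolding l2 using d0 by (simp add: power2_eq_square)
  have e: "448 * (4 * (\<kappa> * d)\<^sup>2 + 3 * \<rho>) / (\<delta> * sqrt d) ^ 4 \<le> 448 * (4 * \<kappa>\<^sup>2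
      + 3 * \<rho>) * (1 / \<delta> ^ 4)"
  proof -
    have "\<rho> \<le> \<rho> * (real d)\<^sup>2" using d nn by (simp add: mult_le_cancel_left1 one_le_power)
    then have "448 * (4 * (\<kappa> * d)\<^sup>2 + 3 * \<rho>) \<le> 448 * (4 * \<kappa>\<^sup>2 + 3 * \<rho>) * (real d)\<^sup>2"
      by (simp add: power_mult_distrib algebra_simps)
    then have "448 * (4 * (\<kappa> * d)\<^sup>2 + 3 * \<rho>) / (\<delta> ^ 4 * (real d)\<^sup>2) \<le> 448 * (4 * \<kappa>\<^sup>2
        + 3 * \<rho>) * (real d)\<^sup>2 / (\<delta> ^ 4 * (real d)\<^sup>2)"
      using \<delta> by (intro divide_right_mono) auto
    then show ?thesis unfolding l4 using d0 by simp
  qed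
  have f: "28 / (\<delta> * sqrt d)\<^sup>2 \<le> 28 * (1 / \<delta> ^ 4)"
  proof -
    have "28 / (\<delta>\<^sup>2 * d) \<le> 28 / \<delta>\<^sup>2" using d \<delta> by (intro divide_left_mono) auto
    then show ?thesis unfolding l2 using p by simp
  qed
  have "lindeberg_error d (\<delta> * sqrt d) \<tau> \<kappa> \<eta> \<rho> \<le> \<eta> * (1 / \<delta> ^ 4 + 2 * \<kappa> * (1 / \<delta> ^ 4))
      + 112 * \<tau> * \<kappa>\<^sup>2 * (1 / \<delta> ^ 4)
     + (448 * (4 * \<kappa>\<^sup>2 + 3 * \<rho>) * (1 / \<delta> ^ 4) + 28 * (1 / \<delta> ^ 4)) / \<tau> * \<rho>"
    unfolding lindeberg_error_def a b c using p e f nn \<tau>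
    by (intro add_mono mult_left_mono mult_right_mono divide_right_mono) auto
  also have "\<dots> = (\<eta> * (1 + 2 * \<kappa>) + 112 * \<tau> * \<kappa>\<^sup>2 + (448 * (4 * \<kappa>\<^sup>2 + 3 * \<rho>)
      + 28) / \<tau> * \<rho>) / \<delta> ^ 4"
    using \<delta> \<tau> by (simp add: field_simps)
  finally show ?thesis .
qed

lemma fourth_moment_bound:
  fixes L :: "real measure"
  assumes "prob_space L" and S: "sets L = sets borel" and q: "4 \<le> q" and Cw: "0 \<le> Cw"
    and m: "(\<integral>\<^sup>+r. ennreal (\<bar>r\<bar> powr q) \<partial>L) \<le> ennreal Cw"
  shows "integrable L (\<lambda>r. r ^ 4)" "(\<integral>r. r ^ 4 \<partial>L) \<le> 1 + Cw"
proof -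
  interpret prob_space L by fact
  have le: "r ^ 4 \<le> 1 + \<bar>r\<bar> powr q" for r :: real
  proof (cases "\<bar>r\<bar> \<le> 1")
    case True
    then have "\<bar>r\<bar> ^ 4 \<le> 1" by (intro power_le_one) auto
    then show ?thesis by (simp add: add_increasing2)
  next
    case False
    then have "\<bar>r\<bar> powr 4 \<le> \<bar>r\<bar> powr q" using q by (intro powr_mono) auto
    then have "\<bar>r\<bar> ^ 4 \<le> \<bar>r\<bar> powr q" using False by (simp add: powr_numeral)
    then show ?thesis by simp
  qed
  have bm: "(\<lambda>r. r ^ 4) \<in> borel_measurable L" "(\<lambda>r. \<bar>r\<bar> powr q) \<in> borel_measurable L"
    unfolding measurable_cong_sets[OF S refl] by measurable
  have "(\<integral>\<^sup>+r. ennreal (r ^ 4) \<partial>L) \<le> (\<integral>\<^sup>+r. ennreal 1 + ennreal (\<bar>r\<bar> powr q) \<partial>L)"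
    using le by (intro nn_integral_mono) (simp add: ennreal_plus[symmetric] ennreal_leI del: ennreal_plus ennreal_1)
  also have "\<dots> = 1 + (\<integral>\<^sup>+r. ennreal (\<bar>r\<bar> powr q) \<partial>L)"
    using bm by (subst nn_integral_add) (auto simp: emeasure_space_1)
  also have "\<dots> \<le> ennreal (1 + Cw)"
    using m Cw by (simp add: ennreal_plus add_left_mono)
  finally have f: "(\<integral>\<^sup>+r. ennreal (r ^ 4) \<partial>L) \<le> ennreal (1 + Cw)" .
  show i: "integrable L (\<lambda>r. r ^ 4)"
    using bm f by (intro integrableI_bounded) (auto intro: le_less_trans)
  have "ennreal (\<integral>r. r ^ 4 \<partial>L) \<le> ennreal (1 + Cw)"
    using f i by (subst nn_integral_eq_integral[symmetric]) auto
  then show "(\<integral>r. r ^ 4 \<partial>L) \<le> 1 + Cw" using Cw by (subst (asm) ennreal_le_iff) auto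
qed

text \<open>
  Independence identifies the law of the weights with the product of its marginals, and the moment of order \<open>q\<close>
  bounds their fourth moments.
\<close>

lemma weights_product_law:
  assumes Q: "prob_space Q" "sets Q = sets (weight_borel n)" and n: "1 \<le> n"
    and W: "standardized_independent_weights Q n" and q: "4 \<le> q" and Cw: "0 \<le> Cw"
    and m: "\<And>i. i \<in> {1..n} \<Longrightarrow> (\<integral>\<^sup>+w. ennreal (\<bar>w i\<bar> powr q) \<partial>Q) \<le> ennreal Cw"
  defines "L \<equiv> \<lambda>i. distr Q borel (\<lambda>w. w i)"
  shows "Q = PiM {1..n} L"
    and "\<And>i. i \<in> {1..n} \<Longrightarrow> prob_space (L i) \<and> sets (L i) = sets borel \<and> integrable (L i) (\<lambda>r. r)
        \<and> (\<integral>r. r \<partial>L i) = 0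
       \<and> integrable (L i) (\<lambda>r. r\<^sup>2) \<and> (\<integral>r. r\<^sup>2 \<partial>L i) = 1 \<and> integrable (L i) (\<lambda>r. r ^ 4)
           \<and> (\<integral>r. r ^ 4 \<partial>L i) \<le> max 3 (1 + Cw)"
proof -
  interpret Q: prob_space Q by fact
  let ?B = "PiM {1..n} (\<lambda>_. borel :: real measure)"
  have sQ: "sets Q = sets ?B" using Q(2) by (simp add: weight_borel_def)
  have cm: "(\<lambda>w. w i) \<in> borel_measurable Q" if "i \<in> {1..n}" for i
    unfolding measurable_cong_sets[OF sQ refl] using that by (rule measurable_component_singleton)
  have "distr Q ?B (\<lambda>w. \<lambda>i\<in>{1..n}. w i) = PiM {1..n} L"
    unfolding L_def
    using W n cm by (subst Q.indep_vars_iff_distr_eq_PiM'[symmetric]) (auto simp: standardized_independent_weights_def)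
  moreover have "distr Q ?B (\<lambda>w. \<lambda>i\<in>{1..n}. w i) = distr Q ?B (\<lambda>w. w)"
  proof (rule distr_cong[OF refl refl])
    fix w assume "w \<in> space Q"
    then have "w \<in> extensional {1..n}" using sets_eq_imp_space_eq[OF sQ] by (auto simp: space_PiM PiE_def)
    then show "(\<lambda>i\<in>{1..n}. w i) = w" by (rule extensional_restrict)
  qed
  moreover have "distr Q ?B (\<lambda>w. w) = Q"
    using sQ by (intro distr_id2) simp
  ultimately show "Q = PiM {1..n} L" by simp
  fix i assume i: "i \<in> {1..n}"
  have PL: "prob_space (L i)" unfolding L_def by (rule Q.prob_space_distr[OF cm[OF i]])
  have w: "integrable Q (\<lambda>w. w i)" "(\<integral>w. w i \<partial>Q)
      = 0" "integrable Q (\<lambda>w. (w i)\<^sup>2)" "(\<integral>w. (w i)\<^sup>2 \<partial>Q) = 1"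
    using W i by (auto simp: standardized_independent_weights_def)
  have "(\<integral>\<^sup>+r. ennreal (\<bar>r\<bar> powr q) \<partial>L i) = (\<integral>\<^sup>+w. ennreal (\<bar>w i\<bar> powr q) \<partial>Q)"
    unfolding L_def by (rule nn_integral_distr[OF cm[OF i]]) simp
  then have f: "integrable (L i) (\<lambda>r. r ^ 4)" "(\<integral>r. r ^ 4 \<partial>L i) \<le> 1 + Cw"
    using m[OF i] by (intro fourth_moment_bound[OF PL _ q Cw]; simp add: L_def)+
  have "integrable (L i) (\<lambda>r. r)" "integrable (L i) (\<lambda>r. r\<^sup>2)"
    unfolding L_def by (subst integrable_distr_eq[OF cm[OF i]]; simp add: w)+
  moreover have "(\<integral>r. r \<partial>L i) = 0" "(\<integral>r. r\<^sup>2 \<partial>L i) = 1"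
    unfolding L_def by (subst integral_distr[OF cm[OF i]]; simp add: w)+
  ultimately show "prob_space (L i) \<and> sets (L i) = sets borel \<and> integrable (L i) (\<lambda>r. r) \<and> (\<integral>r. r \<partial>L i) = 0
       \<and> integrable (L i) (\<lambda>r. r\<^sup>2) \<and> (\<integral>r. r\<^sup>2 \<partial>L i) = 1 \<and> integrable (L i) (\<lambda>r. r ^ 4)
           \<and> (\<integral>r. r ^ 4 \<partial>L i) \<le> max 3 (1 + Cw)"
    using PL f by (simp add: L_def)
qed

text \<open>
  Both tails are compared with that of the Gaussian vector built from the sample. The tolerance \<open>s\<close> plays three
  parts: it bounds the Frobenius error, its square bounds the fourth moments, and it serves as the parameter \<open>\<tau>\<close> of the
  replacement bound, which makes all contributions linear in \<open>s\<close>. As \<open>s \<le> c / 2\<close>, the empirical covariance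
  keeps the lower bound \<open>c / 2\<close> that anti-concentration needs.
\<close>

lemma tail_comparison_good_sample:
  fixes P :: "(nat \<Rightarrow> real) measure" and Q :: "(nat \<Rightarrow> real) measure"
    and c C \<delta> s q Cw :: real and n d :: nat
  assumes n: "1 \<le> n" and d: "1 \<le> d"
    and P: "centred_law d P (\<lambda>z. z)" "integrable P (\<lambda>z. (nsq d z)\<^sup>2)"
    and low: "\<And>v. c * nsq d v \<le> (\<integral>x. (ip d v x)\<^sup>2 \<partial>P)"
        and upp: "\<And>v. (\<integral>x. (ip d v x)\<^sup>2 \<partial>P) \<le> C * nsq d v"
    and c: "0 < c" "c \<le> C"
    and Q: "prob_space Q" "sets Q = sets (weight_borel n)"
    and W: "standardized_independent_weights Q n" and q: "4 \<le> q" and Cw: "0 \<le> Cw"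
    and wq: "\<And>i. i \<in> {1..n} \<Longrightarrow> (\<integral>\<^sup>+w. ennreal (\<bar>w i\<bar> powr q) \<partial>Q) \<le> ennreal Cw"
    and \<delta>: "0 < \<delta>" "\<delta> \<le> 1" and s: "0 < s" "s \<le> 1" "s \<le> c / 2"
    and dev: "sample_dev n d P z \<le> s\<^sup>2"
    and r4: "(\<integral>x. (nsq d x)\<^sup>2 \<partial>P) \<le> n * s\<^sup>2"
    and dn: "4 * ((C + 1) * d)\<^sup>2 / n \<le> s\<^sup>2"
  defines "\<kappa> \<equiv> C + 1" and "K \<equiv> max 3 (1 + Cw)"
  shows "\<bar>measure Q {w \<in> space Q. t \<le> nsq d (gsum {1..n} (scaled n z) w)}
       - measure (PiM {1..n} (\<lambda>_. P)) {x \<in> space (PiM {1..n} (\<lambda>_. P)). t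
           \<le> nsq d (\<lambda>l. \<Sum>i=1..n. x i l / sqrt n)}\<bar>
     \<le> 2 * small_ball_bound (c / 2) (3 * \<delta>) + s * ((1 + 2 * \<kappa>) + 224 * \<kappa>\<^sup>2 + 11 * (448 * (4 * \<kappa>\<^sup>2 + 33)
         + 28) + K * (448 * (4 * \<kappa>\<^sup>2 + 3 * K) + 28)) / \<delta> ^ 4"
proof -
  let ?a = "scaled n z" and ?J = "{1..n}"
  let ?M = "PiM {1..n} (\<lambda>_. P)" and ?\<Gamma> = "gaussian {1..n}"
  define lam where "lam = \<delta> * sqrt d"
  have lam: "0 < lam" using \<delta> d by (simp add: lam_def)
  note dv = sample_dev_bounds[OF P(1) dev less_imp_le[OF s(1)]]
  have s2: "s\<^sup>2 \<le> 1" using s by (intro power_le_one) auto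
  have \<kappa>: "0 \<le> \<kappa>" using c by (simp add: \<kappa>_def)
  have K: "3 \<le> K" by (simp add: K_def)
  have up1: "(\<integral>x. (ip d v x)\<^sup>2 \<partial>P) \<le> \<kappa> * nsq d v" for v
    using upp[of v] by (simp add: \<kappa>_def distrib_right add_increasing2)
  have up2: "(\<Sum>i\<in>?J. (ip d v (?a i))\<^sup>2) \<le> \<kappa> * nsq d v" for v
  proof -
    have "s * nsq d v \<le> 1 * nsq d v" using s by (intro mult_right_mono) auto
    then show ?thesis using dv(1)[of v] upp[of v] by (simp add: \<kappa>_def distrib_right abs_le_iff)
  qed
  have low2: "c / 2 * nsq d v \<le> (\<Sum>i\<in>?J. (ip d v (?a i))\<^sup>2)" for v
  proof -
    have "s * nsq d v \<le> c / 2 * nsq d v" using s by (intro mult_right_mono) auto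
    then show ?thesis using dv(1)[of v] low[of v] by (simp add: abs_le_iff)
  qed
  define L where "L = (\<lambda>i. distr Q borel (\<lambda>w. w i))"
  have QL: "Q = PiM {1..n} L"
    unfolding L_def by (rule weights_product_law(1)[OF Q n W q Cw wq])
  have LM: "prob_space (L i) \<and> sets (L i) = sets borel \<and> integrable (L i) (\<lambda>r. r) \<and> (\<integral>r. r \<partial>L i) = 0
       \<and> integrable (L i) (\<lambda>r. r\<^sup>2) \<and> (\<integral>r. r\<^sup>2 \<partial>L i) = 1 \<and> integrable (L i) (\<lambda>r. r ^ 4)
           \<and> (\<integral>r. r ^ 4 \<partial>L i) \<le> K"
    if "i \<in> {1..n}" for i
    unfolding L_def K_def by (rule weights_product_law(2)[OF Q n W q Cw wq that])
  interpret Q: prob_space Q by fact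
  interpret M: prob_space ?M using P by (intro prob_space_PiM) (simp add: centred_law_def)
  have conc: "measure ?\<Gamma> {g \<in> space ?\<Gamma>. \<bar>nsq d (gsum ?J ?a g) - t\<bar> \<le> 3 * lam}
      \<le> small_ball_bound (c / 2) (3 * \<delta>)" for t
    using gaussian_anticoncentration[OF _ _ low2 d, where \<delta> = "3 * \<delta>" and t = t] c \<delta> by (simp add: lam_def mult.assoc)
  have mg: "(\<lambda>g. nsq d (gsum ?J ?a g)) \<in> borel_measurable ?\<Gamma>"
    by (intro nsq_measurable gsum_measurable measurable_ident_sets[OF refl])
  have mQ: "(\<lambda>w. nsq d (gsum ?J ?a w)) \<in> borel_measurable Q"
  proof -
    have sQ: "sets Q = sets (gaussian ?J)" using Q(2) by (simp add: weight_borel_def sets_gaussian)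
    show ?thesis unfolding measurable_cong_sets[OF sQ refl] by (rule mg)
  qed
  have mM: "(\<lambda>x. nsq d (\<lambda>l. \<Sum>i=1..n. x i l / sqrt n)) \<in> borel_measurable ?M"
    by (intro nsq_measurable borel_measurable_sum borel_measurable_divide borel_measurable_const
        sample_component_measurable[OF P(1)]) auto
  define e1 where "e1 = lindeberg_error d lam s \<kappa> s (s\<^sup>2 + (4 * (\<kappa> * d)\<^sup>2 + 9 * s\<^sup>2) / n)"
  define e2 where "e2 = lindeberg_error d lam s \<kappa> 0 (K * s\<^sup>2)"
  have data: "\<bar>measure ?M {x \<in> space ?M. t \<le> nsq d (\<lambda>l. \<Sum>i=1..n. x i l / sqrt n)}
      - measure ?\<Gamma> {g \<in> space ?\<Gamma>. t \<le> nsq d (gsum ?J ?a g)}\<bar> \<le> e1 + small_ball_bound (c / 2) (3 * \<delta>)"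
  proof (rule smooth_to_tail[OF M.prob_space_axioms prob_space_gaussian mM mg lam _ conc])
    show "\<bar>(\<integral>x. smooth_step (nsq d (\<lambda>l. \<Sum>i=1..n. x i l / sqrt n) / lam - t) \<partial>?M)
      - (\<integral>g. smooth_step (nsq d (gsum ?J ?a g) / lam - t) \<partial>?\<Gamma>)\<bar> \<le> e1" for t
      unfolding e1_def
      by (rule data_vs_gauss[OF n lam s(1,2) _ P \<kappa> less_imp_le[OF s(1)] up1 up2 dv(1,2) r4 dv(3)]) simp
  qed
  have boot: "\<bar>measure Q {w \<in> space Q. t \<le> nsq d (gsum ?J ?a w)}
      - measure ?\<Gamma> {g \<in> space ?\<Gamma>. t \<le> nsq d (gsum ?J ?a g)}\<bar> \<le> e2 + small_ball_bound (c / 2) (3 * \<delta>)"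
  proof (rule smooth_to_tail[OF Q.prob_space_axioms prob_space_gaussian mQ mg lam _ conc])
    show "\<bar>(\<integral>w. smooth_step (nsq d (gsum ?J ?a w) / lam - t) \<partial>Q)
      - (\<integral>g. smooth_step (nsq d (gsum ?J ?a g) / lam - t) \<partial>?\<Gamma>)\<bar> \<le> e2" for t
      unfolding e2_def using boot_vs_gauss[where L = L, OF lam s(1,2) \<kappa> K LM up2 dv(3), where t = t]
      unfolding QL[symmetric] .
  qed
  have e1: "e1 \<le> s * ((1 + 2 * \<kappa>) + 112 * \<kappa>\<^sup>2 + 11 * (448 * (4 * \<kappa>\<^sup>2 + 33) + 28)) / \<delta> ^ 4"
  proof -
    define \<rho> where "\<rho> = s\<^sup>2 + (4 * (\<kappa> * d)\<^sup>2 + 9 * s\<^sup>2) / n"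
    have "9 * s\<^sup>2 / n \<le> 9 * s\<^sup>2 / 1" using n by (intro divide_left_mono) auto
    then have \<rho>: "\<rho> \<le> 11 * s\<^sup>2" "0 \<le> \<rho>" using dn by (auto simp: \<rho>_def \<kappa>_def add_divide_distrib)
    then have \<rho>11: "\<rho> \<le> 11" using s2 by simp
    have "(448 * (4 * \<kappa>\<^sup>2 + 3 * \<rho>) + 28) / s * \<rho> \<le> (448 * (4 * \<kappa>\<^sup>2 + 33) + 28) / s * (11 * s\<^sup>2)"
      using \<rho> \<rho>11 s by (intro mult_mono divide_right_mono add_mono mult_left_mono) auto
    also have "\<dots> = s * (11 * (448 * (4 * \<kappa>\<^sup>2 + 33) + 28))"
      using s by (simp add: power2_eq_square)
    finally have "s * (1 + 2 * \<kappa>) + 112 * s * \<kappa>\<^sup>2 + (448 * (4 * \<kappa>\<^sup>2 + 3 * \<rho>) + 28) / s * \<rho>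
      \<le> s * ((1 + 2 * \<kappa>) + 112 * \<kappa>\<^sup>2 + 11 * (448 * (4 * \<kappa>\<^sup>2 + 33) + 28))"
      by (simp add: algebra_simps)
    then show ?thesis
      using lindeberg_error_le[OF d \<delta> s(1) \<kappa> less_imp_le[OF s(1)] \<rho>(2)] \<delta>
      unfolding e1_def lam_def \<rho>_def[symmetric]
      by (meson divide_right_mono less_imp_le order_trans zero_less_power)
  qed
  have e2: "e2 \<le> s * (112 * \<kappa>\<^sup>2 + K * (448 * (4 * \<kappa>\<^sup>2 + 3 * K) + 28)) / \<delta> ^ 4"
  proof -
    have \<rho>: "0 \<le> K * s\<^sup>2" "K * s\<^sup>2 \<le> K" using K s2 by (auto simp: mult_left_le)
    have "(448 * (4 * \<kappa>\<^sup>2 + 3 * (K * s\<^sup>2)) + 28) / s * (K * s\<^sup>2) \<le> (448 * (4 * \<kappa>\<^sup>2 + 3 * K)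
        + 28) / s * (K * s\<^sup>2)"
      using \<rho> s K by (intro mult_mono divide_right_mono add_mono mult_left_mono) auto
    also have "\<dots> = s * (K * (448 * (4 * \<kappa>\<^sup>2 + 3 * K) + 28))"
      using s by (simp add: power2_eq_square)
    finally have "0 * (1 + 2 * \<kappa>) + 112 * s * \<kappa>\<^sup>2 + (448 * (4 * \<kappa>\<^sup>2 + 3 * (K * s\<^sup>2))
        + 28) / s * (K * s\<^sup>2)
      \<le> s * (112 * \<kappa>\<^sup>2 + K * (448 * (4 * \<kappa>\<^sup>2 + 3 * K) + 28))"
      by (simp add: algebra_simps)
    then show ?thesis
      using lindeberg_error_le[OF d \<delta> s(1) \<kappa> order_refl \<rho>(1)] \<delta>
      unfolding e2_def lam_def
      by (meson divide_right_mono less_imp_le order_trans zero_less_power)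
  qed
  have "e1 + e2 \<le> s * ((1 + 2 * \<kappa>) + 112 * \<kappa>\<^sup>2 + 11 * (448 * (4 * \<kappa>\<^sup>2 + 33) + 28)) / \<delta> ^ 4
     + s * (112 * \<kappa>\<^sup>2 + K * (448 * (4 * \<kappa>\<^sup>2 + 3 * K) + 28)) / \<delta> ^ 4"
    using e1 e2 by (rule add_mono)
  also have "\<dots> = s * ((1 + 2 * \<kappa>) + 224 * \<kappa>\<^sup>2 + 11 * (448 * (4 * \<kappa>\<^sup>2 + 33) + 28)
      + K * (448 * (4 * \<kappa>\<^sup>2 + 3 * K) + 28)) / \<delta> ^ 4"
    by (simp add: add_divide_distrib[symmetric] algebra_simps)
  finally show ?thesis using data boot by linarith
qed

section \<open>Measurability of the supremum over thresholds\<close>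

lemma SUP_right_continuous_eq_SUP_Rats:
  fixes g :: "real \<Rightarrow> real"
  assumes rc: "\<And>s. (g \<longlongrightarrow> g s) (at_right s)" and B: "\<And>s. g s \<le> B"
  shows "(SUP s. g s) = (SUP s\<in>\<rat>. g s)"
proof (rule antisym)
  have bd: "bdd_above (g ` A)" for A by (rule bdd_aboveI2[where M = B]) (rule B)
  show "(SUP s. g s) \<le> (SUP s\<in>\<rat>. g s)"
  proof (rule cSUP_least)
    fix s
    show "g s \<le> (SUP s\<in>\<rat>. g s)"
    proof (rule ccontr)
      assume "\<not> g s \<le> (SUP s\<in>\<rat>. g s)"
      then have "eventually (\<lambda>x. (SUP s\<in>\<rat>. g s) < g x) (at_right s)"
        by (intro order_tendstoD(1)[OF rc]) simp
      then obtain b where b: "s < b" "\<And>y. s < y \<Longrightarrow> y < b \<Longrightarrow> (SUP s\<in>\<rat>. g s) < g y"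
        unfolding eventually_at_right_field by blast
      obtain r where r: "r \<in> \<rat>" "s < r" "r < b" using Rats_dense_in_real[OF b(1)] by blast
      have "g r \<le> (SUP s\<in>\<rat>. g s)" by (rule cSUP_upper[OF r(1) bd])
      then show False using b(2)[OF r(2,3)] by simp
    qed
  qed simp
  have "(\<rat> :: real set) \<noteq> {}" using Rats_0 by blast
  then show "(SUP s\<in>\<rat>. g s) \<le> (SUP s. g s)"
    by (rule cSUP_least) (rule cSUP_upper[OF UNIV_I bd])
qed

text \<open>
  The reflected tail is the distribution function of \<open>- Y\<close>.
\<close>

lemma tail_right_continuous:
  fixes Y :: "'w \<Rightarrow> real"
  assumes Q: "prob_space Q" and Y: "Y \<in> borel_measurable Q"
  shows "((\<lambda>s. measure Q {w \<in> space Q. - s \<le> Y w}) \<longlongrightarrow> measure Q {w \<in> space Q. - s \<le> Y w}) (at_right s)"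
proof -
  interpret Q: prob_space Q by fact
  have m: "(\<lambda>w. - Y w) \<in> borel_measurable Q" using Y by (rule borel_measurable_uminus)
  let ?D = "distr Q borel (\<lambda>w. - Y w)"
  interpret D: prob_space ?D by (rule Q.prob_space_distr[OF m])
  interpret D: finite_borel_measure ?D by standard simp
  have "measure Q {w \<in> space Q. - s \<le> Y w} = cdf ?D s" for s
  proof -
    have "cdf ?D s = measure Q ((\<lambda>w. - Y w) -` {..s} \<inter> space Q)"
      unfolding cdf_def by (rule measure_distr[OF m]) simp
    also have "(\<lambda>w. - Y w) -` {..s} \<inter> space Q = {w \<in> space Q. - s \<le> Y w}" by auto
    finally show ?thesis ..
  qed
  then show ?thesis using D.cdf_is_right_cont[of s] by (simp add: continuous_within)
qed

text \<open>
  One-sided continuity in the threshold reduces the supremum to the countably many rational thresholds.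
\<close>

lemma SUP_tail_difference_measurable:
  fixes Y :: "'z \<Rightarrow> 'w \<Rightarrow> real" and Y' :: "'m \<Rightarrow> real"
  assumes X: "X \<in> measurable M N" and \<K>: "\<K> \<in> measurable N (prob_algebra W)"
    and Y: "case_prod Y \<in> borel_measurable (N \<Otimes>\<^sub>M W)"
    and M': "prob_space M'" "Y' \<in> borel_measurable M'"
  shows "(\<lambda>x. SUP t. \<bar>measure (\<K> (X x)) {w \<in> space W. t \<le> Y (X x) w} - measure M' {y \<in> space M'. t
      \<le> Y' y}\<bar>) \<in> borel_measurable M"
proof -
  define g where "g x s = \<bar>measure (\<K> (X x)) {w \<in> space W. - s \<le> Y (X x) w} - measure M' {y \<in> space M'. - s
      \<le> Y' y}\<bar>" for x s
  interpret M': prob_space M' by fact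
  have KX: "prob_space (\<K> (X x))" "sets (\<K> (X x)) = sets W" if "x \<in> space M" for x
  proof -
    have "\<K> (X x) \<in> space (prob_algebra W)"
      using measurable_space[OF \<K> measurable_space[OF X that]] .
    then show "prob_space (\<K> (X x))" "sets (\<K> (X x)) = sets W"
      by (auto simp: space_prob_algebra)
  qed
  have YX: "Y (X x) \<in> borel_measurable (\<K> (X x))" if x: "x \<in> space M" for x
  proof -
    have "Y (X x) \<in> borel_measurable W"
      using measurable_compose[OF measurable_Pair1'[OF measurable_space[OF X x]] Y] by simp
    then show ?thesis by (simp add: measurable_cong_sets[OF KX(2)[OF x] refl])
  qed
  have gB: "g x s \<le> 1" if x: "x \<in> space M" for x s
  proof -
    have "\<bar>a - b\<bar> \<le> 1" if "0 \<le> a" "a \<le> 1" "0 \<le> b" "b \<le> 1" for a b :: real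
      using that by linarith
    then show ?thesis
      unfolding g_def by (simp add: prob_space.prob_le_1[OF KX(1)[OF x]])
  qed
  have eq: "(SUP t. \<bar>measure (\<K> (X x)) {w \<in> space W. t \<le> Y (X x) w} - measure M' {y \<in> space M'. t \<le> Y' y}\<bar>)
      = (SUP s\<in>\<rat>. g x s)"
    if x: "x \<in> space M" for x
  proof -
    have sp: "space W = space (\<K> (X x))" using sets_eq_imp_space_eq[OF KX(2)[OF x]] by simp
    have "(g x \<longlongrightarrow> g x s) (at_right s)" for s
      unfolding g_def sp
      by (intro tendsto_rabs tendsto_diff tail_right_continuous KX(1) YX x M')
    then have "(SUP s. g x s) = (SUP s\<in>\<rat>. g x s)"
      by (rule SUP_right_continuous_eq_SUP_Rats) (rule gB[OF x])
    moreover have "range (\<lambda>t. \<bar>measure (\<K> (X x)) {w \<in> space W. t \<le> Y (X x) w} - measure M' {y \<in> space M'. t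
        \<le> Y' y}\<bar>) = range (g x)"
      (is "range ?f = _")
    proof -
      have "?f t = g x (- t)" for t by (simp add: g_def)
      then have "?f = g x \<circ> uminus" by (simp add: fun_eq_iff)
      then have "range ?f = g x ` range uminus" by (simp only: image_comp)
      then show ?thesis by (simp add: surj_uminus)
    qed
    ultimately show ?thesis by simp
  qed
  have gm: "(\<lambda>x. g x s) \<in> borel_measurable M" for s
  proof -
    have "Sigma (space N) (\<lambda>z. {w \<in> space W. - s \<le> Y z w}) = {p \<in> space (N \<Otimes>\<^sub>M W). - s \<le> case_prod Y p}"
      by (auto simp: space_pair_measure)
    also have "\<dots> \<in> sets (N \<Otimes>\<^sub>M W)" using Y by simp
    finally have "(\<lambda>z. measure (\<K> z) {w \<in> space W. - s \<le> Y z w}) \<in> borel_measurable N"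
      by (rule measure_measurable_prob_algebra2[OF _ \<K>])
    from measurable_compose[OF X this] show ?thesis
      unfolding g_def by (intro borel_measurable_abs borel_measurable_diff borel_measurable_const)
  qed
  have "(\<lambda>x. SUP s\<in>\<rat>. g x s) \<in> borel_measurable M"
    by (intro borel_measurable_cSUP countable_rat gm bdd_aboveI2[where M = 1] gB)
  then show ?thesis by (subst measurable_cong[OF eq])
qed


section \<open>Bootstrap consistency for the squared norm of the mean\<close>

theorem theorem3p1:
  fixes d :: "nat \<Rightarrow> nat"
    and M :: "nat \<Rightarrow> 'a measure"
    and P :: "nat \<Rightarrow> (nat \<Rightarrow> real) measure"
    and Z :: "nat \<Rightarrow> nat \<Rightarrow> 'a \<Rightarrow> nat \<Rightarrow> real"
    and Zn :: "nat \<Rightarrow> 'a \<Rightarrow> nat \<Rightarrow> nat \<Rightarrow> real"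
    and \<omega> :: "nat \<Rightarrow> nat \<Rightarrow> 'a \<Rightarrow> real"
    and Pstar :: "nat \<Rightarrow> (nat \<Rightarrow> nat \<Rightarrow> real) \<Rightarrow> (nat \<Rightarrow> real) measure"
    and c C \<gamma> \<kappa> q Cw :: real
  defines Zn_def: "Zn \<equiv> \<lambda>n x. \<lambda>i\<in>{1..n}. Z n i x"
  assumes d_pos: "\<And>n. n \<ge> 1 \<Longrightarrow> d n \<ge> 1"
    and d_mono: "mono_on {1..} d"
    and prob: "\<And>n. n \<ge> 1 \<Longrightarrow> prob_space (M n)"
    and Z_indep: "\<And>n. n \<ge> 1 \<Longrightarrow>
      prob_space.indep_vars (M n) (\<lambda>_. vec_borel (d n)) (Z n) {1..n}"
    and Z_law: "\<And>n i. n \<ge> 1 \<Longrightarrow> i \<in> {1..n} \<Longrightarrow> distr (M n) (vec_borel (d n)) (Z n i) = P n"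
    and Z_centred: "\<And>n. n \<ge> 1 \<Longrightarrow> centred_finite_cov (P n) (d n)"
    and Z_posdef: "\<And>n. n \<ge> 1 \<Longrightarrow> positive_definite (d n) (second_moment_mat (P n) (d n))"
    and weights_law: "\<And>n. n \<ge> 1 \<Longrightarrow>
      regular_cond_law (M n) (data_borel n (d n)) (Zn n)
        (weight_borel n) (\<lambda>x. \<lambda>i\<in>{1..n}. \<omega> n i x) (Pstar n)"
    and Z_i_const: "0 < c" "c \<le> C"
    and Z_i_eigenvalues: "\<And>n e. n \<ge> 1 \<Longrightarrow>
      eigenvalue (second_moment_mat (P n) (d n)) e \<Longrightarrow> c \<le> e \<and> e \<le> C"
    and Z_i_rate: "(\<lambda>n.
      max (max (of_nat (d n) * (norm_moment (P n) (d n) 2 3)\<^sup>2) (norm_moment (P n) (d n) 2 4))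
          (of_nat (d n) ^ 4) / of_nat n) \<longlonglongrightarrow> (0 :: ennreal)"
    and Z_ii_gamma: "\<gamma> > 0"
    and Z_ii_rate: "(\<lambda>n. ennreal (real (d n) powr (2 + \<gamma>) / real n powr \<gamma>) *
      norm_moment (P n) (d n) 2 (4 + 2 * \<gamma>)) \<longlonglongrightarrow> 0"
    and Z_iii_kappa: "\<kappa> \<ge> 0"
    and Z_iii_rate: "(\<lambda>n.
      ennreal (rpow (ln (real (d n))) (\<kappa> / 2) * real (d n) powr (2 + \<kappa>) / real n powr (1 + \<kappa> / 2)) *
      norm_moment (P n) (d n) (2 + \<kappa>) (2 * (2 + \<kappa>))) \<longlonglongrightarrow> 0"
    and W_i: "\<And>n. n \<ge> 1 \<Longrightarrow>
      AE x in M n. standardized_independent_weights (Pstar n (Zn n x)) n"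
    and W_ii_const: "q \<ge> max (\<gamma> + 2) 4" "Cw > 0"
    and W_ii: "\<And>n. n \<ge> 1 \<Longrightarrow>
      AE x in M n. \<forall>i\<in>{1..n}.
        (\<integral>\<^sup>+ w. ennreal (\<bar>w i\<bar> powr q) \<partial>(Pstar n (Zn n x))) \<le> ennreal Cw"
  shows "small_o_prob M (\<lambda>n x.
    SUP t::real.
      \<bar>measure (Pstar n (Zn n x))
         {w \<in> space (weight_borel n).
            (pnorm (d n) 2 (\<lambda>l. sqrt (real n) * boot_mean n w (Zn n x) l))\<^sup>2 \<ge> t} -
       measure (M n)
         {y \<in> space (M n).
            (pnorm (d n) 2 (\<lambda>l. sqrt (real n) * sample_mean n (Zn n y) l))\<^sup>2 \<ge> t}\<bar>)"
proof -
  define A where "A = (1 + 2 * (C + 1)) + 224 * (C + 1)\<^sup>2 + 11 * (448 * (4 * (C + 1)\<^sup>2 + 33) + 28)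
    + max 3 (1 + Cw) * (448 * (4 * (C + 1)\<^sup>2 + 3 * max 3 (1 + Cw)) + 28)"
  have C0: "0 < C" using Z_i_const by simp
  have A0: "0 < A" unfolding A_def using C0 W_ii_const
    by (intro add_pos_nonneg mult_nonneg_nonneg add_nonneg_nonneg) auto
  have q4: "4 \<le> q" using W_ii_const by simp
  have rate4: "(\<lambda>n. norm_moment (P n) (d n) 2 4 / of_nat n) \<longlonglongrightarrow> 0"
    by (rule tendsto_sandwich[OF _ _ tendsto_const Z_i_rate]) (auto intro!: always_eventually divide_right_mono_ennreal simp: le_max_iff_disj)
  have rated: "(\<lambda>n. of_nat (d n) ^ 4 / of_nat n :: ennreal) \<longlonglongrightarrow> 0"
    by (rule tendsto_sandwich[OF _ _ tendsto_const Z_i_rate]) (auto intro!: always_eventually divide_right_mono_ennreal simp: le_max_iff_disj)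
  define Y where "Y n z w = nsq (d n) (gsum {1..n} (scaled n z) w)" for n z w
  define S where "S n z = nsq (d n) (\<lambda>l. \<Sum>i=1..n. z i l / sqrt n)" for n and z :: "nat \<Rightarrow> nat \<Rightarrow> real"
  have root: "sqrt (real n) * (a / real n) = a / sqrt (real n)" for n a
  proof -
    have "sqrt (real n) * (a / real n) = a * (sqrt (real n) / real n)" by simp
    also have "sqrt (real n) / real n = inverse (sqrt (real n))" by (rule sqrt_divide_self_eq) simp
    finally show ?thesis by (simp only: divide_inverse)
  qed
  have Yeq: "(pnorm (d n) 2 (\<lambda>l. sqrt (real n) * boot_mean n w z l))\<^sup>2 = Y n z w" for n w z
  proof -
    have "(\<lambda>l. sqrt (real n) * boot_mean n w z l) = gsum {1..n} (scaled n z) w"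
      unfolding boot_mean_def root by (simp add: gsum_def scaled_def fun_eq_iff sum_divide_distrib)
    then show ?thesis by (simp only: pnorm_2_sq Y_def)
  qed
  have Seq: "(pnorm (d n) 2 (\<lambda>l. sqrt (real n) * sample_mean n z l))\<^sup>2 = S n z" for n z
  proof -
    have "(\<lambda>l. sqrt (real n) * sample_mean n z l) = (\<lambda>l. \<Sum>i=1..n. z i l / sqrt n)"
      unfolding sample_mean_def root by (simp add: fun_eq_iff sum_divide_distrib)
    then show ?thesis by (simp only: pnorm_2_sq S_def)
  qed
  define f where "f n x = (SUP t::real. \<bar>measure (Pstar n (Zn n x)) {w \<in> space (weight_borel n). t \<le> Y n (Zn n x) w}
     - measure (M n) {y \<in> space (M n). t \<le> S n (Zn n y)}\<bar>)" for n x
  have "small_o_prob M f"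
    unfolding small_o_prob_def
  proof (intro allI impI)
    fix \<epsilon> :: real assume \<epsilon>: "0 < \<epsilon>"
    have "0 < c / 2" "0 < \<epsilon> / 8" using Z_i_const \<epsilon> by auto
    then obtain \<delta>0 where \<delta>0: "0 < \<delta>0" "\<delta>0 \<le> 1" "small_ball_bound (c / 2) \<delta>0 < \<epsilon> / 8"
      by (rule small_ball_bound_vanishes)
    \<comment> \<open>the smooth step has width \<open>3\<close>\<close>
    define \<delta> where "\<delta> = \<delta>0 / 3"
    have \<delta>: "0 < \<delta>" "\<delta> \<le> 1" and conc: "small_ball_bound (c / 2) (3 * \<delta>) < \<epsilon> / 8"
      using \<delta>0 by (auto simp: \<delta>_def)
    \<comment> \<open>the last bound makes the replacement error at most \<open>\<epsilon> / 4\<close>\<close>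
    define s where "s = min 1 (min (c / 2) (\<epsilon> / 4 * \<delta> ^ 4 / A))"
    have s: "0 < s" "s \<le> 1" "s \<le> c / 2" using Z_i_const \<epsilon> \<delta> A0 by (auto simp: s_def)
    have sA: "s * A / \<delta> ^ 4 \<le> \<epsilon> / 4"
    proof -
      have "s \<le> \<epsilon> / 4 * \<delta> ^ 4 / A" by (simp add: s_def)
      then have "s * A \<le> \<epsilon> / 4 * \<delta> ^ 4" using A0 by (simp add: pos_le_divide_eq)
      then show ?thesis using \<delta> by (simp add: pos_divide_le_eq)
    qed
    \<comment> \<open>\<open>\<theta>\<close> bounds \<open>E \<parallel>Z\<parallel>\<^sup>4 / n\<close>, both for the replacement error and for Markov's inequality\<close>
    define \<theta> where "\<theta> = min (s\<^sup>2) (s\<^sup>2 * \<epsilon> / 4)"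
    have \<theta>: "0 < \<theta>" using s \<epsilon> by (simp add: \<theta>_def)
    define \<theta>' where "\<theta>' = s\<^sup>2 / (4 * (C + 1)\<^sup>2)"
    have \<theta>': "0 < \<theta>'" using s C0 by (simp add: \<theta>'_def)
    have "eventually (\<lambda>n. norm_moment (P n) (d n) 2 4 / of_nat n < ennreal \<theta>) sequentially"
      using \<theta> by (intro order_tendstoD(2)[OF rate4]) simp
    moreover have "eventually (\<lambda>n. of_nat (d n) ^ 4 / of_nat n < ennreal \<theta>') sequentially"
      using \<theta>' by (intro order_tendstoD(2)[OF rated]) simp
    ultimately have "eventually (\<lambda>n. 1 \<le> n \<and> norm_moment (P n) (d n) 2 4 / of_nat n < ennreal \<theta>
        \<and> of_nat (d n) ^ 4 / of_nat n < ennreal \<theta>') sequentially"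
      using eventually_ge_at_top[of 1] by eventually_elim auto
    then obtain N where N: "\<And>n. N \<le> n \<Longrightarrow> 1 \<le> n \<and> norm_moment (P n) (d n) 2 4 / of_nat n < ennreal \<theta>
        \<and> of_nat (d n) ^ 4 / of_nat n < ennreal \<theta>'"
      unfolding eventually_sequentially by blast
    show "\<exists>N. \<forall>n\<ge>N. {x \<in> space (M n). \<epsilon> \<le> \<bar>f n x\<bar>} \<in> sets (M n)
        \<and> measure (M n) {x \<in> space (M n). \<epsilon> \<le> \<bar>f n x\<bar>} < \<epsilon>"
    proof (intro exI[of _ N] allI impI)
      fix n assume "N \<le> n"
      from N[OF this] have n: "1 \<le> n" and m4: "norm_moment (P n) (d n) 2 4 / of_nat n < ennreal \<theta>"
        and d4: "of_nat (d n) ^ 4 / of_nat n < ennreal \<theta>'" by auto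
      have d: "1 \<le> d n" using d_pos[OF n] .
      interpret M: prob_space "M n" using prob[OF n] .
      let ?P = "P n" and ?J = "{1..n}"
      have rv: "Z n i \<in> measurable (M n) (vec_borel (d n))" if "i \<in> ?J" for i
        using Z_indep[OF n] that by (auto simp: M.indep_vars_def)
      have PZ: "?P = distr (M n) (vec_borel (d n)) (Z n 1)" using Z_law[OF n, of 1] n by simp
      have Pp: "prob_space ?P" unfolding PZ using rv n by (intro M.prob_space_distr) auto
      have Ps: "sets ?P = sets (vec_borel (d n))" unfolding PZ by simp
      have P1: "centred_law (d n) ?P (\<lambda>z. z)"
        by (rule centred_finite_cov_imp_centred_law[OF Pp Ps Z_centred[OF n]])
      have nm: "(\<lambda>z. (nsq (d n) z)\<^sup>2) \<in> borel_measurable ?P"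
        by (intro borel_measurable_power nsq_measurable centred_lawD(2)[OF P1])
      have fin: "norm_moment ?P (d n) 2 4 < \<infinity>"
      proof (rule ccontr)
        assume "\<not> norm_moment ?P (d n) 2 4 < \<infinity>"
        then have "norm_moment ?P (d n) 2 4 / of_nat n = \<infinity>"
          by (simp add: less_top[symmetric] ennreal_top_divide)
        then show False using m4 by simp
      qed
      have i4: "integrable ?P (\<lambda>z. (nsq (d n) z)\<^sup>2)"
        using nm fin by (intro integrableI_bounded) (auto simp: norm_moment_2_4)
      define I4 where "I4 = (\<integral>z. (nsq (d n) z)\<^sup>2 \<partial>?P)"
      have I40: "0 \<le> I4" by (simp add: I4_def)
      have "norm_moment ?P (d n) 2 4 = ennreal I4"
        unfolding norm_moment_2_4 I4_def using i4 by (intro nn_integral_eq_integral) auto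
      then have "ennreal (I4 / n) < ennreal \<theta>"
        using m4 n I40 by (simp add: divide_ennreal ennreal_of_nat_eq_real_of_nat)
      then have r\<theta>: "I4 / n < \<theta>" using I40 by (simp add: ennreal_less_iff)
      have r4: "I4 \<le> n * s\<^sup>2"
      proof -
        have "I4 / n \<le> s\<^sup>2" using r\<theta> by (simp add: \<theta>_def)
        then show ?thesis using n by (simp add: pos_divide_le_eq mult.commute)
      qed
      have dn: "4 * ((C + 1) * d n)\<^sup>2 / n \<le> s\<^sup>2"
      proof -
        have "of_nat (d n) ^ 4 / (of_nat n :: ennreal) = ennreal (real (d n) ^ 4 / n)"
          using n by (simp add: divide_ennreal ennreal_of_nat_eq_real_of_nat ennreal_power)
        then have "real (d n) ^ 4 / n < \<theta>'" using d4 by (simp add: ennreal_less_iff)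
        then have "real (d n) ^ 4 / n * (4 * (C + 1)\<^sup>2) \<le> s\<^sup>2"
          using C0 by (simp add: \<theta>'_def pos_less_divide_eq)
        moreover have "4 * ((C + 1) * d n)\<^sup>2 / n \<le> real (d n) ^ 4 / n * (4 * (C + 1)\<^sup>2)"
        proof -
          have "(real (d n))\<^sup>2 \<le> real (d n) ^ 4" using d by (intro power_increasing) auto
          then have "(4 * (C + 1)\<^sup>2) * (real (d n))\<^sup>2 / n \<le> (4 * (C + 1)\<^sup>2) * real (d n) ^ 4 / n"
            by (intro divide_right_mono mult_left_mono) auto
          then show ?thesis by (simp add: power_mult_distrib mult_ac)
        qed
        ultimately show ?thesis by simp
      qed
      have sym: "cov_entry ?P k l = cov_entry ?P l k" for k l by (simp add: cov_entry_def mult.commute)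
      have ev: "c \<le> e \<and> e \<le> C" if "eigenvalue (mat (d n) (d n) (\<lambda>(k, l). cov_entry ?P k l)) e" for e
        using Z_i_eigenvalues[OF n] that by (simp add: second_moment_mat_eq)
      have low: "c * nsq (d n) v \<le> (\<integral>x. (ip (d n) v x)\<^sup>2 \<partial>?P)"
          and upp: "(\<integral>x. (ip (d n) v x)\<^sup>2 \<partial>?P) \<le> C * nsq (d n) v" for v
        unfolding integral_ip_sq[OF P1]
        using quadratic_form_eigenvalue_bounds[where S = "cov_entry ?P", OF d sym ev] by auto
      have ZnM: "Zn n \<in> measurable (M n) (data_borel n (d n))"
        and KM: "Pstar n \<in> measurable (data_borel n (d n)) (prob_algebra (weight_borel n))"
        using weights_law[OF n] by (auto simp: regular_cond_law_def)
      let ?PP = "PiM ?J (\<lambda>_. ?P)"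
      have sPP: "sets ?PP = sets (data_borel n (d n))"
        unfolding data_borel_def by (intro sets_PiM_cong) (auto simp: Ps)
      have law: "distr (M n) (data_borel n (d n)) (Zn n) = ?PP"
      proof -
        have "distr (M n) (data_borel n (d n)) (Zn n) = PiM ?J (\<lambda>i. distr (M n) (vec_borel (d n)) (Z n i))"
          unfolding data_borel_def Zn_def
          using Z_indep[OF n] n rv by (subst M.indep_vars_iff_distr_eq_PiM'[symmetric]) auto
        also have "\<dots> = ?PP" using Z_law[OF n] by (intro PiM_cong) auto
        finally show ?thesis .
      qed
      have ZnP: "Zn n \<in> measurable (M n) ?PP"
        using ZnM unfolding measurable_cong_sets[OF refl sPP] .
      have law_measure: "measure ?PP B = measure (M n) (Zn n -` B \<inter> space (M n))" if "B \<in> sets ?PP" for B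
        using measure_distr[OF ZnM that[unfolded sPP]] unfolding law .
      have zc: "(\<lambda>z. z i l) \<in> borel_measurable (data_borel n (d n))" if "i \<in> ?J" "l < d n" for i l
        using sample_component_measurable[OF P1 that] unfolding measurable_cong_sets[OF sPP refl] .
      have Sm: "S n \<in> borel_measurable (data_borel n (d n))"
        unfolding S_def by (intro nsq_measurable borel_measurable_sum borel_measurable_divide borel_measurable_const zc)
      have SmP: "S n \<in> borel_measurable ?PP"
        using Sm unfolding measurable_cong_sets[OF sPP refl] .
      have Ym: "case_prod (Y n) \<in> borel_measurable (data_borel n (d n) \<Otimes>\<^sub>M weight_borel n)"
      proof -
        have wc: "(\<lambda>w. w i) \<in> borel_measurable (weight_borel n)" if "i \<in> ?J" for i
          unfolding weight_borel_def using that by (rule measurable_component_singleton)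
        show ?thesis
          unfolding Y_def gsum_def scaled_def split_beta'
          by (intro nsq_measurable borel_measurable_sum borel_measurable_times borel_measurable_divide borel_measurable_const
              measurable_compose[OF measurable_fst zc] measurable_compose[OF measurable_snd wc])
      qed
      have fm [measurable]: "f n \<in> borel_measurable (M n)"
        unfolding f_def
        by (rule SUP_tail_difference_measurable[OF ZnM KM Ym M.prob_space_axioms measurable_compose[OF ZnM Sm]])
      have tailP: "measure (M n) {y \<in> space (M n). t \<le> S n (Zn n y)} = measure ?PP {x \<in> space ?PP. t \<le> S n x}" for t
      proof -
        have "{x \<in> space ?PP. t \<le> S n x} \<in> sets ?PP" using SmP by simp
        then have "measure ?PP {x \<in> space ?PP. t \<le> S n x} = measure (M n) (Zn n -` {x \<in> space ?PP. t \<le> S n x} \<inter> space (M n))"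
          by (rule law_measure)
        also have "Zn n -` {x \<in> space ?PP. t \<le> S n x} \<inter> space (M n) = {y \<in> space (M n). t \<le> S n (Zn n y)}"
          using measurable_space[OF ZnP] by auto
        finally show ?thesis ..
      qed
      define bad where "bad = {x \<in> space (M n). s\<^sup>2 \<le> sample_dev n (d n) ?P (Zn n x)}"
      have dm: "sample_dev n (d n) ?P \<in> borel_measurable ?PP" by (rule sample_dev_measurable[OF P1])
      have badm: "bad \<in> sets (M n)"
        unfolding bad_def using measurable_compose[OF ZnP dm] by simp
      have badP: "measure (M n) bad \<le> \<epsilon> / 2"
      proof -
        have "{z \<in> space ?PP. s\<^sup>2 \<le> sample_dev n (d n) ?P z} \<in> sets ?PP" using dm by simp
        then have "measure ?PP {z \<in> space ?PP. s\<^sup>2 \<le> sample_dev n (d n) ?P z}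
          = measure (M n) (Zn n -` {z \<in> space ?PP. s\<^sup>2 \<le> sample_dev n (d n) ?P z} \<inter> space (M n))"
          by (rule law_measure)
        also have "Zn n -` {z \<in> space ?PP. s\<^sup>2 \<le> sample_dev n (d n) ?P z} \<inter> space (M n) = bad"
          unfolding bad_def using measurable_space[OF ZnP] by auto
        finally have "measure (M n) bad = measure ?PP {z \<in> space ?PP. s\<^sup>2 \<le> sample_dev n (d n) ?P z}" ..
        also have "\<dots> \<le> 2 * (I4 / n) / s\<^sup>2"
          unfolding I4_def using s by (intro sample_dev_markov[OF n P1 i4]) simp
        also have "\<dots> \<le> 2 * (s\<^sup>2 * \<epsilon> / 4) / s\<^sup>2"
        proof (intro divide_right_mono mult_left_mono)
          show "I4 / n \<le> s\<^sup>2 * \<epsilon> / 4" using r\<theta> unfolding \<theta>_def by linarith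
        qed auto
        also have "\<dots> = \<epsilon> / 2" using s by simp
        finally show ?thesis .
      qed
      have ae: "AE x in M n. \<epsilon> \<le> \<bar>f n x\<bar> \<longrightarrow> x \<in> bad"
        using W_i[OF n] W_ii[OF n] AE_space
      proof eventually_elim
        case (elim x)
        show ?case
        proof (rule impI, rule ccontr)
          assume large: "\<epsilon> \<le> \<bar>f n x\<bar>" and "x \<notin> bad"
          then have dev: "sample_dev n (d n) ?P (Zn n x) \<le> s\<^sup>2" using elim by (simp add: bad_def)
          let ?Q = "Pstar n (Zn n x)"
          have "?Q \<in> space (prob_algebra (weight_borel n))"
            using measurable_space[OF KM measurable_space[OF ZnM]] elim by simp
          then have Q: "prob_space ?Q" "sets ?Q = sets (weight_borel n)"
            by (auto simp: space_prob_algebra)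
          have spQ: "space (weight_borel n) = space ?Q" using sets_eq_imp_space_eq[OF Q(2)] by simp
          have wq: "(\<integral>\<^sup>+w. ennreal (\<bar>w i\<bar> powr q) \<partial>?Q) \<le> ennreal Cw" if "i \<in> ?J" for i
            using elim(2) that by blast
          have Cw0: "0 \<le> Cw" using W_ii_const by simp
          have bound: "\<bar>measure ?Q {w \<in> space (weight_borel n). t \<le> Y n (Zn n x) w}
            - measure (M n) {y \<in> space (M n). t \<le> S n (Zn n y)}\<bar> \<le> 2 * small_ball_bound (c / 2) (3 * \<delta>)
                + s * A / \<delta> ^ 4" for t
            unfolding tailP unfolding spQ Y_def S_def A_def
            by (rule tail_comparison_good_sample[OF n d P1 i4 low upp Z_i_const Q elim(1) q4 Cw0 wq \<delta> s dev r4[unfolded I4_def] dn])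
          have "f n x \<le> 2 * small_ball_bound (c / 2) (3 * \<delta>) + s * A / \<delta> ^ 4"
            unfolding f_def by (rule cSUP_least) (auto intro: bound)
          moreover have "0 \<le> f n x"
            unfolding f_def
            by (rule cSUP_upper2[where x = 0]) (auto intro!: bdd_aboveI2[where M = "2 * small_ball_bound (c / 2) (3 * \<delta>)
                + s * A / \<delta> ^ 4"] bound)
          ultimately have "\<bar>f n x\<bar> \<le> \<epsilon> / 2" using conc sA by linarith
          then show False using large \<epsilon> by simp
        qed
      qed
      have meas: "{x \<in> space (M n). \<epsilon> \<le> \<bar>f n x\<bar>} \<in> sets (M n)" by measurable
      have "measure (M n) {x \<in> space (M n). \<epsilon> \<le> \<bar>f n x\<bar>} \<le> measure (M n) bad"
        using ae badm by (intro M.finite_measure_mono_AE) auto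
      then have "measure (M n) {x \<in> space (M n). \<epsilon> \<le> \<bar>f n x\<bar>} < \<epsilon>" using badP \<epsilon> by simp
      with meas show "{x \<in> space (M n). \<epsilon> \<le> \<bar>f n x\<bar>} \<in> sets (M n) \<and> measure (M n) {x \<in> space (M n). \<epsilon>
          \<le> \<bar>f n x\<bar>} < \<epsilon>" ..
    qed
  qed
  then show ?thesis unfolding f_def Yeq[symmetric] Seq[symmetric] by simp
qed

end
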